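(* The space $\operatorname{Diff}_0(\mathbb{T}^4)$ admits a HyperKähler structure $(\operatorname{Diff}_0(\mathbb{T}^4),G,I,J,K)$, where $G$ is a scalar product compatible with all the complex structures $I$, $J$ and $K$ (whether they act on the left or on the right). Denote by $\Omega_I$, $\Omega_J$ and $\Omega_K$ the Kähler forms associated with $I$, $J$ and $K$ acting on the left. This HyperKähler structure is invariant under the action of $\operatorname{Ham}(\mathbb{T}^4,\omega)$ by precomposition. Moreover, the action of $\operatorname{Ham}(\mathbb{T}^4,\omega)$ is Hamiltonian with respect to each $\Omega_\bullet$, $\bullet\in\{I,J,K\}$, and the moment map associated with $\Omega_\bullet$ is $$\mu_\bullet(f):=-\frac{1}{\mathrm{vol}}\left(f^*\omega_\bullet\wedge\omega\right),$$ where $\mathrm{vol}=-\frac12\,\omega\wedge\omega=dx_1\wedge dx_2\wedge dx_3\wedge dx_4$ (locally) is the volume form associated with $\omega$. The zeros of $\underline{\mu}:=(\mu_I,\mu_J,\mu_K)$ are exactly the symplectomorphisms of $\operatorname{Symp}(\mathbb{T}^4,\omega)$.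
   Context: $\mathbb{T}^4=\mathbb{H}/\Lambda$, where $\mathbb{H}=\{x_1+ix_2+jx_3+kx_4\}$ is the space of quaternions ($i^2=j^2=k^2=ijk=-1$) and $\Lambda$ is a lattice acting by translation. It carries the flat metric $g=|dq|^2$ and the symplectic form $\omega=dx_1\wedge dx_3+dx_2\wedge dx_4=g(\cdot J,\cdot)$ (in local coordinates), where $XJ$ denotes right multiplication of the tangent vector $X$ by $j$. Left multiplication by $i,j,k$ on tangent spaces gives complex structures $I,J,K$ and Kähler forms $\omega_\bullet=g(\bullet\,\cdot,\cdot)$, $\bullet\in\{I,J,K\}$; each $\omega_\bullet$ induces the orientation of $\mathbb{T}^4$ opposite to that of $\omega$. $\operatorname{Diff}_0(\mathbb{T}^4)$ is the space of diffeomorphisms of $\mathbb{T}^4$ homotopic to the identity; the maps $\mu_\bullet$ are defined on it. Its tangent space at $f$ is the space of maps $u:\mathbb{T}^4\to T\mathbb{T}^4$ lying over $f$; each is uniquely $f_*X:=df\circ X$ with $X$ a vector field on $\mathbb{T}^4$. The complex structures act pointwise on such $u$: $(\bullet u)_x=\bullet_{f(x)}u_x$. The scalar product is $G(u,v)=\int_{\mathbb{T}^4}g(u,v)\,\mathrm{vol}$, and $\Omega_\bullet(u,v)=G(\bullet u,v)=\int_{\mathbb{T}^4}\omega_\bullet(u,v)\,\mathrm{vol}$. $\operatorname{Symp}(\mathbb{T}^4,\omega)$ is the group of diffeomorphisms $\varphi$ with $\varphi^*\omega=\omega$; $\operatorname{Ham}(\mathbb{T}^4,\omega)$ is its subgroup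 of Hamiltonian diffeomorphisms, acting by $f\mapsto f\circ\varphi$. Its Lie algebra is identified with $\mathcal{C}^\infty_0(\mathbb{T}^4)$, the smooth functions $h$ with $\int_{\mathbb{T}^4} h\,\mathrm{vol}=0$, via $h\mapsto X_h$ with $\iota_{X_h}\omega=-dh$; the infinitesimal action at $f$ is $f_*X_h$. Convention: $\mu_\bullet$ is a moment map for $\Omega_\bullet$ if $\Omega_\bullet(f_*X_h,f_*Y)=-\int_{\mathbb{T}^4}D_f\mu_\bullet(f_*Y)\,h\,\mathrm{vol}$ for all $f$, $h$, $Y$, and $\mu_\bullet(f\circ\varphi)=\mu_\bullet(f)\circ\varphi$ for all $\varphi\in\operatorname{Ham}(\mathbb{T}^4,\omega)$. For a $4$-form $\eta$, $\frac{1}{\mathrm{vol}}\eta$ denotes the function $h$ with $\eta=h\,\mathrm{vol}$.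
   Formalization: The moment map convention is taken with opposite sign, Ω(f_*X_h,f_*Y)=+∫D_fμ(f_*Y) h vol; with the minus sign the claim fails, e.g. on R^4/Z^4 for f=id, •=I, h=sin 2πx_4, Y=cos(2πx_4)∂_1, where both integrals equal π. *)

theory Defs
  imports "HOL-Analysis.Analysis"
begin

section \<open>Quaternions\<close>

text \<open>The quaternion \<open>x1 + i x2 + j x3 + k x4\<close> is the vector \<open>(x1, x2, x3, x4)\<close>; the standard
  inner product and the Lebesgue measure of \<open>real^4\<close> are \<open>|dq|\<^sup>2\<close> and \<open>dx1 dx2 dx3 dx4\<close>.\<close>

type_synonym quat = "real^4"

definition qmult :: "quat \<Rightarrow> quat \<Rightarrow> quat"  (infixl "\<cdot>\<^sub>H" 75) where
  "p \<cdot>\<^sub>H q = vector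
    [p$1 * q$1 - p$2 * q$2 - p$3 * q$3 - p$4 * q$4,
     p$1 * q$2 + p$2 * q$1 + p$3 * q$4 - p$4 * q$3,
     p$1 * q$3 - p$2 * q$4 + p$3 * q$1 + p$4 * q$2,
     p$1 * q$4 + p$2 * q$3 - p$3 * q$2 + p$4 * q$1]"

lemma vector_4:
  "(vector [a, b, c, d] :: 'a::zero^4) $ 1 = a" "(vector [a, b, c, d] :: 'a^4) $ 2 = b"
  "(vector [a, b, c, d] :: 'a^4) $ 3 = c" "(vector [a, b, c, d] :: 'a^4) $ 4 = d"
  by (simp_all add: vector_def)

definition qi :: quat where "qi = axis 2 1"
definition qj :: quat where "qj = axis 3 1"
definition qk :: quat where "qk = axis 4 1"

section \<open>Smooth maps between Euclidean spaces\<close>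

text \<open>For open \<open>S\<close>: \<open>f\<close> is \<open>k\<close> times differentiable on \<open>S\<close>, with continuous \<open>k\<close>-th derivatives.\<close>

primrec k_smooth_on ::
  "nat \<Rightarrow> 'a::euclidean_space set \<Rightarrow> ('a \<Rightarrow> 'b::real_normed_vector) \<Rightarrow> bool" where
  "k_smooth_on 0 S f \<longleftrightarrow> continuous_on S f"
| "k_smooth_on (Suc k) S f \<longleftrightarrow>
     (\<forall>x\<in>S. f differentiable (at x)) \<and>
     (\<forall>v. k_smooth_on k S (\<lambda>x. frechet_derivative f (at x) v))"

definition smooth_on :: "'a::euclidean_space set \<Rightarrow> ('a \<Rightarrow> 'b::real_normed_vector) \<Rightarrow> bool" where
  "smooth_on S f \<longleftrightarrow> (\<forall>k. k_smooth_on k S f)"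

primrec iter_deriv ::
  "'a::euclidean_space list \<Rightarrow> ('a \<Rightarrow> 'b::real_normed_vector) \<Rightarrow> 'a \<Rightarrow> 'b" where
  "iter_deriv [] f = f"
| "iter_deriv (v # vs) f = (\<lambda>x. frechet_derivative (iter_deriv vs f) (at x) v)"

section \<open>The torus \<open>H / \<Lambda>\<close>\<close>

definition lattice_basis :: "quat set \<Rightarrow> (4 \<Rightarrow> quat) \<Rightarrow> bool" where
  "lattice_basis \<Lambda> b \<longleftrightarrow>
     inj b \<and> independent (range b) \<and>
     \<Lambda> = range (\<lambda>n :: 4 \<Rightarrow> int. \<Sum>i\<in>UNIV. of_int (n i) *\<^sub>R b i)"

definition full_lattice :: "quat set \<Rightarrow> bool" where
  "full_lattice \<Lambda> \<longleftrightarrow> (\<exists>b. lattice_basis \<Lambda> b)"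

text \<open>Points of the torus are cosets of \<open>\<Lambda>\<close>.  Maps defined on the torus are total functions on
  \<open>quat set\<close> whose values outside the torus are irrelevant.\<close>

type_synonym point = "quat set"

definition proj :: "quat set \<Rightarrow> quat \<Rightarrow> point" where
  "proj \<Lambda> x = (\<lambda>l. x + l) ` \<Lambda>"

definition torus :: "quat set \<Rightarrow> point set" where
  "torus \<Lambda> = range (proj \<Lambda>)"

definition torus_topology :: "quat set \<Rightarrow> point topology" where
  "torus_topology \<Lambda> = topology (\<lambda>U. U \<subseteq> torus \<Lambda> \<and> open {x. proj \<Lambda> x \<in> U})"

text \<open>Guards against \<open>topology\<close> being applied to a predicate that is not a topology.\<close>

lemma openin_torus_topology:
  "openin (torus_topology \<Lambda>) U \<longleftrightarrow> U \<subseteq> torus \<Lambda> \<and> open {x. proj \<Lambda> x \<in> U}"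
proof -
  have *: "{x. proj \<Lambda> x \<in> S \<inter> T} = {x. proj \<Lambda> x \<in> S} \<inter> {x. proj \<Lambda> x \<in> T}"
    "{x. proj \<Lambda> x \<in> \<Union>\<K>} = (\<Union>K\<in>\<K>. {x. proj \<Lambda> x \<in> K})" for S T :: "point set" and \<K>
    by auto
  have "istopology (\<lambda>U. U \<subseteq> torus \<Lambda> \<and> open {x. proj \<Lambda> x \<in> U})"
    unfolding istopology_def * by (auto intro: open_Int)
  then show ?thesis
    unfolding torus_topology_def by (simp add: topology_inverse')
qed

text \<open>The tangent bundle is trivialised by translations: a tangent vector at a point is a
  quaternion, and vector fields on the torus, as well as tangent vectors to the diffeomorphism
  group at a map \<open>f\<close> (fields along \<open>f\<close>), are functions from the torus to the quaternions.\<close>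

type_synonym field = "point \<Rightarrow> quat"

definition smooth_fun :: "quat set \<Rightarrow> (point \<Rightarrow> 'b::real_normed_vector) \<Rightarrow> bool" where
  "smooth_fun \<Lambda> h \<longleftrightarrow> smooth_on UNIV (\<lambda>x. h (proj \<Lambda> x))"

definition fields :: "quat set \<Rightarrow> field set" where
  "fields \<Lambda> = {u. smooth_fun \<Lambda> u}"

definition dfun :: "quat set \<Rightarrow> (point \<Rightarrow> real) \<Rightarrow> point \<Rightarrow> quat \<Rightarrow> real" where
  "dfun \<Lambda> h p v = frechet_derivative (\<lambda>x. h (proj \<Lambda> x)) (at (SOME x. proj \<Lambda> x = p)) v"

text \<open>The local inverses of \<open>proj \<Lambda>\<close> are the charts of the torus; local lifts are thus the
  coordinate expressions of maps between tori.\<close>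

definition local_lift ::
  "quat set \<Rightarrow> (point \<Rightarrow> point) \<Rightarrow> quat set \<Rightarrow> (quat \<Rightarrow> quat) \<Rightarrow> bool" where
  "local_lift \<Lambda> f U F \<longleftrightarrow>
     open U \<and> smooth_on U F \<and> (\<forall>x\<in>U. proj \<Lambda> (F x) = f (proj \<Lambda> x))"

definition smooth_map :: "quat set \<Rightarrow> (point \<Rightarrow> point) \<Rightarrow> bool" where
  "smooth_map \<Lambda> f \<longleftrightarrow> (\<forall>x. \<exists>U F. x \<in> U \<and> local_lift \<Lambda> f U F)"

definition dmap :: "quat set \<Rightarrow> (point \<Rightarrow> point) \<Rightarrow> point \<Rightarrow> quat \<Rightarrow> quat" where
  "dmap \<Lambda> f p v =
     (THE w. \<exists>x U F. proj \<Lambda> x = p \<and> x \<in> U \<and> local_lift \<Lambda> f U F \<and>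
                     w = frechet_derivative F (at x) v)"

definition push :: "quat set \<Rightarrow> (point \<Rightarrow> point) \<Rightarrow> field \<Rightarrow> field" where
  "push \<Lambda> f X = (\<lambda>p. dmap \<Lambda> f p (X p))"

definition diffeo :: "quat set \<Rightarrow> (point \<Rightarrow> point) \<Rightarrow> bool" where
  "diffeo \<Lambda> f \<longleftrightarrow>
     bij_betw f (torus \<Lambda>) (torus \<Lambda>) \<and> smooth_map \<Lambda> f \<and>
     smooth_map \<Lambda> (inv_into (torus \<Lambda>) f)"

definition Diff0 :: "quat set \<Rightarrow> (point \<Rightarrow> point) set" where
  "Diff0 \<Lambda> = {f. diffeo \<Lambda> f \<and>
                 homotopic_with (\<lambda>_. True) (torus_topology \<Lambda>) (torus_topology \<Lambda>) f id}"

text \<open>Integration against \<open>vol\<close>, over the half-open fundamental parallelepiped of a basis of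
  \<open>\<Lambda>\<close>; the result does not depend on the basis.\<close>

definition fundamental_domain :: "(4 \<Rightarrow> quat) \<Rightarrow> quat set" where
  "fundamental_domain b = {\<Sum>i\<in>UNIV. t i *\<^sub>R b i | t. \<forall>i. 0 \<le> t i \<and> t i < (1::real)}"

definition torus_integral :: "quat set \<Rightarrow> (point \<Rightarrow> real) \<Rightarrow> real" where
  "torus_integral \<Lambda> h =
     (LINT x : fundamental_domain (SOME b. lattice_basis \<Lambda> b) | lborel. h (proj \<Lambda> x))"

section \<open>Differential forms\<close>

type_synonym form2 = "point \<Rightarrow> quat \<Rightarrow> quat \<Rightarrow> real"
type_synonym form4 = "point \<Rightarrow> quat \<Rightarrow> quat \<Rightarrow> quat \<Rightarrow> quat \<Rightarrow> real"

definition wedge :: "form2 \<Rightarrow> form2 \<Rightarrow> form4" where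
  "wedge \<alpha> \<beta> p a b c d =
     \<alpha> p a b * \<beta> p c d - \<alpha> p a c * \<beta> p b d + \<alpha> p a d * \<beta> p b c
   + \<alpha> p b c * \<beta> p a d - \<alpha> p b d * \<beta> p a c + \<alpha> p c d * \<beta> p a b"

definition pullback :: "quat set \<Rightarrow> (point \<Rightarrow> point) \<Rightarrow> form2 \<Rightarrow> form2" where
  "pullback \<Lambda> f \<alpha> p v w = \<alpha> (f p) (dmap \<Lambda> f p v) (dmap \<Lambda> f p w)"

definition omega :: form2 where
  "omega p v w = (v \<cdot>\<^sub>H qj) \<bullet> w"

lemma omega_coords:
  "omega p v w = (v$1 * w$3 - v$3 * w$1) + (v$2 * w$4 - v$4 * w$2)"
  by (simp add: omega_def qmult_def qj_def axis_def inner_vec_def sum_4 vector_4)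

definition omega_left :: "quat \<Rightarrow> form2" where
  "omega_left q p v w = (q \<cdot>\<^sub>H v) \<bullet> w"

definition vol :: form4 where
  "vol p a b c d = - (1/2) * wedge omega omega p a b c d"

definition div_vol :: "form4 \<Rightarrow> point \<Rightarrow> real" where
  "div_vol \<eta> p = (THE r. \<forall>a b c d. \<eta> p a b c d = r * vol p a b c d)"

section \<open>Symplectic and Hamiltonian diffeomorphisms\<close>

definition Symp :: "quat set \<Rightarrow> (point \<Rightarrow> point) set" where
  "Symp \<Lambda> = {\<phi>. diffeo \<Lambda> \<phi> \<and> (\<forall>p\<in>torus \<Lambda>. \<forall>v w. pullback \<Lambda> \<phi> omega p v w = omega p v w)}"

definition C0 :: "quat set \<Rightarrow> (point \<Rightarrow> real) set" where
  "C0 \<Lambda> = {h. smooth_fun \<Lambda> h \<and> torus_integral \<Lambda> h = 0}"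

definition ham_field :: "quat set \<Rightarrow> (point \<Rightarrow> real) \<Rightarrow> field" where
  "ham_field \<Lambda> h p = (THE v. \<forall>w. omega p v w = - dfun \<Lambda> h p w)"

definition smooth_isotopy :: "quat set \<Rightarrow> (real \<Rightarrow> point \<Rightarrow> point) \<Rightarrow> bool" where
  "smooth_isotopy \<Lambda> \<psi> \<longleftrightarrow>
     (\<forall>t. diffeo \<Lambda> (\<psi> t)) \<and>
     (\<forall>t x. \<exists>U F. (t, x) \<in> U \<and> open U \<and> smooth_on U F \<and>
              (\<forall>(s, y)\<in>U. proj \<Lambda> (F (s, y)) = \<psi> s (proj \<Lambda> y)))"

definition velocity :: "quat set \<Rightarrow> (real \<Rightarrow> point \<Rightarrow> point) \<Rightarrow> real \<Rightarrow> field" where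
  "velocity \<Lambda> \<psi> t p =
     (THE w. \<exists>x U F. proj \<Lambda> x = p \<and> (t, x) \<in> U \<and> open U \<and> smooth_on U F \<and>
              (\<forall>(s, y)\<in>U. proj \<Lambda> (F (s, y)) = \<psi> s (proj \<Lambda> y)) \<and>
              w = frechet_derivative F (at (t, x)) (1, 0))"

text \<open>Time-one maps of flows of smooth time-dependent Hamiltonians.\<close>

definition Ham :: "quat set \<Rightarrow> (point \<Rightarrow> point) set" where
  "Ham \<Lambda> = {\<phi>. \<exists>\<psi> h.
      smooth_on UNIV (\<lambda>(t :: real, x). h t (proj \<Lambda> x)) \<and> (\<forall>t. h t \<in> C0 \<Lambda>) \<and>
      smooth_isotopy \<Lambda> \<psi> \<and>
      (\<forall>p\<in>torus \<Lambda>. \<psi> 0 p = p \<and> \<psi> 1 p = \<phi> p) \<and>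
      (\<forall>t. \<forall>p\<in>torus \<Lambda>. velocity \<Lambda> \<psi> t p = ham_field \<Lambda> (h t) (\<psi> t p))}"

section \<open>Calculus on the Frechet manifold \<open>Diff0\<close>\<close>

text \<open>Convergence in the Frechet space of smooth functions on the torus: all iterated derivatives
  converge uniformly.\<close>

definition Cinf_lim ::
  "quat set \<Rightarrow> ('i \<Rightarrow> point \<Rightarrow> 'b::real_normed_vector) \<Rightarrow> (point \<Rightarrow> 'b) \<Rightarrow> 'i filter \<Rightarrow> bool" where
  "Cinf_lim \<Lambda> \<Phi> D F \<longleftrightarrow>
     (\<forall>\<^sub>F n in F. smooth_fun \<Lambda> (\<Phi> n)) \<and> smooth_fun \<Lambda> D \<and>
     (\<forall>vs. uniform_limit UNIV (\<lambda>n. iter_deriv vs (\<lambda>x. \<Phi> n (proj \<Lambda> x)))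
                              (iter_deriv vs (\<lambda>x. D (proj \<Lambda> x))) F)"

text \<open>\<open>u \<mapsto> shift f 1 u\<close> is the chart of \<open>Diff0\<close> centred at \<open>f\<close>.  In these charts a field along
  \<open>f\<close> extends to a constant vector field.\<close>

definition shift :: "(point \<Rightarrow> point) \<Rightarrow> real \<Rightarrow> field \<Rightarrow> point \<Rightarrow> point" where
  "shift f t u p = (\<lambda>y. y + t *\<^sub>R u p) ` f p"

text \<open>The derivative at \<open>f\<close> in the direction \<open>u\<close> of a map \<open>\<Phi>\<close> from \<open>Diff0\<close> to smooth functions on
  the torus.  Real-valued maps on \<open>Diff0\<close> are treated as maps to constant functions.\<close>

definition has_dir_deriv ::
  "quat set \<Rightarrow> ((point \<Rightarrow> point) \<Rightarrow> point \<Rightarrow> 'b::real_normed_vector) \<Rightarrow>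
   (point \<Rightarrow> point) \<Rightarrow> field \<Rightarrow> (point \<Rightarrow> 'b) \<Rightarrow> bool" where
  "has_dir_deriv \<Lambda> \<Phi> f u D \<longleftrightarrow>
     (\<forall>\<^sub>F t in at 0. shift f t u \<in> Diff0 \<Lambda>) \<and>
     Cinf_lim \<Lambda> (\<lambda>t p. (1 / t) *\<^sub>R (\<Phi> (shift f t u) p - \<Phi> f p)) D (at 0)"

text \<open>Smoothness on Frechet manifolds, for maps that depend on a point \<open>f\<close> of \<open>Diff0\<close> and
  (multilinearly) on a list of \<open>n\<close> tangent vectors at \<open>f\<close>: all iterated directional derivatives
  in \<open>f\<close> exist and are jointly continuous.  Sequential continuity suffices by metrisability.\<close>

type_synonym 'b tensor = "(point \<Rightarrow> point) \<Rightarrow> field list \<Rightarrow> point \<Rightarrow> 'b"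

definition tensor_continuous ::
  "quat set \<Rightarrow> nat \<Rightarrow> 'b::real_normed_vector tensor \<Rightarrow> bool" where
  "tensor_continuous \<Lambda> n \<Phi> \<longleftrightarrow>
     (\<forall>f\<in>Diff0 \<Lambda>. \<forall>us. \<forall>w :: nat \<Rightarrow> field. \<forall>uss :: nat \<Rightarrow> field list.
        length us = n \<longrightarrow> set us \<subseteq> fields \<Lambda> \<longrightarrow>
        (\<forall>m. w m \<in> fields \<Lambda> \<and> shift f 1 (w m) \<in> Diff0 \<Lambda> \<and>
             length (uss m) = n \<and> set (uss m) \<subseteq> fields \<Lambda>) \<longrightarrow>
        Cinf_lim \<Lambda> w (\<lambda>p. 0) sequentially \<longrightarrow>
        (\<forall>i<n. Cinf_lim \<Lambda> (\<lambda>m. uss m ! i) (us ! i) sequentially) \<longrightarrow>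
        Cinf_lim \<Lambda> (\<lambda>m. \<Phi> (shift f 1 (w m)) (uss m)) (\<Phi> f us) sequentially)"

primrec k_smooth_tensor ::
  "nat \<Rightarrow> quat set \<Rightarrow> nat \<Rightarrow> 'b::real_normed_vector tensor \<Rightarrow> bool" where
  "k_smooth_tensor 0 \<Lambda> n \<Phi> \<longleftrightarrow> tensor_continuous \<Lambda> n \<Phi>"
| "k_smooth_tensor (Suc k) \<Lambda> n \<Phi> \<longleftrightarrow>
     tensor_continuous \<Lambda> n \<Phi> \<and>
     (\<exists>\<Phi>'. (\<forall>f\<in>Diff0 \<Lambda>. \<forall>u us. u \<in> fields \<Lambda> \<longrightarrow> set us \<subseteq> fields \<Lambda> \<longrightarrow> length us = n \<longrightarrow>
                has_dir_deriv \<Lambda> (\<lambda>f. \<Phi> f us) f u (\<Phi>' f (u # us))) \<and>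
            k_smooth_tensor k \<Lambda> (Suc n) \<Phi>')"

definition smooth_tensor :: "quat set \<Rightarrow> nat \<Rightarrow> 'b::real_normed_vector tensor \<Rightarrow> bool" where
  "smooth_tensor \<Lambda> n \<Phi> \<longleftrightarrow> (\<forall>k. k_smooth_tensor k \<Lambda> n \<Phi>)"

section \<open>Hyperkaehler structures on \<open>Diff0\<close>\<close>

type_synonym bilin = "(point \<Rightarrow> point) \<Rightarrow> field \<Rightarrow> field \<Rightarrow> real"
type_synonym endo = "(point \<Rightarrow> point) \<Rightarrow> field \<Rightarrow> field"

definition riemannian_metric :: "quat set \<Rightarrow> bilin \<Rightarrow> bool" where
  "riemannian_metric \<Lambda> G \<longleftrightarrow>
     smooth_tensor \<Lambda> 2 (\<lambda>f us p. G f (us ! 0) (us ! 1)) \<and>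
     (\<forall>f\<in>Diff0 \<Lambda>. \<forall>u\<in>fields \<Lambda>. \<forall>v\<in>fields \<Lambda>. \<forall>w\<in>fields \<Lambda>. \<forall>a b.
        G f u v = G f v u \<and>
        G f (\<lambda>p. a *\<^sub>R u p + b *\<^sub>R v p) w = a * G f u w + b * G f v w \<and>
        G f u u \<ge> 0 \<and> (G f u u = 0 \<longrightarrow> (\<forall>p\<in>torus \<Lambda>. u p = 0)))"

definition almost_complex_structure :: "quat set \<Rightarrow> endo \<Rightarrow> bool" where
  "almost_complex_structure \<Lambda> A \<longleftrightarrow>
     smooth_tensor \<Lambda> 1 (\<lambda>f us. A f (us ! 0)) \<and>
     (\<forall>f\<in>Diff0 \<Lambda>. \<forall>u\<in>fields \<Lambda>. \<forall>v\<in>fields \<Lambda>. \<forall>a b.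
        A f u \<in> fields \<Lambda> \<and>
        (\<forall>p\<in>torus \<Lambda>.
           A f (\<lambda>p. a *\<^sub>R u p + b *\<^sub>R v p) p = a *\<^sub>R A f u p + b *\<^sub>R A f v p \<and>
           A f (A f u) p = - u p))"

text \<open>Vanishing of the Nijenhuis tensor
  \<open>[AU, AV] - A [AU, V] - A [U, AV] - [U, V]\<close>, evaluated on the constant vector fields \<open>U\<close>, \<open>V\<close>
  with values \<open>u\<close>, \<open>v\<close>; here \<open>[X, Y] = D Y X - D X Y\<close>, so \<open>[AU, V] = - D\<^sub>v (AU)\<close>.\<close>

definition integrable_structure :: "quat set \<Rightarrow> endo \<Rightarrow> bool" where
  "integrable_structure \<Lambda> A \<longleftrightarrow>
     (\<forall>f\<in>Diff0 \<Lambda>. \<forall>u\<in>fields \<Lambda>. \<forall>v\<in>fields \<Lambda>. \<exists>a b c d.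
        has_dir_deriv \<Lambda> (\<lambda>f. A f v) f (A f u) a \<and>
        has_dir_deriv \<Lambda> (\<lambda>f. A f u) f (A f v) b \<and>
        has_dir_deriv \<Lambda> (\<lambda>f. A f u) f v c \<and>
        has_dir_deriv \<Lambda> (\<lambda>f. A f v) f u d \<and>
        (\<forall>p\<in>torus \<Lambda>. (a p - b p) + A f c p - A f d p = 0))"

definition complex_structure :: "quat set \<Rightarrow> endo \<Rightarrow> bool" where
  "complex_structure \<Lambda> A \<longleftrightarrow> almost_complex_structure \<Lambda> A \<and> integrable_structure \<Lambda> A"

definition compatible :: "quat set \<Rightarrow> bilin \<Rightarrow> endo \<Rightarrow> bool" where
  "compatible \<Lambda> G A \<longleftrightarrow>
     (\<forall>f\<in>Diff0 \<Lambda>. \<forall>u\<in>fields \<Lambda>. \<forall>v\<in>fields \<Lambda>. G f (A f u) (A f v) = G f u v)"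

definition kaehler_form :: "bilin \<Rightarrow> endo \<Rightarrow> bilin" where
  "kaehler_form G A f u v = G f (A f u) v"

text \<open>\<open>d\<Omega> = 0\<close>, evaluated on constant (hence commuting) vector fields.\<close>

definition closed_form :: "quat set \<Rightarrow> bilin \<Rightarrow> bool" where
  "closed_form \<Lambda> \<Omega> \<longleftrightarrow>
     (\<forall>f\<in>Diff0 \<Lambda>. \<forall>u\<in>fields \<Lambda>. \<forall>v\<in>fields \<Lambda>. \<forall>w\<in>fields \<Lambda>. \<exists>a b c :: real.
        has_dir_deriv \<Lambda> (\<lambda>f p. \<Omega> f v w) f u (\<lambda>p. a) \<and>
        has_dir_deriv \<Lambda> (\<lambda>f p. \<Omega> f w u) f v (\<lambda>p. b) \<and>
        has_dir_deriv \<Lambda> (\<lambda>f p. \<Omega> f u v) f w (\<lambda>p. c) \<and>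
        a + b + c = 0)"

definition hyperkaehler :: "quat set \<Rightarrow> bilin \<Rightarrow> endo \<Rightarrow> endo \<Rightarrow> endo \<Rightarrow> bool" where
  "hyperkaehler \<Lambda> G I J K \<longleftrightarrow>
     riemannian_metric \<Lambda> G \<and>
     (\<forall>A\<in>{I, J, K}. complex_structure \<Lambda> A \<and> compatible \<Lambda> G A \<and>
                    closed_form \<Lambda> (kaehler_form G A)) \<and>
     (\<forall>f\<in>Diff0 \<Lambda>. \<forall>u\<in>fields \<Lambda>. \<forall>p\<in>torus \<Lambda>. I f (J f (K f u)) p = - u p)"

text \<open>The differential of \<open>f \<mapsto> f \<circ> \<phi>\<close> maps the field \<open>u\<close> along \<open>f\<close> to the field \<open>u \<circ> \<phi>\<close> along
  \<open>f \<circ> \<phi>\<close>.\<close>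

definition ham_invariant :: "quat set \<Rightarrow> bilin \<Rightarrow> endo \<Rightarrow> endo \<Rightarrow> endo \<Rightarrow> bool" where
  "ham_invariant \<Lambda> G I J K \<longleftrightarrow>
     (\<forall>\<phi>\<in>Ham \<Lambda>. \<forall>f\<in>Diff0 \<Lambda>. f \<circ> \<phi> \<in> Diff0 \<Lambda> \<and>
        (\<forall>u\<in>fields \<Lambda>. u \<circ> \<phi> \<in> fields \<Lambda> \<and>
           (\<forall>v\<in>fields \<Lambda>. G (f \<circ> \<phi>) (u \<circ> \<phi>) (v \<circ> \<phi>) = G f u v) \<and>
           (\<forall>A\<in>{I, J, K}. \<forall>p\<in>torus \<Lambda>. A (f \<circ> \<phi>) (u \<circ> \<phi>) p = A f u (\<phi> p))))"

text \<open>The sign: moment maps are normalised by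
  \<open>\<Omega> (f\<^sub>* X\<^sub>h) (f\<^sub>* Y) = \<integral> D\<^sub>f \<mu> (f\<^sub>* Y) h vol\<close>.  With \<open>\<omega>(X\<^sub>h, _) = - dh\<close> and
  \<open>vol = - \<omega> \<and> \<omega> / 2\<close> this is the sign that \<open>\<mu> f = - (f\<^sup>* \<omega>\<^sub>q \<and> \<omega>) / vol\<close> satisfies: for
  \<open>\<sigma> = f\<^sup>* \<omega>\<^sub>q\<close>, integration by parts and \<open>\<iota>\<^sub>X \<omega> \<and> \<omega> = - \<iota>\<^sub>X vol\<close> give
  \<open>\<integral> h d(\<iota>\<^sub>Y \<sigma>) \<and> \<omega> = - \<integral> \<sigma>(X\<^sub>h, Y) vol\<close>.  With the opposite
  sign the identity fails, e.g. for \<open>\<Lambda>\<close> the integer lattice, \<open>f = id\<close>, \<open>q = i\<close>,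
  \<open>h = sin (2 \<pi> x4)\<close>, \<open>Y = cos (2 \<pi> x4) \<partial>\<^sub>1\<close>, where \<open>D\<^sub>f \<mu> (f\<^sub>* Y) = 2 \<pi> sin (2 \<pi> x4)\<close> and both
  \<open>\<Omega> (f\<^sub>* X\<^sub>h) (f\<^sub>* Y)\<close> and \<open>\<integral> D\<^sub>f \<mu> (f\<^sub>* Y) h vol\<close> equal \<open>\<pi>\<close>.\<close>

definition moment_map ::
  "quat set \<Rightarrow> bilin \<Rightarrow> ((point \<Rightarrow> point) \<Rightarrow> point \<Rightarrow> real) \<Rightarrow> bool" where
  "moment_map \<Lambda> \<Omega> \<mu> \<longleftrightarrow>
     (\<forall>f\<in>Diff0 \<Lambda>. smooth_fun \<Lambda> (\<mu> f) \<and>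
        (\<forall>Y\<in>fields \<Lambda>. \<exists>D. has_dir_deriv \<Lambda> \<mu> f (push \<Lambda> f Y) D \<and>
           (\<forall>h\<in>C0 \<Lambda>. \<Omega> f (push \<Lambda> f (ham_field \<Lambda> h)) (push \<Lambda> f Y) =
                       torus_integral \<Lambda> (\<lambda>p. D p * h p)))) \<and>
     (\<forall>f\<in>Diff0 \<Lambda>. \<forall>\<phi>\<in>Ham \<Lambda>. \<forall>p\<in>torus \<Lambda>. \<mu> (f \<circ> \<phi>) p = \<mu> f (\<phi> p))"

section \<open>The structures on \<open>Diff0\<close>\<close>

definition L2_metric :: "quat set \<Rightarrow> bilin" where
  "L2_metric \<Lambda> f u v = torus_integral \<Lambda> (\<lambda>p. u p \<bullet> v p)"

definition left_op :: "quat \<Rightarrow> endo" where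
  "left_op q f u = (\<lambda>p. q \<cdot>\<^sub>H u p)"

definition right_op :: "quat \<Rightarrow> endo" where
  "right_op q f u = (\<lambda>p. u p \<cdot>\<^sub>H q)"

definition mu :: "quat set \<Rightarrow> quat \<Rightarrow> (point \<Rightarrow> point) \<Rightarrow> point \<Rightarrow> real" where
  "mu \<Lambda> q f p = - div_vol (wedge (pullback \<Lambda> f (omega_left q)) omega) p"

end

theory Submission
  imports Defs
begin

text \<open>In the charts \<open>u \<mapsto> f + u\<close> of the diffeomorphism group the metric and the complex structures
  are constant, because the torus is flat with translation-invariant structures.  All their
  derivatives along the group vanish, so the Nijenhuis tensors and the exterior derivatives of the
  Kaehler forms vanish too (\<open>constant_complex_structure\<close>, \<open>left_op_closed\<close>).  What needs an argument
  is that \<open>f + t u\<close> is again a diffeomorphism isotopic to the identity for small \<open>t\<close>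
  (\<open>shift_in_Diff0\<close>).

  Everything is computed on the universal cover.  A diffeomorphism of the torus homotopic to the
  identity is the same as a diffeomorphism \<open>F\<close> of \<open>\<real>\<^sup>4\<close> with \<open>F (x + l) = F x + l\<close> for lattice vectors
  \<open>l\<close>: lifting the homotopy in small steps gives \<open>F\<close> (\<open>Diff0_imp_cover_diffeo\<close>), and conversely
  the segment from \<open>F\<close> to the identity descends (\<open>cover_diffeo_imp_Diff0\<close>).  Integration by
  parts on the torus holds because the integral of a periodic function is invariant under
  translations (\<open>integral_derivative\<close>).

  Hamiltonian diffeomorphisms preserve \<open>\<omega>\<close>, since the Hessian of the Hamiltonian is symmetric
  (\<open>omega_constant_along_flow\<close>), hence they preserve the volume and the metric.

  Wedging with \<open>\<omega>\<close> contracts a 2-form with the bivector \<open>e1 \<and> e3 + e2 \<and> e4\<close>, so \<open>mu\<close> is the quadratic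
  expression \<open>\<omega>\<^sub>q(F\<^sub>1, F\<^sub>3) + \<omega>\<^sub>q(F\<^sub>2, F\<^sub>4)\<close> in the partial derivatives of the lift (\<open>mu_lift\<close>).  Its
  derivative in the direction \<open>u\<close> is the same contraction of \<open>d\<beta>\<close> with \<open>\<beta> = \<omega>\<^sub>q(u, dF)\<close>, and
  integrating it by parts against \<open>h\<close> produces \<open>\<omega>\<^sub>q(dF X\<^sub>h, u)\<close> (\<open>moment_map_identity\<close>).

  If all three moment maps vanish at \<open>f\<close> and \<open>g\<close> is the inverse of \<open>f\<close>, then \<open>\<omega>\<^sub>q \<and> g\<^sup>*\<omega> = 0\<close> for
  \<open>q = i, j, k\<close>; so \<open>\<gamma> = g\<^sup>*\<omega> - \<omega>\<close> is anti-self-dual, and \<open>\<gamma> \<and> \<gamma>\<close> is a nonpositive multiple of the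
  volume form.  But \<open>\<gamma>\<close> is exact, as \<open>g\<close> is homotopic to the identity, so \<open>\<gamma> \<and> \<gamma>\<close> has integral zero
  and \<open>\<gamma> = 0\<close> (\<open>mu_zero_imp_Symp\<close>).\<close>

section \<open>Calculus of smooth maps\<close>

abbreviation Df :: "('a::real_normed_vector \<Rightarrow> 'b::real_normed_vector) \<Rightarrow> 'a \<Rightarrow> 'a \<Rightarrow> 'b" where
  "Df f x \<equiv> frechet_derivative f (at x)"

abbreviation smooth :: "('a::euclidean_space \<Rightarrow> 'b::real_normed_vector) \<Rightarrow> bool" where
  "smooth \<equiv> smooth_on UNIV"

lemma frechet_derivative_eq:
  "(f has_derivative f') (at x) \<Longrightarrow> Df f x = f'"
  using frechet_derivative_at by metis

lemma k_smooth_on_cong: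
  assumes "open S" "\<And>x. x \<in> S \<Longrightarrow> f x = g x" "k_smooth_on k S f"
  shows "k_smooth_on k S g"
  using assms
proof (induction k arbitrary: f g)
  case 0
  then show ?case by (simp cong: continuous_on_cong)
next
  case (Suc k)
  have d: "(g has_derivative Df f x) (at x)" if "x \<in> S" for x
    using Suc.prems that frechet_derivative_works
    by (metis has_derivative_transform_within_open k_smooth_on.simps(2))
  then have eq: "Df g x = Df f x" if "x \<in> S" for x
    using frechet_derivative_at that by metis
  have "k_smooth_on k S (\<lambda>x. Df g x v)" for v
  proof (rule Suc.IH[OF assms(1), of "\<lambda>x. Df f x v"])
    show "k_smooth_on k S (\<lambda>x. Df f x v)"
      using Suc.prems(3) by simp
  qed (simp add: eq)
  then show ?case
    using d by (auto simp: differentiable_def)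
qed

text \<open>Smoothness is proved by exhibiting a derivative.  The class is closed under sums, bilinear products
  and composition because each derivative is again built by these operations from maps that are one
  degree less smooth.\<close>

lemma k_smooth_on_SucI:
  assumes "open S" "\<And>x. x \<in> S \<Longrightarrow> (f has_derivative f' x) (at x)"
    and "\<And>v. k_smooth_on k S (\<lambda>x. f' x v)"
  shows "k_smooth_on (Suc k) S f"
proof -
  have "Df f x = f' x" if "x \<in> S" for x
    using frechet_derivative_at assms(2) that by metis
  then have "k_smooth_on k S (\<lambda>x. Df f x v)" for v
    by (intro k_smooth_on_cong[OF assms(1) _ assms(3)[of v]]) auto
  then show ?thesis
    using assms(2) by (auto simp: differentiable_def)
qed

lemma k_smooth_on_has_derivative:
  assumes "k_smooth_on (Suc k) S f" "x \<in> S"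
  shows "(f has_derivative Df f x) (at x)"
  using assms by (simp add: frechet_derivative_works[symmetric])

lemma k_smooth_on_Suc_imp: "k_smooth_on (Suc k) S f \<Longrightarrow> k_smooth_on k S f"
proof (induction k arbitrary: f)
  case 0
  then show ?case
    by (auto intro!: differentiable_imp_continuous_on
        simp: differentiable_on_def differentiable_at_withinI)
next
  case (Suc k)
  then show ?case by (metis k_smooth_on.simps(2))
qed

lemma k_smooth_on_subset: "k_smooth_on k S f \<Longrightarrow> T \<subseteq> S \<Longrightarrow> k_smooth_on k T f"
  by (induction k arbitrary: f) (auto intro: continuous_on_subset)

lemma k_smooth_on_const: "k_smooth_on k S (\<lambda>x. c)"
  by (induction k arbitrary: c) auto

lemma k_smooth_on_add:
  assumes "open S" "k_smooth_on k S f" "k_smooth_on k S g"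
  shows "k_smooth_on k S (\<lambda>x. f x + g x)"
  using assms(2,3)
proof (induction k arbitrary: f g)
  case 0
  then show ?case by (simp add: continuous_on_add)
next
  case (Suc k)
  show ?case
  proof (rule k_smooth_on_SucI[OF assms(1)])
    show "((\<lambda>x. f x + g x) has_derivative
        (\<lambda>v. Df f x v + Df g x v)) (at x)" if "x \<in> S" for x
      using that Suc.prems by (intro has_derivative_add k_smooth_on_has_derivative)
  qed (use Suc in auto)
qed

lemma k_smooth_on_bounded_linear:
  assumes "open S" "bounded_linear L" "k_smooth_on k S f"
  shows "k_smooth_on k S (\<lambda>x. L (f x))"
  using assms(3)
proof (induction k arbitrary: f)
  case 0
  then have "continuous_on S f" by simp
  from bounded_linear.continuous_on[OF assms(2) this] show ?case by simp
next
  case (Suc k)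
  show ?case
  proof (rule k_smooth_on_SucI[OF assms(1)])
    show "((\<lambda>x. L (f x)) has_derivative (\<lambda>v. L (Df f x v))) (at x)" if "x \<in> S" for x
      by (rule bounded_linear.has_derivative[OF assms(2) k_smooth_on_has_derivative[OF Suc.prems that]])
  qed (use Suc in auto)
qed

lemma k_smooth_on_bilinear:
  assumes "open S" "bounded_bilinear B" "k_smooth_on k S f" "k_smooth_on k S g"
  shows "k_smooth_on k S (\<lambda>x. B (f x) (g x))"
  using assms(3,4)
proof (induction k arbitrary: f g)
  case 0
  then have "continuous_on S f" "continuous_on S g" by simp_all
  from bounded_bilinear.continuous_on[OF assms(2) this] show ?case by simp
next
  case (Suc k)
  show ?case
  proof (rule k_smooth_on_SucI[OF assms(1)])
    show "((\<lambda>x. B (f x) (g x)) has_derivative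
        (\<lambda>v. B (f x) (Df g x v) + B (Df f x v) (g x))) (at x)"
      if "x \<in> S" for x
      by (rule bounded_bilinear.FDERIV[OF assms(2) k_smooth_on_has_derivative[OF Suc.prems(1) that]
            k_smooth_on_has_derivative[OF Suc.prems(2) that]])
    fix v
    have "k_smooth_on k S f" "k_smooth_on k S g"
      using Suc.prems by (simp_all only: k_smooth_on_Suc_imp)
    moreover have "k_smooth_on k S (\<lambda>x. Df f x v)"
      "k_smooth_on k S (\<lambda>x. Df g x v)"
      using Suc.prems by simp_all
    ultimately show "k_smooth_on k S
        (\<lambda>x. B (f x) (Df g x v) + B (Df f x v) (g x))"
      by (intro k_smooth_on_add assms(1) Suc.IH)
  qed
qed

lemma k_smooth_on_sum:
  assumes "open S" "\<And>i. i \<in> I \<Longrightarrow> k_smooth_on k S (f i)"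
  shows "k_smooth_on k S (\<lambda>x. \<Sum>i\<in>I. f i x)"
proof (cases "finite I")
  case True
  then show ?thesis using assms(2)
    by (induction I) (auto intro!: k_smooth_on_add[OF assms(1)] simp: k_smooth_on_const)
qed (simp add: k_smooth_on_const)

text \<open>Smoothness is a condition on derivatives in fixed directions.  Expanding in the standard basis
  reduces to it a derivative taken in a direction that varies with the point, as in the chain rule.\<close>

lemma linear_apply_Basis:
  fixes L :: "'a::euclidean_space \<Rightarrow> 'b::real_vector"
  assumes "linear L"
  shows "L v = (\<Sum>b\<in>Basis. (v \<bullet> b) *\<^sub>R L b)"
proof -
  interpret linear L by fact
  show ?thesis
    by (subst euclidean_representation[of v, symmetric]) (simp add: sum scaleR del: euclidean_representation)
qed

lemma k_smooth_on_compose: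
  assumes "open S" "open T" "\<And>x. x \<in> S \<Longrightarrow> g x \<in> T" "k_smooth_on k T f" "k_smooth_on k S g"
  shows "k_smooth_on k S (\<lambda>x. f (g x))"
  using assms(4,5)
proof (induction k arbitrary: f)
  case 0
  then have "continuous_on T f" "continuous_on S g" by simp_all
  from continuous_on_compose2[OF this] assms(3) have "continuous_on S (\<lambda>x. f (g x))" by blast
  then show ?case by simp
next
  case (Suc k)
  have lin: "linear (Df f (g x))" if "x \<in> S" for x
    using k_smooth_on_has_derivative[OF Suc.prems(1) assms(3)[OF that]] has_derivative_linear by blast
  show ?case
  proof (rule k_smooth_on_SucI[OF assms(1)])
    show "((\<lambda>x. f (g x)) has_derivative
        (\<lambda>v. Df f (g x) (Df g x v))) (at x)" if "x \<in> S" for x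
      by (rule has_derivative_compose[OF k_smooth_on_has_derivative[OF Suc.prems(2) that]
            k_smooth_on_has_derivative[OF Suc.prems(1) assms(3)[OF that]]])
    show "k_smooth_on k S (\<lambda>x. Df f (g x) (Df g x v))" for v
    proof (rule k_smooth_on_cong[OF assms(1)])
      show "(\<Sum>b\<in>Basis. (Df g x v \<bullet> b) *\<^sub>R Df f (g x) b) =
          Df f (g x) (Df g x v)" if "x \<in> S" for x
        by (rule linear_apply_Basis[OF lin[OF that], symmetric])
      show "k_smooth_on k S (\<lambda>x. \<Sum>b\<in>Basis. (Df g x v \<bullet> b) *\<^sub>R
          Df f (g x) b)"
      proof (intro k_smooth_on_sum k_smooth_on_bilinear[OF _ bounded_bilinear_scaleR]
            k_smooth_on_bounded_linear[OF _ bounded_linear_inner_left] assms(1))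
        show "k_smooth_on k S (\<lambda>x. Df g x v)" using Suc.prems(2) by simp
        show "k_smooth_on k S (\<lambda>x. Df f (g x) b)" for b
          using Suc.prems(1) by (intro Suc.IH k_smooth_on_Suc_imp[OF Suc.prems(2)]) simp
      qed
    qed
  qed
qed

lemma k_smooth_on_inverse:
  fixes f :: "'a::euclidean_space \<Rightarrow> real"
  assumes "open S" "k_smooth_on k S f" "\<And>x. x \<in> S \<Longrightarrow> f x \<noteq> 0"
  shows "k_smooth_on k S (\<lambda>x. inverse (f x))"
  using assms(2)
proof (induction k)
  case 0
  then have "continuous_on S f" by simp
  then have "continuous_on S (\<lambda>x. inverse (f x))"
    using assms(3) by (intro continuous_on_inverse) simp_all
  then show ?case by simp
next
  case (Suc k)
  note IH = Suc.IH[OF k_smooth_on_Suc_imp[OF Suc.prems]]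
  show ?case
  proof (rule k_smooth_on_SucI[OF assms(1)])
    show "((\<lambda>x. inverse (f x)) has_derivative
        (\<lambda>v. - (inverse (f x) * Df f x v * inverse (f x)))) (at x)" if "x \<in> S" for x
      using Deriv.has_derivative_inverse[OF assms(3)[OF that] k_smooth_on_has_derivative[OF Suc.prems that]] .
    show "k_smooth_on k S (\<lambda>x. - (inverse (f x) * Df f x v * inverse (f x)))" for v
    proof -
      have "k_smooth_on k S (\<lambda>x. Df f x v)" using Suc.prems by simp
      then show ?thesis
        by (intro k_smooth_on_bounded_linear[OF _ bounded_linear_minus[OF bounded_linear_ident]]
          k_smooth_on_bilinear[OF _ bounded_bilinear_mult] IH assms(1))
    qed
  qed
qed

lemma k_smooth_on_linear:
  assumes "open S" "bounded_linear L"
  shows "k_smooth_on k S L"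
proof (cases k)
  case 0
  then show ?thesis using assms(2) by (simp add: linear_continuous_on)
next
  case (Suc m)
  show ?thesis unfolding Suc
  proof (rule k_smooth_on_SucI[OF assms(1)])
    show "(L has_derivative L) (at x)" for x
      using assms(2) by (rule bounded_linear_imp_has_derivative)
  qed (rule k_smooth_on_const)
qed

lemma smooth_on_cong: "open S \<Longrightarrow> (\<And>x. x \<in> S \<Longrightarrow> f x = g x) \<Longrightarrow> smooth_on S f \<Longrightarrow> smooth_on S g"
  unfolding smooth_on_def using k_smooth_on_cong by blast

lemma smooth_on_subset: "smooth_on S f \<Longrightarrow> T \<subseteq> S \<Longrightarrow> smooth_on T f"
  unfolding smooth_on_def using k_smooth_on_subset by blast

lemma smooth_on_const [simp]: "smooth_on S (\<lambda>x. c)"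
  by (simp add: smooth_on_def k_smooth_on_const)

lemma smooth_on_linear: "open S \<Longrightarrow> bounded_linear L \<Longrightarrow> smooth_on S L"
  by (simp add: smooth_on_def k_smooth_on_linear)

lemma smooth_on_id: "open S \<Longrightarrow> smooth_on S (\<lambda>x. x)"
  by (simp add: smooth_on_linear)

lemma smooth_on_bounded_linear:
  "open S \<Longrightarrow> bounded_linear L \<Longrightarrow> smooth_on S f \<Longrightarrow> smooth_on S (\<lambda>x. L (f x))"
  by (simp add: smooth_on_def k_smooth_on_bounded_linear)

lemma smooth_on_bilinear:
  "open S \<Longrightarrow> bounded_bilinear B \<Longrightarrow> smooth_on S f \<Longrightarrow> smooth_on S g \<Longrightarrow> smooth_on S (\<lambda>x. B (f x) (g x))"
  by (simp add: smooth_on_def k_smooth_on_bilinear)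

lemmas smooth_on_scaleR = smooth_on_bilinear[OF _ bounded_bilinear_scaleR]
lemmas smooth_on_mult = smooth_on_bilinear[OF _ bounded_bilinear_mult]
lemmas smooth_on_inner = smooth_on_bilinear[OF _ bounded_bilinear_inner]
lemmas smooth_on_minus = smooth_on_bounded_linear[OF _ bounded_linear_minus[OF bounded_linear_ident]]

lemma smooth_on_add: "open S \<Longrightarrow> smooth_on S f \<Longrightarrow> smooth_on S g \<Longrightarrow> smooth_on S (\<lambda>x. f x + g x)"
  by (simp add: smooth_on_def k_smooth_on_add)

lemma smooth_on_diff: "open S \<Longrightarrow> smooth_on S f \<Longrightarrow> smooth_on S g \<Longrightarrow> smooth_on S (\<lambda>x. f x - g x)"
  using smooth_on_add[OF _ _ smooth_on_minus] by force

lemma smooth_on_sum: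
  "open S \<Longrightarrow> (\<And>i. i \<in> I \<Longrightarrow> smooth_on S (f i)) \<Longrightarrow> smooth_on S (\<lambda>x. \<Sum>i\<in>I. f i x)"
  by (simp add: smooth_on_def k_smooth_on_sum)

lemma smooth_on_prod:
  fixes f :: "'i \<Rightarrow> 'a::euclidean_space \<Rightarrow> real"
  assumes "open S" "\<And>i. i \<in> I \<Longrightarrow> smooth_on S (f i)"
  shows "smooth_on S (\<lambda>x. \<Prod>i\<in>I. f i x)"
proof (cases "finite I")
  case True
  then show ?thesis using assms(2)
    by (induction I) (auto intro!: smooth_on_mult[OF assms(1)])
qed simp

lemma smooth_on_inverse:
  fixes f :: "'a::euclidean_space \<Rightarrow> real"
  shows "open S \<Longrightarrow> smooth_on S f \<Longrightarrow> (\<And>x. x \<in> S \<Longrightarrow> f x \<noteq> 0) \<Longrightarrow> smooth_on S (\<lambda>x. inverse (f x))"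
  by (simp add: smooth_on_def k_smooth_on_inverse)

lemma smooth_on_compose:
  "open S \<Longrightarrow> open T \<Longrightarrow> (\<And>x. x \<in> S \<Longrightarrow> g x \<in> T) \<Longrightarrow> smooth_on T f \<Longrightarrow> smooth_on S g \<Longrightarrow>
    smooth_on S (\<lambda>x. f (g x))"
  by (simp add: smooth_on_def k_smooth_on_compose)

lemma smooth_compose: "smooth f \<Longrightarrow> smooth g \<Longrightarrow> smooth (\<lambda>x. f (g x))"
  by (rule smooth_on_compose[of UNIV UNIV]) auto

lemma smooth_on_frechet: "smooth_on S f \<Longrightarrow> smooth_on S (\<lambda>x. Df f x v)"
  unfolding smooth_on_def using k_smooth_on.simps(2) by blast

lemma smooth_on_has_derivative:
  "smooth_on S f \<Longrightarrow> x \<in> S \<Longrightarrow> (f has_derivative Df f x) (at x)"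
  unfolding smooth_on_def using k_smooth_on_has_derivative by blast

lemmas smooth_has_derivative = smooth_on_has_derivative[OF _ UNIV_I]

lemma smooth_on_continuous_on: "smooth_on S f \<Longrightarrow> continuous_on S f"
  unfolding smooth_on_def using k_smooth_on.simps(1) by blast

lemma smooth_on_linear_frechet:
  "smooth_on S f \<Longrightarrow> x \<in> S \<Longrightarrow> linear (Df f x)"
  using smooth_on_has_derivative has_derivative_linear by blast

lemma smooth_on_frechet_field:
  assumes "open S" "smooth_on S f" "smooth_on S v"
  shows "smooth_on S (\<lambda>x. Df f x (v x))"
proof (rule smooth_on_cong[OF assms(1)])
  show "(\<Sum>b\<in>Basis. (v x \<bullet> b) *\<^sub>R Df f x b) = Df f x (v x)"
    if "x \<in> S" for x
    using linear_apply_Basis[OF smooth_on_linear_frechet[OF assms(2) that]] by metis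
  show "smooth_on S (\<lambda>x. \<Sum>b\<in>Basis. (v x \<bullet> b) *\<^sub>R Df f x b)"
    using assms by (intro smooth_on_sum smooth_on_scaleR smooth_on_inner smooth_on_frechet) auto
qed

lemma smooth_on_vec_nth: "open S \<Longrightarrow> smooth_on S f \<Longrightarrow> smooth_on S (\<lambda>x. f x $ i :: real)"
  by (rule smooth_on_bounded_linear[OF _ bounded_linear_vec_nth])

lemma smooth_on_vec_lambda:
  fixes f :: "'n::finite \<Rightarrow> 'a::euclidean_space \<Rightarrow> real"
  assumes "open S" "\<And>i. smooth_on S (f i)"
  shows "smooth_on S (\<lambda>x. \<chi> i. f i x)"
proof -
  have "(\<lambda>x. \<chi> i. f i x) = (\<lambda>x. \<Sum>i\<in>UNIV. f i x *\<^sub>R axis i 1)"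
    by (auto simp: vec_eq_iff axis_def if_distrib cong: if_cong)
  then show ?thesis
    using assms by (auto intro!: smooth_on_sum smooth_on_scaleR)
qed

lemma smooth_on_local:
  assumes "\<And>x. x \<in> S \<Longrightarrow> \<exists>U. open U \<and> x \<in> U \<and> smooth_on U f"
  shows "smooth_on S f"
proof -
  have "k_smooth_on k S f" if "\<And>x. x \<in> S \<Longrightarrow> \<exists>U. open U \<and> x \<in> U \<and> k_smooth_on k U f" for k
    using that
  proof (induction k arbitrary: f)
    case 0
    then show ?case
      by (metis continuous_at_imp_continuous_on continuous_on_eq_continuous_at k_smooth_on.simps(1))
  next
    case (Suc k)
    then show ?case
      by (metis k_smooth_on.simps(2))
  qed
  then show ?thesis
    using assms unfolding smooth_on_def by metis
qed

text \<open>Symmetry of second derivatives: both iterated derivatives are limits of the second difference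
  quotient over a parallelogram with sides \<open>t a\<close> and \<open>t b\<close>, by the mean value theorem in each side.\<close>

lemma second_difference_mean_value:
  fixes f :: "'a::euclidean_space \<Rightarrow> real"
  assumes f: "smooth_on S f" and t: "0 < t"
    and S: "\<And>s r. 0 \<le> s \<Longrightarrow> s \<le> t \<Longrightarrow> 0 \<le> r \<Longrightarrow> r \<le> t \<Longrightarrow> x + s *\<^sub>R a + r *\<^sub>R b \<in> S"
  shows "\<exists>s r. 0 < s \<and> s < t \<and> 0 < r \<and> r < t \<and>
    f (x + t *\<^sub>R a + t *\<^sub>R b) - f (x + t *\<^sub>R a) - f (x + t *\<^sub>R b) + f x =
    t * t * Df (\<lambda>y. Df f y a) (x + s *\<^sub>R a + r *\<^sub>R b) b"
proof -
  let ?Da = "\<lambda>y. Df f y a"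
  have d1: "((\<lambda>s. f (x + s *\<^sub>R a + r *\<^sub>R b)) has_real_derivative ?Da (x + s *\<^sub>R a + r *\<^sub>R b)) (at s)"
    if "0 \<le> s" "s \<le> t" "0 \<le> r" "r \<le> t" for s r
  proof -
    have "((\<lambda>s. x + s *\<^sub>R a + r *\<^sub>R b) has_derivative (\<lambda>h. h *\<^sub>R a)) (at s)"
      by (auto intro!: derivative_eq_intros)
    from has_derivative_compose[OF this smooth_on_has_derivative[OF f S[OF that]]]
    show ?thesis
      by (rule has_derivative_imp_has_field_derivative)
        (simp add: linear_scale[OF smooth_on_linear_frechet[OF f S[OF that]]])
  qed
  let ?g = "\<lambda>s. f (x + s *\<^sub>R a + t *\<^sub>R b) - f (x + s *\<^sub>R a)"
  have "\<exists>s. 0 < s \<and> s < t \<and> ?g t - ?g 0 = (t - 0) * (?Da (x + s *\<^sub>R a + t *\<^sub>R b) - ?Da (x + s *\<^sub>R a))"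
    using t d1[of _ 0] d1[of _ t] by (intro MVT2) (auto intro!: derivative_intros)
  then obtain s where s: "0 < s" "s < t"
    "?g t - ?g 0 = t * (?Da (x + s *\<^sub>R a + t *\<^sub>R b) - ?Da (x + s *\<^sub>R a))" by auto
  have d2: "((\<lambda>r. ?Da (x + s *\<^sub>R a + r *\<^sub>R b)) has_real_derivative
      Df ?Da (x + s *\<^sub>R a + r *\<^sub>R b) b) (at r)" if "0 \<le> r" "r \<le> t" for r
  proof -
    have m: "x + s *\<^sub>R a + r *\<^sub>R b \<in> S" using S s that by simp
    have "((\<lambda>r. x + s *\<^sub>R a + r *\<^sub>R b) has_derivative (\<lambda>h. h *\<^sub>R b)) (at r)"
      by (auto intro!: derivative_eq_intros)
    from has_derivative_compose[OF this smooth_on_has_derivative[OF smooth_on_frechet[OF f] m]]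
    show ?thesis
      by (rule has_derivative_imp_has_field_derivative)
        (simp add: linear_scale[OF smooth_on_linear_frechet[OF smooth_on_frechet[OF f] m]])
  qed
  have "\<exists>r. 0 < r \<and> r < t \<and> ?Da (x + s *\<^sub>R a + t *\<^sub>R b) - ?Da (x + s *\<^sub>R a + 0 *\<^sub>R b) =
      (t - 0) * Df ?Da (x + s *\<^sub>R a + r *\<^sub>R b) b"
    using t d2 by (intro MVT2) auto
  then obtain r where r: "0 < r" "r < t" "?Da (x + s *\<^sub>R a + t *\<^sub>R b) - ?Da (x + s *\<^sub>R a) =
      t * Df ?Da (x + s *\<^sub>R a + r *\<^sub>R b) b" by auto
  show ?thesis
    using s r by (intro exI[of _ s] exI[of _ r]) (simp add: algebra_simps)
qed

lemma second_derivative_limit: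
  fixes f :: "'a::euclidean_space \<Rightarrow> real"
  assumes f: "smooth_on S f" and S: "open S" "x \<in> S"
  shows "((\<lambda>t. (f (x + t *\<^sub>R a + t *\<^sub>R b) - f (x + t *\<^sub>R a) - f (x + t *\<^sub>R b) + f x) / (t * t)) \<longlongrightarrow>
     Df (\<lambda>y. Df f y a) x b) (at_right 0)"
proof (rule tendstoI)
  fix e :: real assume e: "0 < e"
  let ?D = "\<lambda>y. Df (\<lambda>y. Df f y a) y b"
  have "continuous_on S ?D"
    by (intro smooth_on_continuous_on smooth_on_frechet f)
  then have "(?D \<longlongrightarrow> ?D x) (at x)"
    using S continuous_on_eq_continuous_at isCont_def by blast
  then have "\<forall>\<^sub>F y in at x. dist (?D y) (?D x) < e" using e by (rule tendstoD)
  moreover have "\<forall>\<^sub>F y in at x. y \<in> S" using S by (simp add: eventually_at_in_open')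
  ultimately have "\<forall>\<^sub>F y in at x. y \<in> S \<and> dist (?D y) (?D x) < e" by eventually_elim auto
  then obtain d where d: "0 < d" "\<And>y. dist y x < d \<Longrightarrow> y \<in> S \<and> dist (?D y) (?D x) < e"
    using e S by (auto simp: eventually_at) (metis dist_self)
  let ?M = "norm a + norm b + 1"
  have M: "0 < ?M" by (simp add: add_nonneg_pos)
  have near: "dist (x + s *\<^sub>R a + r *\<^sub>R b) x < d"
    if "0 \<le> s" "s \<le> t" "0 \<le> r" "r \<le> t" "t < d / ?M" "0 < t" for s r t
  proof -
    have "dist (x + s *\<^sub>R a + r *\<^sub>R b) x \<le> norm (s *\<^sub>R a) + norm (r *\<^sub>R b)"
      using norm_triangle_ineq[of "s *\<^sub>R a" "r *\<^sub>R b"] by (simp add: dist_norm)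
    also have "\<dots> = s * norm a + r * norm b" using that by simp
    also have "\<dots> \<le> t * norm a + t * norm b" using that by (intro add_mono mult_right_mono) auto
    also have "\<dots> < t * ?M" using that by (simp add: algebra_simps)
    also have "\<dots> \<le> d" using that M by (simp add: field_simps)
    finally show ?thesis .
  qed
  have "dist ((f (x + t *\<^sub>R a + t *\<^sub>R b) - f (x + t *\<^sub>R a) - f (x + t *\<^sub>R b) + f x) / (t * t)) (?D x) < e"
    if t: "0 < t" "t < d / ?M" for t
  proof -
    have "x + s *\<^sub>R a + r *\<^sub>R b \<in> S" if "0 \<le> s" "s \<le> t" "0 \<le> r" "r \<le> t" for s r
      using d(2) near that t by blast
    from second_difference_mean_value[OF f t(1) this]
    obtain s r where sr: "0 < s" "s < t" "0 < r" "r < t"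
      "f (x + t *\<^sub>R a + t *\<^sub>R b) - f (x + t *\<^sub>R a) - f (x + t *\<^sub>R b) + f x =
        t * t * ?D (x + s *\<^sub>R a + r *\<^sub>R b)" by blast
    then show ?thesis
      using d(2)[OF near[of s t r]] t by simp
  qed
  then show "\<forall>\<^sub>F t in at_right 0.
      dist ((f (x + t *\<^sub>R a + t *\<^sub>R b) - f (x + t *\<^sub>R a) - f (x + t *\<^sub>R b) + f x) / (t * t)) (?D x) < e"
    using d(1) M by (auto intro!: eventually_at_rightI[of 0 "d / ?M"])
qed

lemma second_derivative_symmetric_real:
  fixes f :: "'a::euclidean_space \<Rightarrow> real"
  assumes "smooth_on S f" "open S" "x \<in> S"
  shows "Df (\<lambda>y. Df f y a) x b =
         Df (\<lambda>y. Df f y b) x a"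
proof (rule tendsto_unique[OF _ second_derivative_limit[OF assms, of a b]])
  show "((\<lambda>t. (f (x + t *\<^sub>R a + t *\<^sub>R b) - f (x + t *\<^sub>R a) - f (x + t *\<^sub>R b) + f x) / (t * t)) \<longlongrightarrow>
     Df (\<lambda>y. Df f y b) x a) (at_right 0)"
    using second_derivative_limit[OF assms, of b a] by (simp add: algebra_simps)
qed auto

lemma frechet_derivative_bounded_linear:
  assumes "bounded_linear L" "smooth_on S f" "x \<in> S"
  shows "Df (\<lambda>y. L (f y)) x v = L (Df f x v)"
  using frechet_derivative_at[OF bounded_linear.has_derivative[OF assms(1) smooth_on_has_derivative[OF assms(2,3)]]]
  by metis

lemma second_derivative_symmetric:
  fixes f :: "'a::euclidean_space \<Rightarrow> 'b::euclidean_space"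
  assumes f: "smooth_on S f" and S: "open S" "x \<in> S"
  shows "Df (\<lambda>y. Df f y a) x b =
         Df (\<lambda>y. Df f y b) x a"
proof (rule euclidean_eqI)
  fix i :: 'b
  have eq: "Df (\<lambda>y. Df f y a) x b \<bullet> i =
      Df (\<lambda>y. Df (\<lambda>z. f z \<bullet> i) y a) x b" for a b
  proof -
    have "Df (\<lambda>y. Df f y a) x b \<bullet> i =
        Df (\<lambda>y. Df f y a \<bullet> i) x b"
      using frechet_derivative_bounded_linear[OF bounded_linear_inner_left smooth_on_frechet[OF f] S(2)]
      by metis
    also have "Df (\<lambda>y. Df f y a \<bullet> i) x =
        Df (\<lambda>y. Df (\<lambda>z. f z \<bullet> i) y a) x"
    proof (rule frechet_derivative_transform_within_open[OF _ S])
      show "(\<lambda>y. Df f y a \<bullet> i) differentiable at x"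
        using smooth_on_has_derivative[OF smooth_on_inner[OF S(1) smooth_on_frechet[OF f] smooth_on_const] S(2)]
        unfolding differentiable_def by blast
    qed (simp add: frechet_derivative_bounded_linear[OF bounded_linear_inner_left f])
    finally show ?thesis .
  qed
  show "Df (\<lambda>y. Df f y a) x b \<bullet> i =
      Df (\<lambda>y. Df f y b) x a \<bullet> i"
    unfolding eq
    by (rule second_derivative_symmetric_real[OF smooth_on_inner[OF S(1) f smooth_on_const] S])
qed

lemma smooth_on_det:
  fixes M :: "'a::euclidean_space \<Rightarrow> real^'n^'n"
  assumes "open S" "\<And>i j. smooth_on S (\<lambda>x. M x $ i $ j)"
  shows "smooth_on S (\<lambda>x. det (M x))"
  unfolding det_def
  using assms by (intro smooth_on_sum smooth_on_mult smooth_on_prod) auto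

text \<open>By Cramer's rule the inverse of the derivative of \<open>F\<close> depends smoothly on the point.  The
  derivative of \<open>G\<close> is the composition of this inverse with \<open>G\<close>, so it is as often differentiable as
  \<open>G\<close> is, which gains one degree of smoothness at each step.\<close>

lemma smooth_inverse_function:
  fixes F G :: "real^'n \<Rightarrow> real^'n"
  assumes F: "smooth F" and FG: "\<And>y. F (G y) = y" and G: "continuous_on UNIV G"
    and inj: "\<And>x v. Df F x v = 0 \<Longrightarrow> v = 0"
  shows "smooth G"
proof -
  define M where "M x = matrix (Df F x)" for x
  have lin: "linear (Df F x)" for x
    using F smooth_on_linear_frechet by blast
  have M: "M x *v v = Df F x v" for x v
    using lin[of x] by (simp add: M_def matrix_works)
  have det: "det (M x) \<noteq> 0" for x
  proof -
    have "\<forall>v. M x *v v = 0 \<longrightarrow> v = 0" using M inj by metis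
    then show ?thesis
      using matrix_left_invertible_ker invertible_left_inverse invertible_det_nz by metis
  qed
  have Mij: "M x $ i $ j = Df F x (axis j 1) $ i" for x i j
    by (simp add: M_def matrix_def)
  define R :: "real^'n \<Rightarrow> real^'n \<Rightarrow> real^'n" where
    "R x v = (\<chi> k. det (\<chi> i j. if j = k then v $ i else M x $ i $ j) * inverse (det (M x)))" for x v
  have R: "M x *v w = v \<longleftrightarrow> w = R x v" for x v w
    using cramer[OF det] by (simp add: R_def divide_inverse)
  have MR: "M x *v R x v = v" for x v
    using R by blast
  have Msm: "smooth (\<lambda>x. M x $ i $ j)" for i j
    unfolding Mij by (rule smooth_on_vec_nth[OF open_UNIV smooth_on_frechet[OF F]])
  have Rsm: "smooth (\<lambda>x. R x v)" for v
    unfolding R_def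
  proof (rule smooth_on_vec_lambda[OF open_UNIV], rule smooth_on_mult[OF open_UNIV])
    show "smooth (\<lambda>x. det (\<chi> i j. if j = k then v $ i else M x $ i $ j))" for k
    proof (rule smooth_on_det[OF open_UNIV])
      show "smooth (\<lambda>x. (\<chi> i j. if j = k then v $ i else M x $ i $ j) $ i $ j)" for i j
        using Msm by (cases "j = k") simp_all
    qed
    show "smooth (\<lambda>x. inverse (det (M x)))"
      by (rule smooth_on_inverse[OF open_UNIV smooth_on_det[OF open_UNIV Msm] det])
  qed
  have dG: "(G has_derivative R (G y)) (at y)" for y
  proof (rule has_derivative_inverse_basic[where T = UNIV])
    show "(F has_derivative Df F (G y)) (at (G y))"
      using F smooth_on_has_derivative by blast
    show "R (G y) \<circ> Df F (G y) = id"
    proof (rule ext)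
      show "(R (G y) \<circ> Df F (G y)) v = id v" for v
        using R[THEN iffD1, OF M, of v "G y"] by simp
    qed
    have "linear (R (G y))"
    proof (rule linearI)
      fix v w c
      show "R (G y) (v + w) = R (G y) v + R (G y) w"
        by (rule R[THEN iffD1, symmetric]) (simp add: matrix_vector_right_distrib MR)
      show "R (G y) (c *\<^sub>R v) = c *\<^sub>R R (G y) v"
        by (rule R[THEN iffD1, symmetric]) (simp add: matrix_vector_mult_scaleR MR)
    qed
    then show "bounded_linear (R (G y))" by (rule linear_conv_bounded_linear[THEN iffD1])
    show "continuous (at y) G" using G continuous_on_eq_continuous_at open_UNIV by blast
  qed (auto simp: FG)
  have "k_smooth_on k UNIV G" for k
  proof (induction k)
    case (Suc k)
    show ?case
    proof (rule k_smooth_on_SucI[OF open_UNIV dG])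
      show "k_smooth_on k UNIV (\<lambda>x. R (G x) v)" for v
        by (rule k_smooth_on_compose[OF open_UNIV open_UNIV UNIV_I, where f = "\<lambda>x. R x v"])
          (use Rsm[of v] Suc in \<open>simp_all add: smooth_on_def\<close>)
    qed
  qed (use G in auto)
  then show ?thesis by (simp add: smooth_on_def)
qed

lemma smooth_on_iter_deriv: "smooth_on S f \<Longrightarrow> smooth_on S (iter_deriv vs f)"
  by (induction vs) (auto intro: smooth_on_frechet)

section \<open>Lattices, the torus and periodic functions\<close>

locale torus_lattice =
  fixes \<Lambda> :: "quat set"
  assumes full_lattice: "full_lattice \<Lambda>"
begin

definition basis :: "4 \<Rightarrow> quat" where
  "basis = (SOME b. lattice_basis \<Lambda> b)"

definition comb :: "real^4 \<Rightarrow> quat" where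
  "comb t = (\<Sum>i\<in>UNIV. t $ i *\<^sub>R basis i)"

definition coord :: "quat \<Rightarrow> real^4" where
  "coord = inv comb"

lemma lattice_basis_basis: "lattice_basis \<Lambda> basis"
  using full_lattice unfolding full_lattice_def basis_def by (metis someI)

lemma linear_comb: "linear comb"
  by (rule linearI) (simp_all add: comb_def scaleR_left_distrib sum.distrib scaleR_sum_right)

lemma inj_comb: "inj comb"
proof (subst linear_injective_0[OF linear_comb], intro allI impI)
  fix t assume 0: "comb t = 0"
  have b: "inj basis" "independent (range basis)"
    using lattice_basis_basis unfolding lattice_basis_def by blast+
  have "(\<Sum>v\<in>range basis. (t $ inv basis v) *\<^sub>R v) = comb t"
    using b(1) by (simp add: sum.reindex comb_def)
  then have "t $ inv basis v = 0" if "v \<in> range basis" for v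
    using independentD[OF b(2) _ subset_refl _ that, of "\<lambda>v. t $ inv basis v"] 0 by simp
  from this[OF rangeI] show "t = 0"
    using b(1) by (simp add: vec_eq_iff)
qed

lemma surj_comb: "surj comb"
  using linear_comb inj_comb linear_injective_imp_surjective by blast

lemma coord_comb [simp]: "coord (comb t) = t"
  by (simp add: coord_def inj_comb)

lemma comb_coord [simp]: "comb (coord x) = x"
  by (simp add: coord_def surj_comb surj_f_inv_f)

lemma linear_coord: "linear coord"
  unfolding coord_def by (rule inj_linear_imp_inv_linear[OF linear_comb inj_comb])

lemmas coord_add = linear_add[OF linear_coord]
lemmas coord_diff = linear_diff[OF linear_coord]
lemmas coord_minus = linear_neg[OF linear_coord]

lemma mem_lattice: "x \<in> \<Lambda> \<longleftrightarrow> (\<forall>i. coord x $ i \<in> \<int>)"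
proof -
  have "\<Lambda> = range (\<lambda>n :: 4 \<Rightarrow> int. \<Sum>i\<in>UNIV. of_int (n i) *\<^sub>R basis i)"
    using lattice_basis_basis unfolding lattice_basis_def by blast
  from arg_cong[OF this, of "\<lambda>A. x \<in> A"]
  have mem: "x \<in> \<Lambda> \<longleftrightarrow> (\<exists>n :: 4 \<Rightarrow> int. x = comb (\<chi> i. of_int (n i)))"
    by (simp add: comb_def image_iff)
  show ?thesis
  proof
    assume "\<forall>i. coord x $ i \<in> \<int>"
    then have "\<exists>n. coord x $ i = of_int n" for i
      by (meson Ints_cases)
    then obtain n where "\<And>i. coord x $ i = of_int (n i)" by metis
    then have "coord x = (\<chi> i. of_int (n i))" by (simp add: vec_eq_iff)
    then have "x = comb (\<chi> i. of_int (n i))" by (metis comb_coord)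
    then show "x \<in> \<Lambda>" unfolding mem by blast
  qed (auto simp: mem)
qed

lemma lattice_0 [simp]: "0 \<in> \<Lambda>"
  using linear_0[OF linear_coord] by (simp add: mem_lattice)

lemma lattice_add: "x \<in> \<Lambda> \<Longrightarrow> y \<in> \<Lambda> \<Longrightarrow> x + y \<in> \<Lambda>"
  by (simp add: mem_lattice coord_add)

lemma lattice_diff: "x \<in> \<Lambda> \<Longrightarrow> y \<in> \<Lambda> \<Longrightarrow> x - y \<in> \<Lambda>"
  by (simp add: mem_lattice coord_diff)

lemma lattice_minus_iff [simp]: "- x \<in> \<Lambda> \<longleftrightarrow> x \<in> \<Lambda>"
  by (simp add: mem_lattice coord_minus)

lemma lattice_minus_commute: "x - y \<in> \<Lambda> \<longleftrightarrow> y - x \<in> \<Lambda>"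
  using lattice_minus_iff[of "x - y"] by simp

lemma coord_bound: obtains K where "0 < K" "\<And>x i. \<bar>coord x $ i\<bar> \<le> K * norm x"
proof -
  obtain K where "0 < K" "\<And>x. norm (coord x) \<le> K * norm x"
    using linear_bounded_pos[OF linear_coord] by blast
  then show thesis
    using that component_le_norm_cart order_trans by metis
qed

lemma lattice_discrete: obtains r where "0 < r" "\<And>l. l \<in> \<Lambda> \<Longrightarrow> norm l < r \<Longrightarrow> l = 0"
proof -
  obtain K where K: "0 < K" "\<And>x i. \<bar>coord x $ i\<bar> \<le> K * norm x" using coord_bound by blast
  have "l = 0" if l: "l \<in> \<Lambda>" "norm l < 1 / K" for l
  proof -
    have "\<bar>coord l $ i\<bar> < 1" for i
      using K(2)[of l i] l(2) K(1) by (simp add: pos_less_divide_eq mult.commute)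
    then have "coord l $ i = 0" for i
      using l(1) Ints_nonzero_abs_less1 by (auto simp: mem_lattice)
    then have "coord l = 0" by (simp add: vec_eq_iff)
    then show "l = 0" using comb_coord[of l] linear_0[OF linear_comb] by simp
  qed
  then show thesis using that[of "1 / K"] K(1) by simp
qed

lemma finite_lattice_bounded: "finite {l \<in> \<Lambda>. norm l \<le> R}"
proof -
  obtain K where K: "0 < K" "\<And>x i. \<bar>coord x $ i\<bar> \<le> K * norm x" using coord_bound by blast
  let ?A = "{z :: real. z \<in> \<int> \<and> \<bar>z\<bar> \<le> K * R}"
  have "finite (PiE (UNIV :: 4 set) (\<lambda>_. ?A))"
    by (intro finite_PiE finite_abs_int_segment) simp
  then have "finite ((\<lambda>f. comb (vec_lambda f)) ` PiE (UNIV :: 4 set) (\<lambda>_. ?A))" by simp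
  moreover have "{l \<in> \<Lambda>. norm l \<le> R} \<subseteq> (\<lambda>f. comb (vec_lambda f)) ` PiE UNIV (\<lambda>_. ?A)"
  proof
    fix l assume l: "l \<in> {l \<in> \<Lambda>. norm l \<le> R}"
    have "\<bar>coord l $ i\<bar> \<le> K * R" for i
      using K l by (metis (mono_tags, lifting) mem_Collect_eq mult_left_mono order_less_imp_le order_trans)
    then have "(\<lambda>i. coord l $ i) \<in> PiE UNIV (\<lambda>_. ?A)"
      using l by (auto simp: mem_lattice)
    moreover have "l = comb (vec_lambda (\<lambda>i. coord l $ i))" by simp
    ultimately show "l \<in> (\<lambda>f. comb (vec_lambda f)) ` PiE UNIV (\<lambda>_. ?A)" by blast
  qed
  ultimately show ?thesis using finite_subset by blast
qed

abbreviation \<pi> :: "quat \<Rightarrow> point" where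
  "\<pi> \<equiv> proj \<Lambda>"

lemma proj_eq_iff: "\<pi> x = \<pi> y \<longleftrightarrow> y - x \<in> \<Lambda>"
proof
  assume "\<pi> x = \<pi> y"
  moreover have "y \<in> \<pi> y" using lattice_0 by (force simp: proj_def)
  ultimately have "y \<in> \<pi> x" by simp
  then show "y - x \<in> \<Lambda>" by (auto simp: proj_def)
next
  assume d: "y - x \<in> \<Lambda>"
  have "z \<in> \<pi> x \<longleftrightarrow> z \<in> \<pi> y" for z
  proof -
    have z: "z \<in> \<pi> w \<longleftrightarrow> z - w \<in> \<Lambda>" for w
      unfolding proj_def by (auto simp: image_iff) (metis add.commute diff_add_cancel)
    have "z - x = (z - y) + (y - x)" "z - y = (z - x) - (y - x)" by simp_all
    then show ?thesis unfolding z using d lattice_add lattice_diff by metis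
  qed
  then show "\<pi> x = \<pi> y" by blast
qed

lemma proj_add_lattice [simp]: "l \<in> \<Lambda> \<Longrightarrow> \<pi> (x + l) = \<pi> x"
  by (simp add: proj_eq_iff lattice_minus_commute[of x])

lemma proj_in_torus [simp]: "\<pi> x \<in> torus \<Lambda>"
  by (simp add: torus_def)

lemma torusE: assumes "p \<in> torus \<Lambda>" obtains x where "p = \<pi> x"
  using assms by (auto simp: torus_def)

lemma proj_SOME: "p \<in> torus \<Lambda> \<Longrightarrow> \<pi> (SOME x. \<pi> x = p) = p"
  by (metis (mono_tags) someI torusE)

lemma proj_translate: "(\<lambda>y. y + v) ` \<pi> x = \<pi> (x + v)"
  by (auto simp: proj_def image_image algebra_simps)

abbreviation domain :: "quat set" where
  "domain \<equiv> fundamental_domain basis"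

lemma domain_eq: "domain = {x. \<forall>i. 0 \<le> coord x $ i \<and> coord x $ i < 1}"
proof (intro set_eqI iffI)
  fix x assume "x \<in> domain"
  then obtain t where t: "x = (\<Sum>i\<in>UNIV. t i *\<^sub>R basis i)" "\<forall>i. 0 \<le> t i \<and> t i < (1::real)"
    by (auto simp: fundamental_domain_def)
  then have "x = comb (\<chi> i. t i)" by (simp add: comb_def)
  then show "x \<in> {x. \<forall>i. 0 \<le> coord x $ i \<and> coord x $ i < 1}" using t(2) by simp
next
  fix x assume "x \<in> {x. \<forall>i. 0 \<le> coord x $ i \<and> coord x $ i < 1}"
  moreover have "x = (\<Sum>i\<in>UNIV. (coord x $ i) *\<^sub>R basis i)" using comb_coord[of x] by (simp add: comb_def)
  ultimately show "x \<in> domain" unfolding fundamental_domain_def by blast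
qed

lemma domain_reduce: obtains l where "l \<in> \<Lambda>" "x + l \<in> domain"
proof -
  define l where "l = comb (\<chi> i. - of_int \<lfloor>coord x $ i\<rfloor>)"
  have "l \<in> \<Lambda>" by (simp add: mem_lattice l_def)
  moreover have "x + l \<in> domain"
    by (auto simp: domain_eq coord_add l_def) linarith
  ultimately show thesis using that by blast
qed

lemma domain_unique: "x \<in> domain \<Longrightarrow> x + l \<in> domain \<Longrightarrow> l \<in> \<Lambda> \<Longrightarrow> l = 0"
proof -
  assume a: "x \<in> domain" "x + l \<in> domain" "l \<in> \<Lambda>"
  have "coord l $ i = 0" for i
  proof (rule Ints_nonzero_abs_less1)
    show "coord l $ i \<in> \<int>" using a by (simp add: mem_lattice)
    have "0 \<le> coord x $ i" "coord x $ i < 1" "0 \<le> coord x $ i + coord l $ i" "coord x $ i + coord l $ i < 1"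
      using a(1,2) by (auto simp: domain_eq coord_add)
    then show "\<bar>coord l $ i\<bar> < 1" by linarith
  qed
  then have "coord l = 0" by (simp add: vec_eq_iff)
  then show "l = 0" using comb_coord[of l] linear_0[OF linear_comb] by simp
qed

definition cell :: "quat set" where
  "cell = comb ` cbox 0 1"

lemma compact_cell: "compact cell"
  unfolding cell_def
  by (intro compact_continuous_image linear_continuous_on linear_comb[THEN linear_conv_bounded_linear[THEN iffD1]])
    simp

lemma domain_subset_cell: "domain \<subseteq> cell"
proof
  fix x assume "x \<in> domain"
  then have "coord x \<in> cbox 0 1" by (auto simp: domain_eq mem_box_cart less_imp_le)
  then show "x \<in> cell" unfolding cell_def by (metis comb_coord imageI)
qed

lemma bounded_domain: "bounded domain"
  using compact_cell domain_subset_cell bounded_subset compact_imp_bounded by blast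

definition periodic :: "(quat \<Rightarrow> 'b) \<Rightarrow> bool" where
  "periodic g \<longleftrightarrow> (\<forall>x. \<forall>l\<in>\<Lambda>. g (x + l) = g x)"

lemma periodic_proj: "periodic (\<lambda>x. h (\<pi> x))"
  by (simp add: periodic_def)

lemma periodic_SOME:
  assumes "periodic g"
  shows "g (SOME y. \<pi> y = \<pi> x) = g x"
proof -
  define y where "y = (SOME y. \<pi> y = \<pi> x)"
  have "\<pi> y = \<pi> x" unfolding y_def by (rule proj_SOME) simp
  then have "x - y \<in> \<Lambda>" by (simp add: proj_eq_iff)
  then have "g (y + (x - y)) = g y" using assms unfolding periodic_def by blast
  then show ?thesis by (simp add: y_def)
qed

text \<open>Every value of a periodic function is taken on the compact closed cell.\<close>

lemma periodic_bounded:
  fixes g :: "quat \<Rightarrow> 'b::real_normed_vector"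
  assumes "periodic g" "continuous_on UNIV g"
  obtains C where "0 \<le> C" "\<And>x. norm (g x) \<le> C"
proof -
  have "compact (g ` cell)"
    using assms(2) compact_cell by (meson compact_continuous_image continuous_on_subset subset_UNIV)
  then obtain C where C: "\<And>x. x \<in> cell \<Longrightarrow> norm (g x) \<le> C"
    using compact_imp_bounded bounded_iff by (metis imageI)
  have b: "norm (g x) \<le> C" for x
    by (metis C assms(1) domain_reduce domain_subset_cell periodic_def subsetD)
  then show thesis using that order_trans[OF norm_ge_zero b] by blast
qed

lemma frechet_derivative_translate:
  assumes "smooth g"
  shows "Df (\<lambda>x. g (x + c)) x = Df g (x + c)"
proof -
  have "((\<lambda>x. x + c) has_derivative (\<lambda>v. v)) (at x)" by (auto intro!: derivative_eq_intros)
  from has_derivative_compose[OF this smooth_on_has_derivative[OF assms]]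
  show ?thesis using frechet_derivative_at by fastforce
qed

lemma periodic_frechet:
  assumes "smooth g" "periodic g"
  shows "periodic (\<lambda>x. Df g x v)"
proof -
  have "Df g (x + l) = Df g x" if "l \<in> \<Lambda>" for x l
  proof -
    have "(\<lambda>x. g (x + l)) = g" using that assms(2) by (auto simp: periodic_def)
    then show ?thesis using frechet_derivative_translate[OF assms(1), of l x] by metis
  qed
  then show ?thesis by (simp add: periodic_def)
qed

lemma periodic_iter_deriv:
  "smooth g \<Longrightarrow> periodic g \<Longrightarrow> periodic (iter_deriv vs g)"
  by (induction vs) (auto intro: periodic_frechet smooth_on_iter_deriv)

lemma periodic_smooth_frechet_bounded:
  fixes g :: "quat \<Rightarrow> 'b::real_normed_vector"
  assumes "smooth g" "periodic g"
  obtains L where "0 \<le> L" "\<And>x v. norm (Df g x v) \<le> L * norm v"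
    "\<And>x y. norm (g x - g y) \<le> L * norm (x - y)"
proof -
  have "\<exists>C. 0 \<le> C \<and> (\<forall>x. norm (Df g x b) \<le> C)" for b
    using periodic_bounded[OF periodic_frechet[OF assms] smooth_on_continuous_on[OF smooth_on_frechet[OF assms(1)]]]
    by metis
  then obtain C where C: "\<And>b. 0 \<le> C b" "\<And>b x. norm (Df g x b) \<le> C b" by metis
  define L where "L = sum C Basis"
  have L: "0 \<le> L" by (simp add: L_def C sum_nonneg)
  have b: "norm (Df g x v) \<le> L * norm v" for x v
  proof -
    have "norm (Df g x v) =
        norm (\<Sum>b\<in>Basis. (v \<bullet> b) *\<^sub>R Df g x b)"
      by (subst linear_apply_Basis[OF smooth_on_linear_frechet[OF assms(1)]]) simp_all
    also have "\<dots> \<le> (\<Sum>b\<in>Basis. norm v * C b)"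
      by (rule sum_norm_le) (auto intro!: mult_mono C Basis_le_norm)
    finally show ?thesis by (simp add: L_def sum_distrib_left mult.commute)
  qed
  have "norm (g x - g y) \<le> L * norm (x - y)" for x y
  proof (rule differentiable_bound[of UNIV])
    show "(g has_derivative Df g x) (at x)" for x
      using smooth_on_has_derivative[OF assms(1)] by simp
    show "onorm (Df g x) \<le> L" for x
      using b L by (intro onorm_bound) (auto simp: mult.commute)
  qed auto
  then show thesis using that L b by blast
qed

section \<open>Lifts of maps between tori\<close>

text \<open>Two lifts of the same map differ by a continuous function with values in the lattice, and such a
  function is locally constant.  This is what makes derivatives of lifts well defined on the torus and
  lets smoothness be transferred from local to global lifts.\<close>

lemma lattice_valued_locally_constant:
  fixes g :: "'a::real_normed_vector \<Rightarrow> quat"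
  assumes "open U" "x \<in> U" "continuous_on U g" "\<And>y. y \<in> U \<Longrightarrow> g y \<in> \<Lambda>"
  obtains V where "open V" "x \<in> V" "V \<subseteq> U" "\<And>y. y \<in> V \<Longrightarrow> g y = g x"
proof -
  obtain r where r: "0 < r" "\<And>l. l \<in> \<Lambda> \<Longrightarrow> norm l < r \<Longrightarrow> l = 0" using lattice_discrete by blast
  define V where "V = U \<inter> g -` ball (g x) r"
  have "open V" unfolding V_def
    using assms(1,3) by (intro continuous_open_preimage) auto
  moreover have "x \<in> V" using assms(2) r(1) by (simp add: V_def)
  moreover have "g y = g x" if "y \<in> V" for y
  proof -
    have "g y - g x \<in> \<Lambda>" "norm (g y - g x) < r"
      using that assms(2,4) lattice_diff by (auto simp: V_def dist_norm norm_minus_commute)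
    then show ?thesis using r(2) by fastforce
  qed
  moreover have "V \<subseteq> U" by (simp add: V_def)
  ultimately show thesis using that by blast
qed

lemma lifts_differ_by_constant:
  fixes F F' :: "'a::real_normed_vector \<Rightarrow> quat"
  assumes "open U" "x \<in> U" "continuous_on U F" "continuous_on U F'"
    and "\<And>y. y \<in> U \<Longrightarrow> \<pi> (F y) = \<pi> (F' y)"
  obtains V c where "open V" "x \<in> V" "V \<subseteq> U" "c \<in> \<Lambda>" "\<And>y. y \<in> V \<Longrightarrow> F' y = F y + c"
proof -
  have l: "F' y - F y \<in> \<Lambda>" if "y \<in> U" for y
    using assms(5)[OF that] by (simp add: proj_eq_iff)
  have "continuous_on U (\<lambda>y. F' y - F y)" using assms by (intro continuous_on_diff)
  from lattice_valued_locally_constant[OF assms(1,2) this l]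
  obtain V where "open V" "x \<in> V" "V \<subseteq> U" "\<And>y. y \<in> V \<Longrightarrow> F' y - F y = F' x - F x"
    by (metis (no_types, lifting))
  then show thesis
    using that[of V "F' x - F x"] l[OF assms(2)] by (metis add.commute diff_add_cancel)
qed

lemma lifts_frechet_unique:
  fixes F F' :: "'a::euclidean_space \<Rightarrow> quat"
  assumes F: "open U" "smooth_on U F" "x \<in> U" and F': "open U'" "smooth_on U' F'" "x + l \<in> U'"
    and p: "\<And>y. y \<in> U \<Longrightarrow> y + l \<in> U' \<Longrightarrow> \<pi> (F y) = \<pi> (F' (y + l))"
  shows "Df F' (x + l) = Df F x"
proof -
  define W where "W = U \<inter> (\<lambda>y. y + l) -` U'"
  have W: "open W" "x \<in> W" unfolding W_def
    using F F' by (auto intro!: open_Int continuous_open_vimage continuous_intros)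
  have c: "continuous_on W F" "continuous_on W (\<lambda>y. F' (y + l))"
    using smooth_on_continuous_on[OF F(2)] smooth_on_continuous_on[OF F'(2)]
    by (auto simp: W_def intro: continuous_on_subset intro!: continuous_on_compose2[of U' F'] continuous_intros)
  have "\<pi> (F y) = \<pi> (F' (y + l))" if "y \<in> W" for y
    using that p by (simp add: W_def)
  from lifts_differ_by_constant[OF W c this]
  obtain V c where V: "open V" "x \<in> V" "V \<subseteq> W" "\<And>y. y \<in> V \<Longrightarrow> F' (y + l) = F y + c"
    by (metis (no_types, lifting))
  have "(F has_derivative Df F x) (at x)"
    by (rule smooth_on_has_derivative[OF F(2,3)])
  then have "((\<lambda>y. F y + c) has_derivative Df F x) (at x)"
    by (auto intro!: derivative_eq_intros)
  then have d: "((\<lambda>y. F' (y + l)) has_derivative Df F x) (at x)"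
    by (rule has_derivative_transform_within_open[OF _ V(1,2)]) (simp add: V(4))
  have "((\<lambda>y. y - l) has_derivative (\<lambda>v. v)) (at (x + l))" by (auto intro!: derivative_eq_intros)
  moreover have "((\<lambda>y. F' (y + l)) has_derivative Df F x) (at (x + l - l))"
    using d by simp
  ultimately have "((\<lambda>y. F' (y - l + l)) has_derivative (\<lambda>v. Df F x v)) (at (x + l))"
    by (rule has_derivative_compose)
  then show ?thesis using frechet_derivative_at by fastforce
qed

lemma local_lift_frechet_unique:
  assumes F: "local_lift \<Lambda> f U F" "x \<in> U" and F': "local_lift \<Lambda> f U' F'" "x' \<in> U'"
    and p: "\<pi> x = \<pi> x'"
  shows "Df F' x' = Df F x"
proof -
  have l: "x' - x \<in> \<Lambda>" using p by (simp add: proj_eq_iff)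
  have "Df F' (x + (x' - x)) = Df F x"
    by (rule lifts_frechet_unique[of U F x U' F'])
      (use F F' proj_add_lattice[OF l] in \<open>auto simp: local_lift_def simp del: proj_add_lattice\<close>)
  then show ?thesis by simp
qed

lemma dmap_eq:
  assumes "local_lift \<Lambda> f U F" "x \<in> U"
  shows "dmap \<Lambda> f (\<pi> x) v = Df F x v"
  unfolding dmap_def
  by (rule the_equality) (use assms local_lift_frechet_unique in \<open>blast, metis\<close>)

definition lifts :: "(point \<Rightarrow> point) \<Rightarrow> (quat \<Rightarrow> quat) \<Rightarrow> bool" where
  "lifts f F \<longleftrightarrow> (\<forall>x. \<pi> (F x) = f (\<pi> x))"

lemma lifts_local_lift: "lifts f F \<Longrightarrow> smooth F \<Longrightarrow> local_lift \<Lambda> f UNIV F"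
  by (simp add: lifts_def local_lift_def)

lemma dmap_lift:
  "lifts f F \<Longrightarrow> smooth F \<Longrightarrow> dmap \<Lambda> f (\<pi> x) v = Df F x v"
  using dmap_eq[OF lifts_local_lift] by simp

text \<open>The lifts to the universal cover of the elements of \<open>Diff0 \<Lambda>\<close>, with their inverses.  Commuting
  with the translations by lattice vectors, and not just normalising them, expresses that the map
  acts trivially on the fundamental group of the torus, hence is homotopic to the identity.\<close>

definition cover_diffeo :: "(quat \<Rightarrow> quat) \<Rightarrow> (quat \<Rightarrow> quat) \<Rightarrow> bool" where
  "cover_diffeo F G \<longleftrightarrow>
     smooth F \<and> smooth G \<and> (\<forall>x. F (G x) = x) \<and> (\<forall>x. G (F x) = x) \<and>
     (\<forall>x. \<forall>l\<in>\<Lambda>. F (x + l) = F x + l)"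

lemma cover_diffeo_sym: "cover_diffeo F G \<Longrightarrow> cover_diffeo G F"
  unfolding cover_diffeo_def by metis

lemma cover_diffeo_smooth: "cover_diffeo F G \<Longrightarrow> smooth F"
  by (simp add: cover_diffeo_def)

lemma cover_diffeo_compose:
  "cover_diffeo F G \<Longrightarrow> cover_diffeo F' G' \<Longrightarrow>
    cover_diffeo (\<lambda>x. F' (F x)) (\<lambda>x. G (G' x))"
  unfolding cover_diffeo_def by (simp add: smooth_compose)

lemma topspace_torus [simp]: "topspace (torus_topology \<Lambda>) = torus \<Lambda>"
proof -
  have "openin (torus_topology \<Lambda>) (torus \<Lambda>)" by (simp add: openin_torus_topology)
  then show ?thesis
    by (auto simp: topspace_def openin_torus_topology)
qed

text \<open>The projection is an open map: the preimage of the image of an open set is a union of translates.\<close>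

lemma openin_proj_image:
  assumes "open B" shows "openin (torus_topology \<Lambda>) (\<pi> ` B)"
proof -
  have "{x. \<pi> x \<in> \<pi> ` B} = (\<Union>l\<in>\<Lambda>. (\<lambda>x. x + l) -` B)"
  proof (intro set_eqI iffI)
    fix x assume "x \<in> {x. \<pi> x \<in> \<pi> ` B}"
    then obtain y where "y \<in> B" "y - x \<in> \<Lambda>" by (auto simp: proj_eq_iff)
    then show "x \<in> (\<Union>l\<in>\<Lambda>. (\<lambda>x. x + l) -` B)" by (intro UN_I[of "y - x"]) auto
  qed (auto simp: image_iff proj_eq_iff intro: bexI[rotated])
  then show ?thesis
    using assms by (auto simp: openin_torus_topology intro!: continuous_open_vimage continuous_intros)
qed

abbreviation torus_homotopy :: "(real \<times> point \<Rightarrow> point) \<Rightarrow> bool" where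
  "torus_homotopy h \<equiv>
     continuous_map (prod_topology (top_of_set {0..1}) (torus_topology \<Lambda>)) (torus_topology \<Lambda>) h"

text \<open>A homotopy of the torus is continuous as soon as it has continuous local lifts.\<close>

lemma continuous_torus_homotopy:
  assumes "\<And>t x. t \<in> {0..1} \<Longrightarrow> \<exists>W F. open W \<and> (t, x) \<in> W \<and> continuous_on W F \<and>
      (\<forall>(s, y)\<in>W. s \<in> {0..1} \<longrightarrow> \<pi> (F (s, y)) = h (s, \<pi> y))"
  shows "torus_homotopy h"
  unfolding continuous_map_def
proof (intro conjI allI impI)
  show "h \<in> topspace (prod_topology (top_of_set {0..1}) (torus_topology \<Lambda>)) \<rightarrow> topspace (torus_topology \<Lambda>)"
  proof (clarsimp simp: Pi_iff)
    fix t p assume t: "0 \<le> t" "t \<le> (1::real)" and p: "p \<in> torus \<Lambda>"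
    obtain x where x: "p = \<pi> x" using p torusE by blast
    then obtain W F where "(t, x) \<in> W" "\<forall>(s, y)\<in>W. s \<in> {0..1} \<longrightarrow> \<pi> (F (s, y)) = h (s, \<pi> y)"
      using assms[of t x] t by auto
    then have "h (t, p) = \<pi> (F (t, x))" using t x by force
    then show "h (t, p) \<in> torus \<Lambda>" by simp
  qed
next
  fix U assume U: "openin (torus_topology \<Lambda>) U"
  let ?X = "prod_topology (top_of_set {0..1::real}) (torus_topology \<Lambda>)"
  show "openin ?X {z \<in> topspace ?X. h z \<in> U}"
    unfolding openin_prod_topology_alt
  proof (intro allI impI)
    fix t p assume tp: "(t, p) \<in> {z \<in> topspace ?X. h z \<in> U}"
    then have t: "t \<in> {0..1}" and hU: "h (t, p) \<in> U" by auto
    obtain x where x: "p = \<pi> x" using tp torusE by auto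
    obtain W F where W: "open W" "(t, x) \<in> W" "continuous_on W F"
      "\<And>s y. (s, y) \<in> W \<Longrightarrow> s \<in> {0..1} \<Longrightarrow> \<pi> (F (s, y)) = h (s, \<pi> y)"
      using assms[OF t, of x] by (auto split: prod.splits)
    have "open (W \<inter> F -` {x. \<pi> x \<in> U})"
      using W(1,3) U by (intro continuous_open_preimage) (auto simp: openin_torus_topology)
    moreover have "(t, x) \<in> W \<inter> F -` {x. \<pi> x \<in> U}" using W t hU x by simp
    ultimately obtain A B where AB: "open A" "open B" "(t, x) \<in> A \<times> B" "A \<times> B \<subseteq> W \<inter> F -` {x. \<pi> x \<in> U}"
      by (rule open_prod_elim)
    have "h (s, \<pi> y) \<in> U" if "s \<in> {0..1} \<inter> A" "y \<in> B" for s y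
    proof -
      have "(s, y) \<in> W \<inter> F -` {x. \<pi> x \<in> U}" using AB(4) that by blast
      then show ?thesis using W(4)[of s y] that by simp
    qed
    then have "({0..1} \<inter> A) \<times> (\<pi> ` B) \<subseteq> {z \<in> topspace ?X. h z \<in> U}" by auto
    moreover have "openin (top_of_set {0..1}) ({0..1} \<inter> A)" using AB(1) by blast
    ultimately show "\<exists>U' V. openin (top_of_set {0..1}) U' \<and> openin (torus_topology \<Lambda>) V \<and>
        t \<in> U' \<and> p \<in> V \<and> U' \<times> V \<subseteq> {z \<in> topspace ?X. h z \<in> U}"
      using openin_proj_image[OF AB(2)] AB(3) t x by blast
  qed
qed

lemma cover_diffeo_imp_Diff0:
  assumes e: "cover_diffeo F G" and f: "lifts f F"
  shows "f \<in> Diff0 \<Lambda>"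
proof -
  have F: "smooth F" "smooth G" "\<And>x. F (G x) = x" "\<And>x. G (F x) = x"
    "\<And>x l. l \<in> \<Lambda> \<Longrightarrow> F (x + l) = F x + l" using e by (auto simp: cover_diffeo_def)
  have G: "G (x + l) = G x + l" if "l \<in> \<Lambda>" for x l
    using cover_diffeo_sym[OF e] that by (auto simp: cover_diffeo_def)
  have fp: "f (\<pi> x) = \<pi> (F x)" for x using f by (simp add: lifts_def)
  have "inj_on f (torus \<Lambda>)"
  proof (rule inj_onI)
    fix p q assume "p \<in> torus \<Lambda>" "q \<in> torus \<Lambda>" and eq: "f p = f q"
    then obtain x y where xy: "p = \<pi> x" "q = \<pi> y" by (metis torusE)
    then have "F y - F x \<in> \<Lambda>" using eq fp by (simp add: proj_eq_iff)
    then have "G (F x + (F y - F x)) = G (F x) + (F y - F x)" by (rule G)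
    then have "y = x + (F y - F x)" by (simp add: F)
    then show "p = q" using \<open>F y - F x \<in> \<Lambda>\<close> xy proj_add_lattice by metis
  qed
  moreover have "f ` torus \<Lambda> = torus \<Lambda>"
  proof
    show "f ` torus \<Lambda> \<subseteq> torus \<Lambda>" using fp by (auto elim!: torusE)
    have "\<pi> y = f (\<pi> (G y))" for y by (simp add: fp F)
    then show "torus \<Lambda> \<subseteq> f ` torus \<Lambda>" by (metis imageI proj_in_torus subsetI torusE)
  qed
  ultimately have bij: "bij_betw f (torus \<Lambda>) (torus \<Lambda>)" by (simp add: bij_betw_def)
  have "inv_into (torus \<Lambda>) f (\<pi> y) = \<pi> (G y)" for y
    using bij by (intro inv_into_f_eq) (auto simp: bij_betw_def fp F)
  then have "smooth_map \<Lambda> (inv_into (torus \<Lambda>) f)"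
    unfolding smooth_map_def local_lift_def using F by (intro allI exI[of _ UNIV] exI[of _ G]) simp
  moreover have "smooth_map \<Lambda> f"
    unfolding smooth_map_def using lifts_local_lift[OF f F(1)] by blast
  ultimately have "diffeo \<Lambda> f" using bij by (simp add: diffeo_def)
  moreover have "homotopic_with (\<lambda>_. True) (torus_topology \<Lambda>) (torus_topology \<Lambda>) f id"
  proof -
    \<comment> \<open>The displacement of \<open>F\<close> is periodic, so the straight line homotopy from \<open>F\<close> to the identity
      descends to the torus.\<close>
    define h where "h = (\<lambda>z. let x = SOME x. \<pi> x = snd z in
      \<pi> ((1 - fst z) *\<^sub>R F x + fst z *\<^sub>R x))"
    have h: "h (t, \<pi> x) = \<pi> ((1 - t) *\<^sub>R F x + t *\<^sub>R x)" for t x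
    proof -
      define y where "y = (SOME y. \<pi> y = \<pi> x)"
      have "\<pi> y = \<pi> x" unfolding y_def by (rule proj_SOME) simp
      then have "x - y \<in> \<Lambda>" by (simp add: proj_eq_iff)
      then obtain d where d: "x = y + d" "d \<in> \<Lambda>" by (metis add_diff_cancel_left' diff_add_cancel add.commute)
      have "(1 - t) *\<^sub>R F x + t *\<^sub>R x = (1 - t) *\<^sub>R F y + t *\<^sub>R y + d"
        using F(5)[OF d(2), of y] by (simp add: d(1) algebra_simps)
      then show ?thesis using d(2) by (simp add: h_def y_def[symmetric])
    qed
    have "torus_homotopy h"
    proof (rule continuous_torus_homotopy)
      have "continuous_on UNIV (\<lambda>z. (1 - fst z) *\<^sub>R F (snd z) + fst z *\<^sub>R snd z)"
        by (intro continuous_intros continuous_on_compose2[OF smooth_on_continuous_on[OF F(1)]]) auto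
      then show "\<exists>W F. open W \<and> (t, x) \<in> W \<and> continuous_on W F \<and>
          (\<forall>(s, y)\<in>W. s \<in> {0..1} \<longrightarrow> \<pi> (F (s, y)) = h (s, \<pi> y))" for t x
        by (intro exI[of _ UNIV] exI[of _ "\<lambda>z. (1 - fst z) *\<^sub>R F (snd z) + fst z *\<^sub>R snd z"])
          (simp add: h)
    qed
    moreover have "\<forall>p\<in>topspace (torus_topology \<Lambda>). h (0, p) = f p"
      "\<forall>p\<in>topspace (torus_topology \<Lambda>). h (1, p) = id p"
      using h[of 0] h[of 1] by (auto simp: fp elim!: torusE)
    ultimately show ?thesis by (subst homotopic_with) auto
  qed
  ultimately show ?thesis by (simp add: Diff0_def)
qed

end

section \<open>Lifting diffeomorphisms isotopic to the identity\<close>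

context torus_lattice
begin

lemma homotopy_continuousD:
  assumes h: "torus_homotopy h"
    and t: "t \<in> {0..1}" and r: "0 < r" and y: "\<pi> y = h (t, \<pi> x)"
  obtains W where "open W" "(t, x) \<in> W"
    "\<And>s z. (s, z) \<in> W \<Longrightarrow> s \<in> {0..1} \<Longrightarrow> h (s, \<pi> z) \<in> \<pi> ` ball y r"
proof -
  let ?X = "prod_topology (top_of_set {0..1::real}) (torus_topology \<Lambda>)"
  have "openin ?X {z \<in> topspace ?X. h z \<in> \<pi> ` ball y r}"
    by (rule openin_continuous_map_preimage[OF h openin_proj_image[OF open_ball]])
  moreover have "(t, \<pi> x) \<in> {z \<in> topspace ?X. h z \<in> \<pi> ` ball y r}"
    using t r y by (auto intro!: image_eqI[of _ _ y])
  ultimately have "\<exists>U V. openin (top_of_set {0..1}) U \<and> openin (torus_topology \<Lambda>) V \<and> t \<in> U \<and>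
      \<pi> x \<in> V \<and> U \<times> V \<subseteq> {z \<in> topspace ?X. h z \<in> \<pi> ` ball y r}"
    by (rule openin_prod_topology_alt[THEN iffD1, rule_format])
  then obtain U V where UV: "openin (top_of_set {0..1}) U" "openin (torus_topology \<Lambda>) V" "t \<in> U"
    "\<pi> x \<in> V" "U \<times> V \<subseteq> {z \<in> topspace ?X. h z \<in> \<pi> ` ball y r}"
    by (elim exE conjE)
  obtain A where A: "open A" "U = {0..1} \<inter> A" using UV(1) openin_open by blast
  have "open (A \<times> {z. \<pi> z \<in> V})"
    using A(1) UV(2) by (simp add: open_Times openin_torus_topology)
  moreover have "(t, x) \<in> A \<times> {z. \<pi> z \<in> V}" using UV A by simp
  moreover have "h (s, \<pi> z) \<in> \<pi> ` ball y r"
    if "(s, z) \<in> A \<times> {z. \<pi> z \<in> V}" "s \<in> {0..1}" for s z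
  proof -
    have "(s, \<pi> z) \<in> U \<times> V" using that A(2) by simp
    then show ?thesis using UV(5) by blast
  qed
  ultimately show thesis by (rule that)
qed

text \<open>By compactness of the torus, times that are close enough have images in a common small ball, at all
  points of the torus at once.\<close>

lemma homotopy_uniform_steps:
  assumes h: "torus_homotopy h"
    and r: "0 < r"
  obtains \<delta> where "0 < \<delta>" "\<And>t t' x. t \<in> {0..1} \<Longrightarrow> t' \<in> {0..1} \<Longrightarrow> \<bar>t - t'\<bar> < \<delta> \<Longrightarrow>
      \<exists>y. h (t, \<pi> x) \<in> \<pi> ` ball y r \<and> h (t', \<pi> x) \<in> \<pi> ` ball y r"
proof -
  define \<G> where "\<G> = {W. open W \<and> (\<exists>y. \<forall>s z. (s, z) \<in> W \<longrightarrow> s \<in> {0..1} \<longrightarrow>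
      h (s, \<pi> z) \<in> \<pi> ` ball y r)}"
  have "\<exists>W\<in>\<G>. (t, x) \<in> W" if t: "t \<in> {0..1}" for t x
  proof -
    have "h (t, \<pi> x) \<in> torus \<Lambda>"
      using continuous_map_image_subset_topspace[OF h] t by (auto simp: image_subset_iff)
    then obtain y where "\<pi> y = h (t, \<pi> x)" by (metis torusE)
    then obtain W where "open W" "(t, x) \<in> W"
      "\<And>s z. (s, z) \<in> W \<Longrightarrow> s \<in> {0..1} \<Longrightarrow> h (s, \<pi> z) \<in> \<pi> ` ball y r"
      using homotopy_continuousD[OF h t r] by blast
    then show ?thesis unfolding \<G>_def by (intro bexI[of _ W] CollectI conjI exI[of _ y]) simp_all
  qed
  then have cover: "{0..1} \<times> cell \<subseteq> \<Union>\<G>" by (force simp del: atLeastAtMost_iff)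
  have K: "compact ({0..1::real} \<times> cell)" by (intro compact_Times compact_cell compact_Icc)
  obtain \<delta> where \<delta>: "0 < \<delta>" "\<And>z. z \<in> {0..1} \<times> cell \<Longrightarrow> \<exists>G\<in>\<G>. ball z \<delta> \<subseteq> G"
    using Heine_Borel_lemma[OF K cover] unfolding \<G>_def by blast
  show thesis
  proof (rule that[OF \<delta>(1)])
    fix t t' :: real and x assume t: "t \<in> {0..1}" "t' \<in> {0..1}" "\<bar>t - t'\<bar> < \<delta>"
    obtain l where l: "l \<in> \<Lambda>" "x + l \<in> domain" using domain_reduce by blast
    have "(t, x + l) \<in> {0..1} \<times> cell" using t l domain_subset_cell by blast
    then obtain G where G: "G \<in> \<G>" "ball (t, x + l) \<delta> \<subseteq> G" using \<delta>(2) by blast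
    have "(t, x + l) \<in> G" "(t', x + l) \<in> G"
      using G(2) \<delta>(1) t(3) by (auto simp: subset_iff dist_Pair_Pair dist_real_def)
    then obtain y where "h (t, \<pi> (x + l)) \<in> \<pi> ` ball y r"
        "h (t', \<pi> (x + l)) \<in> \<pi> ` ball y r"
      using G(1) t(1,2) unfolding \<G>_def by blast
    then show "\<exists>y. h (t, \<pi> x) \<in> \<pi> ` ball y r \<and> h (t', \<pi> x) \<in> \<pi> ` ball y r"
      using l(1) by auto
  qed
qed

definition cover_lift :: "(point \<Rightarrow> point) \<Rightarrow> (quat \<Rightarrow> quat) \<Rightarrow> bool" where
  "cover_lift f F \<longleftrightarrow>
     continuous_on UNIV F \<and> lifts f F \<and> (\<forall>x. \<forall>l\<in>\<Lambda>. F (x + l) = F x + l)"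

text \<open>One small step of the lifting of a homotopy: the displacement from \<open>h t\<close> to \<open>h t'\<close> is the unique
  short vector between the two points, so it is continuous and periodic.\<close>

lemma cover_lift_step:
  assumes h: "torus_homotopy h"
    and r: "0 < r" "\<And>l. l \<in> \<Lambda> \<Longrightarrow> norm l < 4 * r \<Longrightarrow> l = 0"
    and t': "t' \<in> {0..1}"
    and close: "\<And>x. \<exists>y. h (t, \<pi> x) \<in> \<pi> ` ball y r \<and> h (t', \<pi> x) \<in> \<pi> ` ball y r"
    and F: "cover_lift (\<lambda>p. h (t, p)) F"
  shows "\<exists>F'. cover_lift (\<lambda>p. h (t', p)) F'"
proof -
  have Fc: "continuous_on UNIV F" and Fl: "\<And>x. \<pi> (F x) = h (t, \<pi> x)"
    and Fe: "\<And>x l. l \<in> \<Lambda> \<Longrightarrow> F (x + l) = F x + l"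
    using F by (auto simp: cover_lift_def lifts_def)
  have "\<exists>v. norm v < 2 * r \<and> \<pi> (F x + v) = h (t', \<pi> x)" for x
  proof -
    obtain y y1 y2 where y: "h (t, \<pi> x) = \<pi> y1" "y1 \<in> ball y r"
      "h (t', \<pi> x) = \<pi> y2" "y2 \<in> ball y r"
      using close[of x] by blast
    have "dist y2 y1 < 2 * r"
      using y dist_triangle_less_add[of y2 y r y1 r] by (simp add: dist_commute)
    moreover have "\<pi> (F x + (y2 - y1)) = \<pi> y2"
    proof -
      have "y1 - F x \<in> \<Lambda>" using y(1) Fl[of x] by (metis proj_eq_iff)
      moreover have "y2 - (F x + (y2 - y1)) = y1 - F x" by simp
      ultimately show ?thesis unfolding proj_eq_iff by metis
    qed
    ultimately show ?thesis using y(3) by (intro exI[of _ "y2 - y1"]) (simp add: dist_norm)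
  qed
  then obtain V where V: "\<And>x. norm (V x) < 2 * r" "\<And>x. \<pi> (F x + V x) = h (t', \<pi> x)" by metis
  have uniq: "v = V x" if "norm v < 2 * r" "\<pi> (F x + v) = h (t', \<pi> x)" for v x
  proof -
    have "\<pi> (F x + v) = \<pi> (F x + V x)" using that V by simp
    then have "V x - v \<in> \<Lambda>" by (simp add: proj_eq_iff)
    moreover have "norm (V x - v) < 4 * r"
      using norm_triangle_ineq4[of "V x" v] V(1)[of x] that(1) by linarith
    ultimately show ?thesis using r(2) by fastforce
  qed
  let ?F' = "\<lambda>x. F x + V x"
  have "isCont ?F' x" for x
    unfolding isCont_def
  proof (rule tendstoI)
    fix e :: real assume e: "0 < e"
    (* so small that the displacement stays shorter than 2 r near x, where it is unique *)
    define d where "d = min e (2 * r - norm (V x))"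
    have d: "0 < d" "d \<le> e" "norm (V x) + d \<le> 2 * r" using e V(1)[of x] by (auto simp: d_def)
    obtain W where W: "open W" "(t', x) \<in> W"
      "\<And>s z. (s, z) \<in> W \<Longrightarrow> s \<in> {0..1} \<Longrightarrow> h (s, \<pi> z) \<in> \<pi> ` ball (?F' x) (d / 2)"
      using homotopy_continuousD[OF h t', of "d / 2" "?F' x" x] V(2)[of x] d(1) by auto
    have "open ((\<lambda>z. (t', z)) -` W)" using W(1) by (intro continuous_open_vimage continuous_intros)
    then have "\<forall>\<^sub>F z in at x. (t', z) \<in> W"
      using W(2) eventually_at_in_open'[of "(\<lambda>z. (t', z)) -` W" x] by simp
    moreover have "\<forall>\<^sub>F z in at x. dist (F z) (F x) < d / 2"
      using Fc d(1) by (intro tendstoD) (auto simp: continuous_on_def)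
    ultimately show "\<forall>\<^sub>F z in at x. dist (?F' z) (?F' x) < e"
    proof eventually_elim
      case (elim z)
      obtain w where w: "h (t', \<pi> z) = \<pi> w" "dist (?F' x) w < d / 2"
        using W(3)[OF elim(1) t'] by auto
      have "norm (w - F z) = norm ((w - ?F' x) + V x + (F x - F z))" by simp
      also have "\<dots> \<le> norm (w - ?F' x) + norm (V x) + norm (F x - F z)"
        by (intro norm_triangle_le add_mono norm_triangle_ineq order_refl)
      also have "\<dots> < d / 2 + norm (V x) + d / 2"
        using w(2) elim(2) by (simp add: dist_norm norm_minus_commute)
      also have "\<dots> \<le> 2 * r" using d by simp
      finally have "w - F z = V z" using w(1) by (intro uniq) simp_all
      then have "?F' z = w" by (simp add: algebra_simps)
      then show ?case using w(2) d by (simp add: dist_commute)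
    qed
  qed
  then have "continuous_on UNIV ?F'" by (simp add: continuous_at_imp_continuous_on)
  moreover have "?F' (x + l) = ?F' x + l" if l: "l \<in> \<Lambda>" for x l
  proof -
    have "\<pi> (F x + V (x + l)) = \<pi> (F (x + l) + V (x + l))"
      using l by (simp add: Fe proj_eq_iff)
    then have "V (x + l) = V x" using V[of "x + l"] l by (intro uniq) simp_all
    then show ?thesis using Fe[OF l] by simp
  qed
  ultimately have "cover_lift (\<lambda>p. h (t', p)) ?F'"
    using V(2) by (simp add: cover_lift_def lifts_def)
  then show ?thesis by blast
qed

text \<open>The identity of the torus lifts to the identity, so walking backwards in time along the homotopy in
  steps of length \<open>1 / n\<close> produces a lift of \<open>f\<close>.\<close>

lemma homotopic_id_imp_cover_lift:
  assumes "homotopic_with (\<lambda>_. True) (torus_topology \<Lambda>) (torus_topology \<Lambda>) f id"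
  obtains F where "cover_lift f F"
proof -
  obtain h where h: "torus_homotopy h"
    "\<And>p. h (0, p) = f p" "\<And>p. h (1, p) = p"
    using assms by (auto simp: homotopic_with_def)
  obtain r where r: "0 < r" "\<And>l. l \<in> \<Lambda> \<Longrightarrow> norm l < r \<Longrightarrow> l = 0" using lattice_discrete by blast
  obtain \<delta> where \<delta>: "0 < \<delta>" "\<And>t t' x. t \<in> {0..1} \<Longrightarrow> t' \<in> {0..1} \<Longrightarrow> \<bar>t - t'\<bar> < \<delta> \<Longrightarrow>
      \<exists>y. h (t, \<pi> x) \<in> \<pi> ` ball y (r / 4) \<and> h (t', \<pi> x) \<in> \<pi> ` ball y (r / 4)"
    using homotopy_uniform_steps[OF h(1), of "r / 4"] r(1) by (metis divide_pos_pos zero_less_numeral)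
  obtain n where n: "0 < n" "inverse (real n) < \<delta>" using reals_Archimedean[OF \<delta>(1)] by (metis zero_less_Suc)
  have "\<exists>F. cover_lift (\<lambda>p. h (1 - real k / real n, p)) F" if "k \<le> n" for k
    using that
  proof (induction k)
    case 0
    have "cover_lift (\<lambda>p. h (1, p)) (\<lambda>x. x)"
      by (auto simp: cover_lift_def lifts_def h(3))
    then show ?case by auto
  next
    case (Suc k)
    then obtain F where F: "cover_lift (\<lambda>p. h (1 - real k / real n, p)) F" by auto
    have t: "1 - real k / real n \<in> {0..1}" "1 - real (Suc k) / real n \<in> {0..1}"
      using Suc.prems n(1) by (auto simp: divide_simps)
    have "(1 - real k / real n) - (1 - real (Suc k) / real n) = inverse (real n)"
      using n(1) by (simp add: field_simps)
    then have "\<bar>(1 - real k / real n) - (1 - real (Suc k) / real n)\<bar> < \<delta>"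
      using n by (metis abs_of_pos inverse_positive_iff_positive of_nat_0_less_iff)
    then show ?case
      using r by (intro cover_lift_step[OF h(1) _ _ t(2) _ F, of "r / 4"] \<delta>(2) t) auto
  qed
  from this[of n] obtain F where "cover_lift (\<lambda>p. h (0, p)) F" using n(1) by auto
  then show thesis using that[of F] h(2) by simp
qed

text \<open>A continuous lift differs from a smooth local lift by a locally constant lattice vector.\<close>

lemma continuous_lift_smooth:
  assumes "smooth_map \<Lambda> f" "lifts f F" "continuous_on UNIV F"
  shows "smooth F"
proof (rule smooth_on_local)
  fix x :: quat
  obtain U F1 where U: "x \<in> U" "open U" "smooth_on U F1" "\<And>y. y \<in> U \<Longrightarrow> \<pi> (F1 y) = f (\<pi> y)"
    using assms(1) unfolding smooth_map_def local_lift_def by metis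
  have "\<pi> (F1 y) = \<pi> (F y)" if "y \<in> U" for y using U(4)[OF that] assms(2) by (simp add: lifts_def)
  from lifts_differ_by_constant[OF U(2,1) smooth_on_continuous_on[OF U(3)] continuous_on_subset[OF assms(3) subset_UNIV] this]
  obtain V c where V: "open V" "x \<in> V" "V \<subseteq> U" "\<And>y. y \<in> V \<Longrightarrow> F y = F1 y + c"
    by (metis (no_types, lifting))
  have "smooth_on V (\<lambda>y. F1 y + c)"
    using smooth_on_add[OF V(1) smooth_on_subset[OF U(3) V(3)] smooth_on_const] .
  then have "smooth_on V F" by (rule smooth_on_cong[OF V(1), rotated]) (simp add: V(4))
  then show "\<exists>U. open U \<and> x \<in> U \<and> smooth_on U F" using V by blast
qed

text \<open>Equivariance makes the lift bijective: \<open>F\<close> covers the bijection \<open>f\<close> and maps each lattice orbit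
  bijectively onto a lattice orbit.  Its inverse is smooth because locally it agrees, up to a lattice
  vector, with a lift of the inverse of \<open>f\<close>.\<close>

lemma Diff0_imp_cover_diffeo:
  assumes "f \<in> Diff0 \<Lambda>"
  obtains F G where "cover_diffeo F G" "lifts f F"
proof -
  have d: "diffeo \<Lambda> f" using assms by (simp add: Diff0_def)
  obtain F where "cover_lift f F"
    using assms homotopic_id_imp_cover_lift by (auto simp: Diff0_def)
  then have Fc: "continuous_on UNIV F" and Fl: "lifts f F" and Fe: "\<And>x l. l \<in> \<Lambda> \<Longrightarrow> F (x + l) = F x + l"
    by (auto simp: cover_lift_def)
  have fp: "f (\<pi> x) = \<pi> (F x)" for x using Fl by (simp add: lifts_def)
  have bij: "inj_on f (torus \<Lambda>)" "f ` torus \<Lambda> = torus \<Lambda>" using d by (auto simp: diffeo_def bij_betw_def)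
  have Fs: "smooth F"
    using d continuous_lift_smooth[OF _ Fl Fc] by (simp add: diffeo_def)
  have "inj F"
  proof (rule injI)
    fix x y assume eq: "F x = F y"
    then have "f (\<pi> x) = f (\<pi> y)" by (simp add: fp)
    then have "\<pi> x = \<pi> y" using bij(1) by (meson inj_onD proj_in_torus)
    then have "y - x \<in> \<Lambda>" by (simp add: proj_eq_iff)
    from Fe[OF this, of x] show "x = y" using eq by simp
  qed
  moreover have "surj F"
  proof (rule surjI)
    fix y
    have "\<pi> y \<in> f ` torus \<Lambda>" using bij(2) by simp
    then obtain x where "\<pi> y = f (\<pi> x)" by (metis imageE torusE)
    then have "y - F x \<in> \<Lambda>" using proj_eq_iff by (metis fp)
    from Fe[OF this, of x] have "F (x + (y - F x)) = y" by simp
    then show "F (SOME x. F x = y) = y" by (rule someI)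
  qed
  ultimately obtain G where FG: "\<And>x. F (G x) = x" "\<And>x. G (F x) = x"
    by (metis inv_f_f surj_f_inv_f)
  have Ge: "G (y + l) = G y + l" if "l \<in> \<Lambda>" for y l
    using Fe[OF that, of "G y"] FG by metis
  have "smooth G"
  proof (rule smooth_on_local)
    fix y :: quat
    obtain U G1 where U: "y \<in> U" "open U" "smooth_on U G1"
      "\<And>z. z \<in> U \<Longrightarrow> \<pi> (G1 z) = inv_into (torus \<Lambda>) f (\<pi> z)"
      using d unfolding diffeo_def smooth_map_def local_lift_def by metis
    have p: "\<pi> (F (G1 z)) = \<pi> z" if "z \<in> U" for z
      using U(4)[OF that] bij(2) by (metis f_inv_into_f fp proj_in_torus)
    have c: "continuous_on U (\<lambda>z. F (G1 z))"
      using continuous_on_compose2[OF Fc smooth_on_continuous_on[OF U(3)]] by simp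
    from lifts_differ_by_constant[OF U(2,1) c continuous_on_id p]
    obtain V c where V: "open V" "y \<in> V" "V \<subseteq> U" "c \<in> \<Lambda>" "\<And>z. z \<in> V \<Longrightarrow> z = F (G1 z) + c"
      by (metis (no_types, lifting) id_apply)
    have G: "G z = G1 z + c" if "z \<in> V" for z
      using V(5)[OF that] Ge[OF V(4), of "F (G1 z)"] FG(2) by metis
    have "smooth_on V (\<lambda>y. G1 y + c)"
      using smooth_on_add[OF V(1) smooth_on_subset[OF U(3) V(3)] smooth_on_const] .
    then have "smooth_on V G" by (rule smooth_on_cong[OF V(1), rotated]) (simp add: G)
    then show "\<exists>U. open U \<and> y \<in> U \<and> smooth_on U G" using V by blast
  qed
  then show thesis using that[of F G] Fs FG Fe Fl by (simp add: cover_diffeo_def)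
qed

lemma lifts_cong: "lifts f F \<Longrightarrow> (\<And>p. p \<in> torus \<Lambda> \<Longrightarrow> f p = g p) \<Longrightarrow> lifts g F"
  by (simp add: lifts_def)

lemma Diff0_cong:
  assumes "f \<in> Diff0 \<Lambda>" "\<And>p. p \<in> torus \<Lambda> \<Longrightarrow> f p = g p"
  shows "g \<in> Diff0 \<Lambda>"
  using Diff0_imp_cover_diffeo[OF assms(1)] cover_diffeo_imp_Diff0 lifts_cong assms(2) by metis

lemma lifts_compose: "lifts f F \<Longrightarrow> lifts g G \<Longrightarrow> lifts (g \<circ> f) (\<lambda>x. G (F x))"
  by (simp add: lifts_def)

lemma Diff0_compose:
  assumes "f \<in> Diff0 \<Lambda>" "g \<in> Diff0 \<Lambda>"
  shows "g \<circ> f \<in> Diff0 \<Lambda>"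
proof -
  obtain F F' where F: "cover_diffeo F F'" "lifts f F" using Diff0_imp_cover_diffeo[OF assms(1)] .
  obtain G G' where G: "cover_diffeo G G'" "lifts g G" using Diff0_imp_cover_diffeo[OF assms(2)] .
  show ?thesis
    using cover_diffeo_imp_Diff0[OF cover_diffeo_compose[OF F(1) G(1)] lifts_compose[OF F(2) G(2)]] .
qed

lemma lifts_shift:
  assumes "lifts f F" shows "lifts (shift f t u) (\<lambda>x. F x + t *\<^sub>R u (\<pi> x))"
  using assms by (simp add: lifts_def shift_def proj_translate[symmetric])

text \<open>A small periodic perturbation of the identity is a diffeomorphism: it is a contractive
  perturbation, so it is bijective by Banach's fixed point theorem, with Lipschitz inverse.\<close>

lemma small_perturbation_cover_diffeo:
  assumes w: "smooth w" "periodic w"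
  obtains d where "0 < d" "\<And>t. \<bar>t\<bar> < d \<Longrightarrow> \<exists>G. cover_diffeo (\<lambda>x. x + t *\<^sub>R w x) G"
proof -
  obtain L where L: "0 \<le> L" "\<And>x v. norm (Df w x v) \<le> L * norm v"
    "\<And>x y. norm (w x - w y) \<le> L * norm (x - y)"
    using periodic_smooth_frechet_bounded[OF w] by blast
  show thesis
  proof (rule that[of "1 / (L + 1)"])
    show "0 < 1 / (L + 1)" using L(1) by simp
    fix t :: real assume t: "\<bar>t\<bar> < 1 / (L + 1)"
    (* a Lipschitz constant of t w; the bound on t makes it less than 1, also if L = 0 *)
    define c where "c = \<bar>t\<bar> * L"
    have "\<bar>t\<bar> * (L + 1) < 1" using t L(1) by (simp add: field_simps)
    then have c: "0 \<le> c" "c < 1" using L(1) by (auto simp: c_def algebra_simps)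
    define F where "F = (\<lambda>x. x + t *\<^sub>R w x)"
    have con: "norm (t *\<^sub>R w x - t *\<^sub>R w y) \<le> c * norm (x - y)" for x y
    proof -
      have "norm (t *\<^sub>R w x - t *\<^sub>R w y) = \<bar>t\<bar> * norm (w x - w y)"
        by (simp add: scaleR_diff_right[symmetric])
      also have "\<dots> \<le> \<bar>t\<bar> * (L * norm (x - y))" by (intro mult_left_mono L) simp
      finally show ?thesis by (simp add: c_def)
    qed
    have low: "(1 - c) * norm (x - y) \<le> norm (F x - F y)" for x y
    proof -
      have "norm (x - y) = norm ((F x - F y) - (t *\<^sub>R w x - t *\<^sub>R w y))" by (simp add: F_def)
      also have "\<dots> \<le> norm (F x - F y) + c * norm (x - y)"
        using norm_triangle_ineq4[of "F x - F y" "t *\<^sub>R w x - t *\<^sub>R w y"] con[of x y] by linarith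
      finally show ?thesis by (simp add: algebra_simps)
    qed
    have "\<exists>x. F x = y" for y
    proof -
      have "\<forall>x z. dist (y - t *\<^sub>R w x) (y - t *\<^sub>R w z) \<le> c * dist x z"
        using con by (auto simp: dist_norm norm_minus_commute)
      from banach_fix_type[OF c this] have "\<exists>!x. y - t *\<^sub>R w x = x" .
      then obtain x where "y - t *\<^sub>R w x = x" by blast
      then have "F x = y" by (simp add: F_def algebra_simps)
      then show ?thesis by blast
    qed
    then obtain G where FG: "\<And>y. F (G y) = y" by metis
    have GF: "G (F x) = x" for x
    proof -
      have "(1 - c) * norm (G (F x) - x) \<le> 0" using low[of "G (F x)" x] by (simp add: FG)
      then show ?thesis using c by (simp add: mult_le_0_iff)
    qed
    have Fs: "smooth F"
      unfolding F_def by (intro smooth_on_add smooth_on_scaleR smooth_on_id smooth_on_const w(1)) auto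
    have "continuous_on UNIV G"
    proof (rule lipschitz_on_continuous_on[OF lipschitz_onI])
      show "dist (G x) (G y) \<le> 1 / (1 - c) * dist x y" for x y
        using low[of "G x" "G y"] c by (simp add: FG dist_norm field_simps)
    qed (use c in simp)
    moreover have "v = 0" if v: "Df F x v = 0" for x v
    proof -
      have "(F has_derivative (\<lambda>v. v + t *\<^sub>R Df w x v)) (at x)"
        unfolding F_def using smooth_on_has_derivative[OF w(1)] by (auto intro!: derivative_eq_intros)
      then have "Df F x v = v + t *\<^sub>R Df w x v"
        by (simp add: frechet_derivative_eq)
      then have "v = - (t *\<^sub>R Df w x v)" using v by (simp add: eq_neg_iff_add_eq_0)
      then have "norm v = \<bar>t\<bar> * norm (Df w x v)" by (metis norm_minus_cancel norm_scaleR)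
      also have "\<dots> \<le> \<bar>t\<bar> * (L * norm v)" by (intro mult_left_mono L) simp
      finally have "(1 - c) * norm v \<le> 0" by (simp add: c_def algebra_simps)
      then show "v = 0" using c by (simp add: mult_le_0_iff)
    qed
    ultimately have "smooth G" by (intro smooth_inverse_function[OF Fs FG])
    moreover have "F (x + l) = F x + l" if "l \<in> \<Lambda>" for x l
      using w(2) that by (simp add: F_def periodic_def)
    ultimately have "cover_diffeo F G" by (simp add: cover_diffeo_def Fs FG GF)
    then show "\<exists>G. cover_diffeo (\<lambda>x. x + t *\<^sub>R w x) G" unfolding F_def by blast
  qed
qed

text \<open>With \<open>w = u \<circ> inv f\<close>, the map \<open>f + t u\<close> is the composition of \<open>f\<close> with the perturbation
  \<open>x + t w x\<close> of the identity.\<close>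

lemma shift_in_Diff0:
  assumes f: "f \<in> Diff0 \<Lambda>" and u: "u \<in> fields \<Lambda>"
  shows "\<forall>\<^sub>F t in at 0. shift f t u \<in> Diff0 \<Lambda>"
proof -
  obtain F G where F: "cover_diffeo F G" "lifts f F" using Diff0_imp_cover_diffeo[OF f] .
  have us: "smooth (\<lambda>x. u (\<pi> x))" using u by (simp add: fields_def smooth_fun_def)
  have G: "smooth G" "\<And>x. G (F x) = x" using F by (auto simp: cover_diffeo_def)
  define w where "w = (\<lambda>x. u (\<pi> (G x)))"
  have "smooth w" unfolding w_def by (rule smooth_compose[OF us G(1)])
  moreover have "periodic w"
    using cover_diffeo_sym[OF F(1)] by (simp add: w_def periodic_def cover_diffeo_def)
  ultimately obtain d where d: "0 < d" "\<And>t. \<bar>t\<bar> < d \<Longrightarrow> \<exists>H. cover_diffeo (\<lambda>x. x + t *\<^sub>R w x) H"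
    using small_perturbation_cover_diffeo by blast
  have "shift f t u \<in> Diff0 \<Lambda>" if t: "\<bar>t\<bar> < d" for t
  proof -
    obtain H where "cover_diffeo (\<lambda>x. x + t *\<^sub>R w x) H" using d(2)[OF t] by blast
    from cover_diffeo_compose[OF F(1) this]
    have "cover_diffeo (\<lambda>x. F x + t *\<^sub>R u (\<pi> x)) (\<lambda>x. G (H x))"
      by (simp add: w_def G(2))
    then show ?thesis using lifts_shift[OF F(2)] by (rule cover_diffeo_imp_Diff0)
  qed
  then show ?thesis using d(1) by (auto simp: eventually_at dist_real_def)
qed

end

section \<open>Integration over the torus\<close>

context torus_lattice
begin

lemma torus_integral_domain: "torus_integral \<Lambda> h = (LINT x : domain | lborel. h (\<pi> x))"
  by (simp add: torus_integral_def basis_def)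

lemma continuous_coord: "continuous_on A (\<lambda>x. coord x $ i)"
  by (intro continuous_intros linear_continuous_on linear_coord[THEN linear_conv_bounded_linear[THEN iffD1]])

lemma domain_borel [measurable]: "domain \<in> sets borel"
proof -
  have "domain = (\<Inter>i\<in>UNIV. {x. 0 \<le> coord x $ i} \<inter> {x. coord x $ i < 1})"
    by (auto simp: domain_eq)
  moreover have "{x. 0 \<le> coord x $ i} \<in> sets borel" for i
    by (intro borel_closed closed_Collect_le continuous_on_const continuous_coord)
  moreover have "{x. coord x $ i < 1} \<in> sets borel" for i
    by (intro borel_open open_Collect_less continuous_on_const continuous_coord)
  ultimately show ?thesis by (simp add: sets.finite_INT)
qed

lemma bounded_set_integrable:
  fixes g :: "quat \<Rightarrow> real"
  assumes "A \<in> sets borel" "bounded A" "continuous_on UNIV g"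
  shows "set_integrable lborel A g"
proof -
  have "set_integrable lborel (closure A) g"
    unfolding set_integrable_def
    using assms(2,3) by (intro borel_integrable_compact) (auto intro: continuous_on_subset)
  then show ?thesis
    by (rule set_integrable_subset) (use assms(1) closure_subset in auto)
qed

lemmas domain_integrable = bounded_set_integrable[OF domain_borel bounded_domain]

text \<open>A periodic function has the same integral over all bounded fundamental sets \<open>A\<close>: cut \<open>A\<close> into the
  finitely many pieces that lie in translates of the fundamental parallelepiped, and translate each
  piece back.\<close>

lemma fundamental_set_integral:
  fixes g :: "quat \<Rightarrow> real"
  assumes A: "A \<in> sets borel" "bounded A"
    and ex: "\<And>x. \<exists>l\<in>\<Lambda>. x + l \<in> A" and un: "\<And>x l. x \<in> A \<Longrightarrow> x + l \<in> A \<Longrightarrow> l \<in> \<Lambda> \<Longrightarrow> l = 0"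
    and g: "periodic g" "continuous_on UNIV g"
  shows "(LINT x:A|lborel. g x) = (LINT x:domain|lborel. g x)"
proof -
  obtain R1 where R1: "\<And>x. x \<in> A \<Longrightarrow> norm x \<le> R1" using A(2) bounded_iff by blast
  obtain R2 where R2: "\<And>x. x \<in> domain \<Longrightarrow> norm x \<le> R2" using bounded_domain bounded_iff by blast
  define L where "L = {l \<in> \<Lambda>. norm l \<le> R1 + R2}"
  have L: "finite L" unfolding L_def by (rule finite_lattice_bounded)
  have small: "norm l \<le> R1 + R2" if "x \<in> A" "x + l \<in> domain" for x l
    using R1[OF that(1)] R2[OF that(2)] norm_triangle_ineq4[of "x + l" x] by simp
  (* each point of A has exactly one translate in the parallelepiped, and vice versa *)
  have sumD: "(\<Sum>l\<in>L. indicator domain (x + l)) = (1::real)" if x: "x \<in> A" for x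
  proof -
    obtain l0 where l0: "l0 \<in> \<Lambda>" "x + l0 \<in> domain" using domain_reduce by blast
    have "x + l \<in> domain \<longleftrightarrow> l = l0" if l: "l \<in> L" for l
    proof
      assume "x + l \<in> domain"
      then have "x + l0 + (l - l0) \<in> domain" by simp
      moreover have "l - l0 \<in> \<Lambda>" using l l0(1) by (intro lattice_diff) (simp_all add: L_def)
      ultimately have "l - l0 = 0" using domain_unique[OF l0(2)] by blast
      then show "l = l0" by simp
    qed (simp add: l0)
    then have "(\<Sum>l\<in>L. indicator domain (x + l)) = (\<Sum>l\<in>L. if l = l0 then 1 else (0::real))"
      by (intro sum.cong refl) (simp add: indicator_def)
    moreover have "l0 \<in> L" using l0 small[OF x] by (simp add: L_def)
    ultimately show ?thesis using L by simp
  qed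
  have sumA: "(\<Sum>l\<in>L. indicator A (y - l)) = (1::real)" if y: "y \<in> domain" for y
  proof -
    obtain l1 where l1: "l1 \<in> \<Lambda>" "y + l1 \<in> A" using ex by blast
    have "y - l \<in> A \<longleftrightarrow> l = - l1" if l: "l \<in> L" for l
    proof
      assume "y - l \<in> A"
      then have "y + l1 + (- l - l1) \<in> A" by simp
      moreover have "- l - l1 \<in> \<Lambda>" using l l1 by (intro lattice_diff) (auto simp: L_def)
      ultimately have "- l - l1 = 0" using un[OF l1(2)] by blast
      then show "l = - l1" by (metis add.inverse_inverse eq_iff_diff_eq_0)
    qed (use l1 in simp)
    then have "(\<Sum>l\<in>L. indicator A (y - l)) = (\<Sum>l\<in>L. if l = - l1 then 1 else (0::real))"
      by (intro sum.cong refl) (simp add: indicator_def)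
    moreover have "- l1 \<in> L" using l1 small[OF l1(2), of "- l1"] y by (simp add: L_def)
    ultimately show ?thesis using L by simp
  qed
  have gm: "g \<in> borel_measurable borel" using g(2) by (rule borel_measurable_continuous_onI)
  let ?f = "\<lambda>l x. indicator A (x - l) * (indicator domain x * g x)"
  have piece: "integrable lborel (?f l)" for l
  proof -
    have "set_integrable lborel (domain \<inter> (\<lambda>x. x - l) -` A) g"
      using A(1) bounded_domain g(2) by (intro bounded_set_integrable) (auto intro!: sets.Int measurable_sets_borel[of "\<lambda>x. x - l" borel] intro: bounded_subset)
    then show ?thesis
      unfolding set_integrable_def by (rule Bochner_Integration.integrable_cong[THEN iffD1, rotated 2]) (auto simp: indicator_def)
  qed
  have shift: "(LINT x|lborel. ?f l (x + l)) = (LINT x|lborel. ?f l x)"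
    "integrable lborel (\<lambda>x. ?f l (x + l))" for l
  proof -
    have m: "?f l \<in> borel_measurable borel" using piece by (auto dest: borel_measurable_integrable)
    have d: "distr lborel borel (\<lambda>x. x + l) = lborel"
    proof -
      have "(\<lambda>x. x + l) = (+) l" by (auto simp: add.commute)
      then show ?thesis using lborel_distr_plus[of l] by metis
    qed
    show "(LINT x|lborel. ?f l (x + l)) = (LINT x|lborel. ?f l x)"
      using integral_distr[of "\<lambda>x. x + l" lborel borel "?f l"] m by (simp add: d)
    show "integrable lborel (\<lambda>x. ?f l (x + l))"
      using integrable_distr_eq[of "\<lambda>x. x + l" lborel borel "?f l"] m piece[of l] by (simp add: d)
  qed
  have "(LINT x:A|lborel. g x) = (LINT x|lborel. (\<Sum>l\<in>L. ?f l (x + l)))"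
    unfolding set_lebesgue_integral_def
  proof (rule Bochner_Integration.integral_cong[OF refl])
    fix x
    have "(\<Sum>l\<in>L. ?f l (x + l)) = (\<Sum>l\<in>L. indicator A x * g x * indicator domain (x + l))"
      using g(1) by (intro sum.cong refl) (simp add: periodic_def L_def)
    also have "\<dots> = indicator A x * g x * (\<Sum>l\<in>L. indicator domain (x + l))" by (simp add: sum_distrib_left)
    also have "\<dots> = indicator A x * g x" using sumD[of x] by (cases "x \<in> A") simp_all
    finally show "indicator A x *\<^sub>R g x = (\<Sum>l\<in>L. ?f l (x + l))" by simp
  qed
  also have "\<dots> = (\<Sum>l\<in>L. LINT x|lborel. ?f l (x + l))"
    by (rule Bochner_Integration.integral_sum) (rule shift(2))
  also have "\<dots> = (\<Sum>l\<in>L. LINT x|lborel. ?f l x)"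
    by (simp only: shift(1))
  also have "\<dots> = (LINT x|lborel. (\<Sum>l\<in>L. ?f l x))"
    by (rule Bochner_Integration.integral_sum[symmetric]) (rule piece)
  also have "\<dots> = (LINT x:domain|lborel. g x)"
    unfolding set_lebesgue_integral_def
  proof (rule Bochner_Integration.integral_cong[OF refl])
    fix x
    have "(\<Sum>l\<in>L. ?f l x) = (\<Sum>l\<in>L. indicator A (x - l)) * (indicator domain x * g x)"
      by (simp add: sum_distrib_right)
    then show "(\<Sum>l\<in>L. ?f l x) = indicator domain x *\<^sub>R g x"
      using sumA[of x] by (cases "x \<in> domain") simp_all
  qed
  finally show ?thesis .
qed

text \<open>The image of the fundamental parallelepiped under an equivariant diffeomorphism is another bounded
  fundamental set, so the change of variables formula leads back to the same integral.\<close>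

lemma integral_volume_preserving:
  fixes g :: "quat \<Rightarrow> real"
  assumes F: "cover_diffeo F G" and det: "\<And>x. \<bar>det (matrix (Df F x))\<bar> = 1"
    and g: "periodic g" "continuous_on UNIV g"
  shows "(LINT x:domain|lborel. g (F x)) = (LINT x:domain|lborel. g x)"
proof -
  have Fs: "smooth F" "smooth G" and FG: "\<And>x. F (G x) = x" "\<And>x. G (F x) = x"
    and Fe: "\<And>x l. l \<in> \<Lambda> \<Longrightarrow> F (x + l) = F x + l" using F by (auto simp: cover_diffeo_def)
  have Ge: "\<And>x l. l \<in> \<Lambda> \<Longrightarrow> G (x + l) = G x + l"
    using cover_diffeo_sym[OF F] by (auto simp: cover_diffeo_def)
  have Fc: "continuous_on UNIV F" "continuous_on UNIV G" using Fs smooth_on_continuous_on by auto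
  have gF: "continuous_on UNIV (\<lambda>x. g (F x))" using continuous_on_compose2[OF g(2) Fc(1)] by simp
  have mem: "x \<in> F ` domain \<longleftrightarrow> G x \<in> domain" for x
    using FG by (metis imageE imageI)
  have FD: "F ` domain \<in> sets borel" "bounded (F ` domain)"
  proof -
    have "F ` domain = G -` domain \<inter> space borel" using mem by auto
    then show "F ` domain \<in> sets borel"
      using measurable_sets[OF borel_measurable_continuous_onI[OF Fc(2)] domain_borel] by simp
    have "compact (F ` cell)" using Fc(1) compact_cell compact_continuous_image continuous_on_subset by blast
    then show "bounded (F ` domain)"
      using domain_subset_cell by (meson bounded_subset compact_imp_bounded image_mono)
  qed
  have vec_linear: "bounded_linear (vec :: real \<Rightarrow> real^1)"
    by (rule linear_conv_bounded_linear[THEN iffD1]) simp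
  have "integral (F ` domain) (\<lambda>x. vec (g x) :: real^1) =
      integral domain (\<lambda>x. \<bar>det (matrix (Df F x))\<bar> *\<^sub>R vec (g (F x)))"
  proof (rule integral_change_of_variables)
    show "domain \<in> sets lebesgue" by simp
    show "(F has_derivative Df F x) (at x within domain)" for x
      using smooth_on_has_derivative[OF Fs(1)] has_derivative_at_withinI by blast
    show "inj_on F domain" using FG(2) by (metis inj_onI)
    have "(\<lambda>x. g (F x)) absolutely_integrable_on domain"
      using domain_integrable[OF gF] unfolding set_integrable_def
      by (subst integrable_completion) (auto dest: borel_measurable_integrable)
    from absolutely_integrable_linear[OF this vec_linear]
    have "(\<lambda>x. vec (g (F x)) :: real^1) absolutely_integrable_on domain" by (simp add: o_def)
    then show "(\<lambda>x. vec (g x) :: real^1) absolutely_integrable_on F ` domain \<or>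
        (\<lambda>x. \<bar>det (matrix (Df F x))\<bar> *\<^sub>R (vec (g (F x)) :: real^1)) absolutely_integrable_on domain"
      by (simp add: det)
  qed
  then have vec: "integral (F ` domain) (\<lambda>x. vec (g x) :: real^1) = integral domain (\<lambda>x. vec (g (F x)))"
    by (simp add: det)
  have lint: "integral S h = (LINT x:S|lborel. h x)" "h integrable_on S"
    if "S \<in> sets borel" "bounded S" "continuous_on UNIV h" for S and h :: "quat \<Rightarrow> real"
    using set_borel_integral_eq_integral[OF bounded_set_integrable[OF that]] by simp_all
  have comp: "integral S (\<lambda>x. vec (h x) :: real^1) $ 1 = integral S h" if "h integrable_on S" for S and h :: "quat \<Rightarrow> real"
  proof -
    have "(\<lambda>x. vec (h x) :: real^1) integrable_on S"
      using integrable_linear[OF that vec_linear] by (simp add: o_def)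
    from integral_component_eq_cart[OF this, of 1] show ?thesis by simp
  qed
  have "(LINT x:domain|lborel. g (F x)) = integral domain (\<lambda>x. g (F x))"
    using lint(1)[OF domain_borel bounded_domain gF] by simp
  also have "\<dots> = integral (F ` domain) g"
    using vec comp[OF lint(2)[OF domain_borel bounded_domain gF]] comp[OF lint(2)[OF FD g(2)]] by simp
  also have "\<dots> = (LINT x:F ` domain|lborel. g x)" by (rule lint(1)[OF FD g(2)])
  also have "\<dots> = (LINT x:domain|lborel. g x)"
  proof (rule fundamental_set_integral[OF FD _ _ g])
    show "\<exists>l\<in>\<Lambda>. x + l \<in> F ` domain" for x
      using domain_reduce[of "G x"] by (metis Ge mem)
    show "l = 0" if "x \<in> F ` domain" "x + l \<in> F ` domain" "l \<in> \<Lambda>" for x l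
      using that domain_unique[of "G x" l] by (simp add: mem Ge)
  qed
  finally show ?thesis .
qed

lemma integral_translate:
  fixes g :: "quat \<Rightarrow> real"
  assumes "periodic g" "continuous_on UNIV g"
  shows "(LINT x:domain|lborel. g (x + c)) = (LINT x:domain|lborel. g x)"
proof (rule integral_volume_preserving[where G = "\<lambda>x. x - c", OF _ _ assms])
  have s: "smooth (\<lambda>x::quat. x + d)" for d
    using smooth_on_add[OF open_UNIV smooth_on_id[OF open_UNIV] smooth_on_const] .
  show "cover_diffeo (\<lambda>x. x + c) (\<lambda>x. x - c)"
    using s[of c] s[of "- c"] by (simp add: cover_diffeo_def)
  have "((\<lambda>x. x + c) has_derivative (\<lambda>v. v)) (at x)" for x by (auto intro!: derivative_eq_intros)
  then have "Df (\<lambda>x. x + c) x = (\<lambda>v. v)" for x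
    by (rule frechet_derivative_eq)
  then show "\<bar>det (matrix (Df (\<lambda>x. x + c) x))\<bar> = 1" for x
    by (simp add: matrix_id[unfolded id_def])
qed

text \<open>Differentiating the invariance under translations: derivatives of periodic functions have
  integral zero, which is integration by parts on the torus.\<close>

lemma integral_derivative:
  fixes g :: "quat \<Rightarrow> real"
  assumes "smooth g" "periodic g"
  shows "(LINT x:domain|lborel. Df g x v) = 0"
proof -
  obtain L where L: "0 \<le> L" "\<And>x v. norm (Df g x v) \<le> L * norm v"
    "\<And>x y. norm (g x - g y) \<le> L * norm (x - y)"
    using periodic_smooth_frechet_bounded[OF assms] by blast
  have gc: "continuous_on UNIV g" using assms(1) by (rule smooth_on_continuous_on)
  have gtc: "continuous_on UNIV (\<lambda>x. g (x + c))" for c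
    by (rule continuous_on_compose2[OF gc]) (auto intro!: continuous_intros)
  define t :: "nat \<Rightarrow> real" where "t n = inverse (real (Suc n))" for n
  have t: "0 < t n" for n by (simp add: t_def)
  have t0: "t \<longlonglongrightarrow> 0" unfolding t_def by (rule LIMSEQ_inverse_real_of_nat)
  let ?s = "\<lambda>n x. indicator domain x *\<^sub>R ((g (x + t n *\<^sub>R v) - g x) / t n)"
  have lim: "(\<lambda>n. LINT x|lborel. ?s n x) \<longlonglongrightarrow> (LINT x|lborel. indicator domain x *\<^sub>R Df g x v)"
  proof (rule integral_dominated_convergence)
    show "(\<lambda>x. indicator domain x *\<^sub>R Df g x v) \<in> borel_measurable lborel"
      using domain_integrable[OF smooth_on_continuous_on[OF smooth_on_frechet[OF assms(1)]]]
      unfolding set_integrable_def by (rule borel_measurable_integrable)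
    show "?s n \<in> borel_measurable lborel" for n
    proof -
      have "continuous_on UNIV (\<lambda>x. (g (x + t n *\<^sub>R v) - g x) / t n)"
        using t[of n] by (intro continuous_intros gc gtc) auto
      from domain_integrable[OF this] show ?thesis
        unfolding set_integrable_def by (rule borel_measurable_integrable)
    qed
    show "integrable lborel (\<lambda>x. indicator domain x *\<^sub>R (L * norm v))"
      using domain_integrable[of "\<lambda>x. L * norm v"] by (simp add: set_integrable_def)
    show "AE x in lborel. norm (?s n x) \<le> indicator domain x *\<^sub>R (L * norm v)" for n
    proof (intro always_eventually allI)
      fix x
      have "norm (g (x + t n *\<^sub>R v) - g x) \<le> L * (t n * norm v)"
        using L(3)[of "x + t n *\<^sub>R v" x] t[of n] by simp
      then show "norm (?s n x) \<le> indicator domain x *\<^sub>R (L * norm v)"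
        using t[of n] by (simp add: indicator_def divide_simps mult_ac)
    qed
    show "AE x in lborel. (\<lambda>n. ?s n x) \<longlonglongrightarrow> indicator domain x *\<^sub>R Df g x v"
    proof (intro always_eventually allI)
      fix x
      have "((\<lambda>h. g (x + h *\<^sub>R v)) has_real_derivative Df g x v) (at 0)"
      proof -
        have "((\<lambda>h. x + h *\<^sub>R v) has_derivative (\<lambda>h. h *\<^sub>R v)) (at 0)"
          by (auto intro!: derivative_eq_intros)
        moreover have "(g has_derivative Df g x) (at (x + 0 *\<^sub>R v))"
          using smooth_on_has_derivative[OF assms(1)] by simp
        ultimately have "((\<lambda>h. g (x + h *\<^sub>R v)) has_derivative (\<lambda>h. Df g x (h *\<^sub>R v))) (at 0)"
          by (rule has_derivative_compose)
        then show ?thesis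
          by (rule has_derivative_imp_has_field_derivative)
            (simp add: linear_scale[OF smooth_on_linear_frechet[OF assms(1)]])
      qed
      then have "((\<lambda>h. (g (x + h *\<^sub>R v) - g x) / h) \<longlongrightarrow> Df g x v) (at 0)"
        by (simp add: DERIV_def)
      moreover have "filterlim t (at 0) sequentially"
        using t0 t by (auto simp: filterlim_at intro!: always_eventually) (metis less_irrefl)
      ultimately have "(\<lambda>n. (g (x + t n *\<^sub>R v) - g x) / t n) \<longlonglongrightarrow> Df g x v"
        by (rule filterlim_compose)
      then show "(\<lambda>n. ?s n x) \<longlonglongrightarrow> indicator domain x *\<^sub>R Df g x v"
        by (rule tendsto_scaleR[OF tendsto_const])
    qed
  qed
  have zero: "(LINT x|lborel. ?s n x) = 0" for n
  proof -
    have "(LINT x:domain|lborel. g (x + t n *\<^sub>R v) - g x) = 0"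
      using integral_translate[OF assms(2) gc, of "t n *\<^sub>R v"]
      by (simp add: set_integral_diff domain_integrable gc gtc)
    then have "(LINT x:domain|lborel. (g (x + t n *\<^sub>R v) - g x) / t n) = 0"
      by (simp add: set_integral_divide_zero)
    then show ?thesis by (simp add: set_lebesgue_integral_def)
  qed
  have "(LINT x|lborel. indicator domain x *\<^sub>R Df g x v) = 0"
    using lim unfolding zero LIMSEQ_const_iff by simp
  then show ?thesis by (simp add: set_lebesgue_integral_def)
qed

lemma periodic_mult: "periodic g \<Longrightarrow> periodic h \<Longrightarrow> periodic (\<lambda>x. g x * h x :: real)"
  by (simp add: periodic_def)

lemma integral_by_parts:
  fixes g h :: "quat \<Rightarrow> real"
  assumes g: "smooth g" "periodic g" and h: "smooth h" "periodic h"
  shows "(LINT x:domain|lborel. Df g x v * h x) =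
      - (LINT x:domain|lborel. g x * Df h x v)"
proof -
  have "Df (\<lambda>x. g x * h x) x v =
      Df g x v * h x + g x * Df h x v" for x
  proof -
    have "((\<lambda>x. g x * h x) has_derivative (\<lambda>v. g x * Df h x v +
        Df g x v * h x)) (at x)"
      using smooth_on_has_derivative[OF g(1)] smooth_on_has_derivative[OF h(1)]
      by (intro has_derivative_mult) simp_all
    then show ?thesis by (simp add: frechet_derivative_eq)
  qed
  moreover have "(LINT x:domain|lborel. Df (\<lambda>x. g x * h x) x v) = 0"
    by (intro integral_derivative smooth_on_mult periodic_mult assms open_UNIV)
  moreover have "set_integrable lborel domain (\<lambda>x. Df g x v * h x)"
    "set_integrable lborel domain (\<lambda>x. g x * Df h x v)"
    by (intro domain_integrable smooth_on_continuous_on smooth_on_mult smooth_on_frechet assms open_UNIV)+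
  ultimately show ?thesis by (simp add: set_integral_add)
qed

text \<open>A translation moves the point \<open>x\<close> to the centre of the parallelepiped, where a positive value would
  contribute a ball of positive volume.\<close>

lemma integral_nonneg_eq_0:
  fixes g :: "quat \<Rightarrow> real"
  assumes g: "periodic g" "continuous_on UNIV g" and nn: "\<And>x. 0 \<le> g x"
    and 0: "(LINT x:domain|lborel. g x) = 0"
  shows "g x = 0"
proof (rule ccontr)
  assume "g x \<noteq> 0"
  then have pos: "0 < g x" using nn[of x] by simp
  define c where "c = comb (\<chi> i. 1/2)"
  define h where "h = (\<lambda>y. g (y + (x - c)))"
  have hc: "continuous_on UNIV h" unfolding h_def
    by (rule continuous_on_compose2[OF g(2)]) (auto intro!: continuous_intros)
  have h0: "(LINT y:domain|lborel. h y) = 0" unfolding h_def using integral_translate[OF g] 0 by simp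
  define U where "U = {y. g x / 2 < h y} \<inter> (\<Inter>i\<in>UNIV. {y. 0 < coord y $ i} \<inter> {y. coord y $ i < 1})"
  have "open U" unfolding U_def
    by (intro open_Int open_INT ballI open_Collect_less continuous_on_const continuous_coord hc) auto
  moreover have "c \<in> U" using pos by (simp add: U_def h_def c_def)
  moreover have UD: "U \<subseteq> domain" by (auto simp: U_def domain_eq less_imp_le)
  ultimately obtain e where e: "0 < e" "ball c e \<subseteq> U" using open_contains_ball by blast
  have "(LINT y:ball c e|lborel. g x / 2) \<le> (LINT y:ball c e|lborel. h y)"
    using e(2) by (intro set_integral_mono bounded_set_integrable hc continuous_on_const) (auto simp: U_def)
  also have "\<dots> \<le> (LINT y:domain|lborel. h y)"
    unfolding set_lebesgue_integral_def
  proof (rule integral_mono)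
    show "integrable lborel (\<lambda>y. indicator (ball c e) y *\<^sub>R h y)"
      using bounded_set_integrable[OF _ bounded_ball hc] by (simp add: set_integrable_def)
    show "integrable lborel (\<lambda>y. indicator domain y *\<^sub>R h y)"
      using domain_integrable[OF hc] by (simp add: set_integrable_def)
    show "indicator (ball c e) y *\<^sub>R h y \<le> indicator domain y *\<^sub>R h y" for y
      using e(2) UD nn by (auto simp: indicator_def h_def)
  qed
  finally have "g x / 2 * measure lborel (ball c e) \<le> 0"
    using h0 by (simp add: set_lebesgue_integral_def mult.commute)
  moreover have "0 < measure lborel (ball c e)"
    using content_ball_pos[OF e(1), of c] by simp
  ultimately show False using pos by (simp add: mult_le_0_iff)
qed

lemma integral_uniform_limit:
  fixes g :: "nat \<Rightarrow> quat \<Rightarrow> real"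
  assumes lim: "uniform_limit UNIV g h sequentially"
    and c: "\<And>n. continuous_on UNIV (g n)" "continuous_on UNIV h"
  shows "(\<lambda>n. LINT x:domain|lborel. g n x) \<longlonglongrightarrow> (LINT x:domain|lborel. h x)"
proof (rule tendstoI)
  fix e :: real assume e: "0 < e"
  define M where "M = measure lborel domain + 1"
  have M: "0 < M" by (simp add: M_def add_nonneg_pos)
  have const: "(LINT x:domain|lborel. k) = measure lborel domain * k" for k :: real
    by (simp add: set_lebesgue_integral_def)
  have "\<forall>\<^sub>F n in sequentially. \<forall>x\<in>UNIV. dist (g n x) (h x) < e / M"
    using lim e M by (intro uniform_limitD) auto
  then show "\<forall>\<^sub>F n in sequentially. dist (LINT x:domain|lborel. g n x) (LINT x:domain|lborel. h x) < e"
  proof eventually_elim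
    case (elim n)
    have "dist (LINT x:domain|lborel. g n x) (LINT x:domain|lborel. h x) =
        norm (LINT x:domain|lborel. g n x - h x)"
      by (simp add: dist_norm set_integral_diff domain_integrable c)
    also have "\<dots> \<le> (LINT x:domain|lborel. norm (g n x - h x))"
      by (intro set_integral_norm_bound domain_integrable continuous_intros c)
    also have "\<dots> \<le> (LINT x:domain|lborel. e / M)"
      using elim by (intro set_integral_mono domain_integrable continuous_intros c) (auto simp: dist_norm less_imp_le)
    also have "\<dots> < e"
      using e M unfolding const by (simp add: M_def field_simps)
    finally show ?case .
  qed
qed

section \<open>Parallel tensors on the diffeomorphism group\<close>

text \<open>In the charts \<open>shift f\<close> the metric and the complex structures do not depend on \<open>f\<close>.  All their
  derivatives vanish, so smoothness, integrability and closedness reduce to continuity.\<close>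

lemma iter_deriv_const: "vs \<noteq> [] \<Longrightarrow> iter_deriv vs (\<lambda>x. c) = (\<lambda>x. 0)"
proof (induction vs)
  case (Cons v vs)
  then show ?case by (cases vs) simp_all
qed simp

lemma Cinf_lim_const:
  assumes "(c \<longlongrightarrow> c0) F"
  shows "Cinf_lim \<Lambda> (\<lambda>n p. c n) (\<lambda>p. c0) F"
proof -
  have "uniform_limit UNIV (\<lambda>n. iter_deriv vs (\<lambda>x::quat. c n)) (iter_deriv vs (\<lambda>x. c0)) F" for vs
  proof (cases "vs = []")
    case True
    then show ?thesis
      using assms by (auto intro!: uniform_limitI dest: tendstoD)
  qed (simp add: iter_deriv_const uniform_limit_const)
  then show ?thesis by (simp add: Cinf_lim_def smooth_fun_def)
qed

lemma has_dir_deriv_const: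
  assumes "f \<in> Diff0 \<Lambda>" "u \<in> fields \<Lambda>"
  shows "has_dir_deriv \<Lambda> (\<lambda>f. C) f u (\<lambda>p. 0)"
  using shift_in_Diff0[OF assms] Cinf_lim_const[OF tendsto_const[of 0]]
  by (simp add: has_dir_deriv_def)

lemma parallel_tensor_k_smooth:
  fixes \<Phi> :: "'b::real_normed_vector tensor"
  assumes "\<And>f f'. \<Phi> f = \<Phi> f'" "tensor_continuous \<Lambda> n \<Phi>"
  shows "k_smooth_tensor k \<Lambda> n \<Phi>"
  using assms
proof (induction k arbitrary: n \<Phi>)
  case (Suc k)
  have "k_smooth_tensor k \<Lambda> (Suc n) (\<lambda>f us p. 0 :: 'b)"
    using Cinf_lim_const[OF tendsto_const[of "0 :: 'b" sequentially]]
    by (intro Suc.IH) (simp_all add: tensor_continuous_def)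
  moreover have "has_dir_deriv \<Lambda> (\<lambda>f. \<Phi> f us) f u (\<lambda>p. 0)" if "f \<in> Diff0 \<Lambda>" "u \<in> fields \<Lambda>" for f u us
  proof -
    have "(\<lambda>f. \<Phi> f us) = (\<lambda>f'. \<Phi> f us)" using Suc.prems(1) by metis
    then show ?thesis using has_dir_deriv_const[OF that] by metis
  qed
  ultimately show ?case
    using Suc.prems(2) by (simp only: k_smooth_tensor.simps) (intro conjI exI[of _ "\<lambda>f us p. 0"], auto)
qed simp

lemma parallel_tensor_smooth:
  "(\<And>f f'. \<Phi> f = \<Phi> f') \<Longrightarrow> tensor_continuous \<Lambda> n \<Phi> \<Longrightarrow> smooth_tensor \<Lambda> n \<Phi>"
  by (simp add: smooth_tensor_def parallel_tensor_k_smooth)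

lemma fields_smooth: "u \<in> fields \<Lambda> \<Longrightarrow> smooth (\<lambda>x. u (\<pi> x))"
  by (simp add: fields_def smooth_fun_def)

lemma L2_metric_domain: "L2_metric \<Lambda> f u v = (LINT x:domain|lborel. u (\<pi> x) \<bullet> v (\<pi> x))"
  by (simp add: L2_metric_def torus_integral_domain)

lemma continuous_field_inner:
  "u \<in> fields \<Lambda> \<Longrightarrow> v \<in> fields \<Lambda> \<Longrightarrow> continuous_on UNIV (\<lambda>x. u (\<pi> x) \<bullet> v (\<pi> x))"
  by (intro smooth_on_continuous_on smooth_on_inner fields_smooth open_UNIV)

lemma field_bounded:
  assumes "u \<in> fields \<Lambda>" shows "bounded (range (\<lambda>x. u (\<pi> x)))"
proof -
  obtain C where "\<And>x. norm (u (\<pi> x)) \<le> C"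
    using periodic_bounded[OF periodic_proj smooth_on_continuous_on[OF fields_smooth[OF assms]]] by blast
  then show ?thesis by (auto simp: bounded_iff)
qed

lemma Cinf_lim_uniform:
  assumes "Cinf_lim \<Lambda> w u F"
  shows "uniform_limit UNIV (\<lambda>n x. w n (\<pi> x)) (\<lambda>x. u (\<pi> x)) F"
proof -
  have "\<forall>vs. uniform_limit UNIV (\<lambda>n. iter_deriv vs (\<lambda>x. w n (\<pi> x))) (iter_deriv vs (\<lambda>x. u (\<pi> x))) F"
    using assms unfolding Cinf_lim_def by blast
  from spec[OF this, of "[]"] show ?thesis by simp
qed

lemma tensor_continuous_L2: "tensor_continuous \<Lambda> 2 (\<lambda>f us p. L2_metric \<Lambda> f (us ! 0) (us ! 1))"
  unfolding tensor_continuous_def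
proof (intro ballI allI impI)
  fix f us and w :: "nat \<Rightarrow> field" and uss :: "nat \<Rightarrow> field list"
  assume us: "length us = 2" "set us \<subseteq> fields \<Lambda>"
    and uss: "\<forall>m. w m \<in> fields \<Lambda> \<and> shift f 1 (w m) \<in> Diff0 \<Lambda> \<and> length (uss m) = 2 \<and> set (uss m) \<subseteq> fields \<Lambda>"
    and lim: "\<forall>i<2. Cinf_lim \<Lambda> (\<lambda>m. uss m ! i) (us ! i) sequentially"
  have u: "us ! i \<in> fields \<Lambda>" if "i < 2" for i using us that by (metis nth_mem subsetD)
  have um: "uss m ! i \<in> fields \<Lambda>" if "i < 2" for i m using uss that by (metis nth_mem subsetD)
  have "uniform_limit UNIV (\<lambda>m x. (uss m ! 0) (\<pi> x) \<bullet> (uss m ! 1) (\<pi> x))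
      (\<lambda>x. (us ! 0) (\<pi> x) \<bullet> (us ! 1) (\<pi> x)) sequentially"
    using lim by (intro bounded_bilinear.bounded_uniform_limit[OF bounded_bilinear_inner]
        Cinf_lim_uniform field_bounded u) simp_all
  from integral_uniform_limit[OF this]
  have "(\<lambda>m. L2_metric \<Lambda> f (uss m ! 0) (uss m ! 1)) \<longlonglongrightarrow> L2_metric \<Lambda> f (us ! 0) (us ! 1)"
    using u um by (simp add: L2_metric_domain continuous_field_inner)
  then show "Cinf_lim \<Lambda> (\<lambda>m p. L2_metric \<Lambda> (shift f 1 (w m)) (uss m ! 0) (uss m ! 1))
      (\<lambda>p. L2_metric \<Lambda> f (us ! 0) (us ! 1)) sequentially"
    by (intro Cinf_lim_const) (simp add: L2_metric_def)
qed

lemma iter_deriv_bounded_linear: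
  assumes "bounded_linear L" "smooth g"
  shows "iter_deriv vs (\<lambda>x. L (g x)) = (\<lambda>x. L (iter_deriv vs g x))"
proof (induction vs)
  case (Cons v vs)
  show ?case
    using frechet_derivative_bounded_linear[OF assms(1) smooth_on_iter_deriv[OF assms(2)]]
    by (simp add: Cons.IH)
qed simp

lemma Cinf_lim_bounded_linear:
  fixes L :: "'b::real_normed_vector \<Rightarrow> 'c::real_normed_vector"
  assumes L: "bounded_linear L" and lim: "Cinf_lim \<Lambda> w u F"
  shows "Cinf_lim \<Lambda> (\<lambda>n p. L (w n p)) (\<lambda>p. L (u p)) F"
proof -
  have w: "\<forall>\<^sub>F n in F. smooth (\<lambda>x. w n (\<pi> x))" and u: "smooth (\<lambda>x. u (\<pi> x))"
    and lim: "\<And>vs. uniform_limit UNIV (\<lambda>n. iter_deriv vs (\<lambda>x. w n (\<pi> x))) (iter_deriv vs (\<lambda>x. u (\<pi> x))) F"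
    using lim by (simp_all add: Cinf_lim_def smooth_fun_def)
  have "uniform_limit UNIV (\<lambda>n. iter_deriv vs (\<lambda>x. L (w n (\<pi> x)))) (iter_deriv vs (\<lambda>x. L (u (\<pi> x)))) F" for vs
  proof (subst uniform_limit_cong)
    show "\<forall>\<^sub>F n in F. \<forall>x\<in>UNIV. iter_deriv vs (\<lambda>x. L (w n (\<pi> x))) x = L (iter_deriv vs (\<lambda>x. w n (\<pi> x)) x)"
      using w by eventually_elim (simp add: iter_deriv_bounded_linear[OF L])
    show "uniform_limit UNIV (\<lambda>n x. L (iter_deriv vs (\<lambda>x. w n (\<pi> x)) x)) (\<lambda>x. L (iter_deriv vs (\<lambda>x. u (\<pi> x)) x)) F"
      by (rule bounded_linear.uniform_limit[OF L lim])
  qed (simp add: iter_deriv_bounded_linear[OF L u])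
  moreover have "\<forall>\<^sub>F n in F. smooth (\<lambda>x. L (w n (\<pi> x)))"
    using w by eventually_elim (rule smooth_on_bounded_linear[OF open_UNIV L])
  ultimately show ?thesis
    using smooth_on_bounded_linear[OF open_UNIV L u] by (simp add: Cinf_lim_def smooth_fun_def)
qed

end

section \<open>Quaternions and the hyperkaehler structure\<close>

lemma qmult_nth:
  "(p \<cdot>\<^sub>H q) $ 1 = p$1 * q$1 - p$2 * q$2 - p$3 * q$3 - p$4 * q$4"
  "(p \<cdot>\<^sub>H q) $ 2 = p$1 * q$2 + p$2 * q$1 + p$3 * q$4 - p$4 * q$3"
  "(p \<cdot>\<^sub>H q) $ 3 = p$1 * q$3 - p$2 * q$4 + p$3 * q$1 + p$4 * q$2"
  "(p \<cdot>\<^sub>H q) $ 4 = p$1 * q$4 + p$2 * q$3 - p$3 * q$2 + p$4 * q$1"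
  by (simp_all add: qmult_def vector_4)

lemma quat_eq_iff: "(p :: quat) = q \<longleftrightarrow> p$1 = q$1 \<and> p$2 = q$2 \<and> p$3 = q$3 \<and> p$4 = q$4"
  by (simp add: vec_eq_iff forall_4)

lemma quat_inner: "(p :: quat) \<bullet> q = p$1 * q$1 + p$2 * q$2 + p$3 * q$3 + p$4 * q$4"
  by (simp add: inner_vec_def sum_4)

lemma quat_units_nth:
  "qi $ 1 = 0" "qi $ 2 = 1" "qi $ 3 = 0" "qi $ 4 = 0"
  "qj $ 1 = 0" "qj $ 2 = 0" "qj $ 3 = 1" "qj $ 4 = 0"
  "qk $ 1 = 0" "qk $ 2 = 0" "qk $ 3 = 0" "qk $ 4 = 1"
  by (simp_all add: qi_def qj_def qk_def axis_def)

lemma bounded_linear_qmult_left: "bounded_linear (\<lambda>v. q \<cdot>\<^sub>H v)"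
  by (rule linear_conv_bounded_linear[THEN iffD1], rule linearI)
    (simp_all add: quat_eq_iff qmult_nth algebra_simps)

lemma bounded_linear_qmult_right: "bounded_linear (\<lambda>v. v \<cdot>\<^sub>H q)"
  by (rule linear_conv_bounded_linear[THEN iffD1], rule linearI)
    (simp_all add: quat_eq_iff qmult_nth algebra_simps)

lemma quat_unit_square:
  assumes "q \<in> {qi, qj, qk}"
  shows "q \<cdot>\<^sub>H (q \<cdot>\<^sub>H v) = - v" "(v \<cdot>\<^sub>H q) \<cdot>\<^sub>H q = - v"
  using assms by (auto simp: quat_eq_iff qmult_nth quat_units_nth)

lemma quat_unit_isometry:
  assumes "q \<in> {qi, qj, qk}"
  shows "(q \<cdot>\<^sub>H v) \<bullet> (q \<cdot>\<^sub>H w) = v \<bullet> w" "(v \<cdot>\<^sub>H q) \<bullet> (w \<cdot>\<^sub>H q) = v \<bullet> w"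
  using assms by (auto simp: quat_inner qmult_nth quat_units_nth)

lemma quat_ijk: "qi \<cdot>\<^sub>H (qj \<cdot>\<^sub>H (qk \<cdot>\<^sub>H v)) = - v"
  by (simp add: quat_eq_iff qmult_nth quat_units_nth)

context torus_lattice
begin

text \<open>An operator that does not depend on the point \<open>f\<close> of the group is parallel, so each term of its
  Nijenhuis tensor vanishes.  Left and right multiplications by \<open>i\<close>, \<open>j\<close>, \<open>k\<close> are of this form.\<close>

lemma constant_complex_structure:
  assumes L: "bounded_linear L" and LL: "\<And>v. L (L v) = - v"
  shows "complex_structure \<Lambda> (\<lambda>f u p. L (u p))"
proof -
  interpret L: bounded_linear L by fact
  have fields: "(\<lambda>p. L (u p)) \<in> fields \<Lambda>" if "u \<in> fields \<Lambda>" for u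
    using smooth_on_bounded_linear[OF open_UNIV L fields_smooth[OF that]] by (simp add: fields_def smooth_fun_def)
  have "tensor_continuous \<Lambda> 1 (\<lambda>f us p. L ((us ! 0) p))"
    unfolding tensor_continuous_def
  proof (intro ballI allI impI)
    fix f us and w :: "nat \<Rightarrow> field" and uss :: "nat \<Rightarrow> field list"
    assume "\<forall>i<1. Cinf_lim \<Lambda> (\<lambda>m. uss m ! i) (us ! i) sequentially"
    then have "Cinf_lim \<Lambda> (\<lambda>m. uss m ! 0) (us ! 0) sequentially" by simp
    from Cinf_lim_bounded_linear[OF L this]
    show "Cinf_lim \<Lambda> (\<lambda>m p. L ((uss m ! 0) p)) (\<lambda>p. L ((us ! 0) p)) sequentially" .
  qed
  then have "smooth_tensor \<Lambda> 1 (\<lambda>f us p. L ((us ! 0) p))"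
    by (rule parallel_tensor_smooth[rotated]) simp
  then have "almost_complex_structure \<Lambda> (\<lambda>f u p. L (u p))"
    by (simp add: almost_complex_structure_def fields LL L.add L.scaleR)
  moreover have "integrable_structure \<Lambda> (\<lambda>f u p. L (u p))"
    unfolding integrable_structure_def
  proof (intro ballI)
    fix f u v assume f: "f \<in> Diff0 \<Lambda>" and u: "u \<in> fields \<Lambda>" and v: "v \<in> fields \<Lambda>"
    note d = has_dir_deriv_const[OF f]
    show "\<exists>a b c d.
        has_dir_deriv \<Lambda> (\<lambda>f p. L (v p)) f (\<lambda>p. L (u p)) a \<and>
        has_dir_deriv \<Lambda> (\<lambda>f p. L (u p)) f (\<lambda>p. L (v p)) b \<and>
        has_dir_deriv \<Lambda> (\<lambda>f p. L (u p)) f v c \<and>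
        has_dir_deriv \<Lambda> (\<lambda>f p. L (v p)) f u d \<and>
        (\<forall>p\<in>torus \<Lambda>. (a p - b p) + L (c p) - L (d p) = 0)"
      by (intro exI[of _ "\<lambda>p. 0"] conjI d fields u v) (simp add: L.zero)
  qed
  ultimately show ?thesis by (simp add: complex_structure_def)
qed

lemma left_op_complex_structure: "q \<in> {qi, qj, qk} \<Longrightarrow> complex_structure \<Lambda> (left_op q)"
  using constant_complex_structure[OF bounded_linear_qmult_left quat_unit_square(1)]
  unfolding left_op_def .

lemma right_op_complex_structure: "q \<in> {qi, qj, qk} \<Longrightarrow> complex_structure \<Lambda> (right_op q)"
  using constant_complex_structure[OF bounded_linear_qmult_right quat_unit_square(2)]
  unfolding right_op_def .

lemma left_op_closed: "closed_form \<Lambda> (kaehler_form (L2_metric \<Lambda>) (left_op q))"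
  unfolding closed_form_def
proof (intro ballI)
  fix f u v w assume f: "f \<in> Diff0 \<Lambda>" and u: "u \<in> fields \<Lambda>" and v: "v \<in> fields \<Lambda>" and w: "w \<in> fields \<Lambda>"
  have "has_dir_deriv \<Lambda> (\<lambda>f p. kaehler_form (L2_metric \<Lambda>) (left_op q) f a b) f c (\<lambda>p. 0)"
    if "c \<in> fields \<Lambda>" for a b c
    using has_dir_deriv_const[OF f that] by (simp add: kaehler_form_def L2_metric_def left_op_def)
  then show "\<exists>a b c :: real.
      has_dir_deriv \<Lambda> (\<lambda>f p. kaehler_form (L2_metric \<Lambda>) (left_op q) f v w) f u (\<lambda>p. a) \<and>
      has_dir_deriv \<Lambda> (\<lambda>f p. kaehler_form (L2_metric \<Lambda>) (left_op q) f w u) f v (\<lambda>p. b) \<and>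
      has_dir_deriv \<Lambda> (\<lambda>f p. kaehler_form (L2_metric \<Lambda>) (left_op q) f u v) f w (\<lambda>p. c) \<and>
      a + b + c = 0"
    using u v w by (intro exI[of _ "0 :: real"]) simp
qed

lemma L2_metric_riemannian: "riemannian_metric \<Lambda> (L2_metric \<Lambda>)"
  unfolding riemannian_metric_def
proof (intro conjI ballI allI)
  show "smooth_tensor \<Lambda> 2 (\<lambda>f us p. L2_metric \<Lambda> f (us ! 0) (us ! 1))"
    by (rule parallel_tensor_smooth[OF _ tensor_continuous_L2]) (simp add: L2_metric_def)
next
  fix f u v w and a b :: real
  assume u: "u \<in> fields \<Lambda>" and v: "v \<in> fields \<Lambda>" and w: "w \<in> fields \<Lambda>"
  show "L2_metric \<Lambda> f u v = L2_metric \<Lambda> f v u" by (simp add: L2_metric_def inner_commute)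
  show "L2_metric \<Lambda> f (\<lambda>p. a *\<^sub>R u p + b *\<^sub>R v p) w = a * L2_metric \<Lambda> f u w + b * L2_metric \<Lambda> f v w"
  proof -
    have "set_integrable lborel domain (\<lambda>x. a * (u (\<pi> x) \<bullet> w (\<pi> x)))"
      "set_integrable lborel domain (\<lambda>x. b * (v (\<pi> x) \<bullet> w (\<pi> x)))"
      by (rule domain_integrable[OF continuous_on_mult_left[OF continuous_field_inner[OF u w]]],
          rule domain_integrable[OF continuous_on_mult_left[OF continuous_field_inner[OF v w]]])
    from set_integral_add(2)[OF this] show ?thesis
      unfolding L2_metric_domain inner_add_left inner_scaleR_left set_integral_mult_right .
  qed
  show "L2_metric \<Lambda> f u u \<ge> 0"
    unfolding L2_metric_domain set_lebesgue_integral_def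
    by (rule Bochner_Integration.integral_nonneg) (simp add: indicator_def)
  show "L2_metric \<Lambda> f u u = 0 \<longrightarrow> (\<forall>p\<in>torus \<Lambda>. u p = 0)"
  proof (intro impI ballI)
    fix p assume 0: "L2_metric \<Lambda> f u u = 0" and "p \<in> torus \<Lambda>"
    then obtain x where p: "p = \<pi> x" by (metis torusE)
    have "(LINT x:domain|lborel. u (\<pi> x) \<bullet> u (\<pi> x)) = 0"
      using 0 by (simp only: L2_metric_domain)
    from integral_nonneg_eq_0[OF periodic_proj[of "\<lambda>p. u p \<bullet> u p"] continuous_field_inner[OF u u]
        inner_ge_zero this, of x]
    show "u p = 0" by (simp add: p)
  qed
qed

lemma L2_metric_compatible:
  "q \<in> {qi, qj, qk} \<Longrightarrow> compatible \<Lambda> (L2_metric \<Lambda>) (left_op q)"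
  "q \<in> {qi, qj, qk} \<Longrightarrow> compatible \<Lambda> (L2_metric \<Lambda>) (right_op q)"
  by (simp_all add: compatible_def L2_metric_def left_op_def right_op_def quat_unit_isometry del: insert_iff)

lemma hyperkaehler_L2_metric:
  "hyperkaehler \<Lambda> (L2_metric \<Lambda>) (left_op qi) (left_op qj) (left_op qk)"
  unfolding hyperkaehler_def
proof (intro conjI ballI)
  show "riemannian_metric \<Lambda> (L2_metric \<Lambda>)" by (rule L2_metric_riemannian)
next
  fix A :: endo assume "A \<in> {left_op qi, left_op qj, left_op qk}"
  then obtain q where "A = left_op q" "q \<in> {qi, qj, qk}" by blast
  then show "complex_structure \<Lambda> A" "compatible \<Lambda> (L2_metric \<Lambda>) A"
    "closed_form \<Lambda> (kaehler_form (L2_metric \<Lambda>) A)"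
    using left_op_complex_structure L2_metric_compatible(1) left_op_closed by blast+
next
  show "left_op qi f (left_op qj f (left_op qk f u)) p = - u p" for f u p
    by (simp add: left_op_def quat_ijk)
qed

end

section \<open>The symplectic form and the volume form\<close>

lemma det_4:
  "det (A :: real^4^4) =
    A$1$1 * A$2$2 * A$3$3 * A$4$4 - A$1$1 * A$2$2 * A$3$4 * A$4$3
  - A$1$1 * A$2$3 * A$3$2 * A$4$4 + A$1$1 * A$2$3 * A$3$4 * A$4$2
  + A$1$1 * A$2$4 * A$3$2 * A$4$3 - A$1$1 * A$2$4 * A$3$3 * A$4$2
  - A$1$2 * A$2$1 * A$3$3 * A$4$4 + A$1$2 * A$2$1 * A$3$4 * A$4$3
  + A$1$2 * A$2$3 * A$3$1 * A$4$4 - A$1$2 * A$2$3 * A$3$4 * A$4$1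
  - A$1$2 * A$2$4 * A$3$1 * A$4$3 + A$1$2 * A$2$4 * A$3$3 * A$4$1
  + A$1$3 * A$2$1 * A$3$2 * A$4$4 - A$1$3 * A$2$1 * A$3$4 * A$4$2
  - A$1$3 * A$2$2 * A$3$1 * A$4$4 + A$1$3 * A$2$2 * A$3$4 * A$4$1
  + A$1$3 * A$2$4 * A$3$1 * A$4$2 - A$1$3 * A$2$4 * A$3$2 * A$4$1
  - A$1$4 * A$2$1 * A$3$2 * A$4$3 + A$1$4 * A$2$1 * A$3$3 * A$4$2
  + A$1$4 * A$2$2 * A$3$1 * A$4$3 - A$1$4 * A$2$2 * A$3$3 * A$4$1
  - A$1$4 * A$2$3 * A$3$1 * A$4$2 + A$1$4 * A$2$3 * A$3$2 * A$4$1"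
proof -
  have f1234: "finite {2::4, 3, 4}" "1 \<notin> {2::4, 3, 4}"
    by auto
  have f234: "finite {3::4, 4}" "2 \<notin> {3::4, 4}"
    by auto
  have f34: "finite {4::4}" "3 \<notin> {4::4}"
    by auto
  show ?thesis
    unfolding det_def UNIV_4
    unfolding sum_over_permutations_insert[OF f1234]
    unfolding sum_over_permutations_insert[OF f234]
    unfolding sum_over_permutations_insert[OF f34]
    unfolding permutes_sing
    by (simp add: sign_swap_id permutation_swap_id permutation_compose sign_compose sign_id swap_id_eq)
qed

lemma vol_det: "vol p a b c d = det (vector [a, b, c, d] :: real^4^4)"
  unfolding vol_def wedge_def omega_coords det_4 vector_4 by (simp add: algebra_simps)

abbreviation e :: "4 \<Rightarrow> quat" where
  "e i \<equiv> axis i 1"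

lemma vol_standard_basis: "vol p (e 1) (e 2) (e 3) (e 4) = 1"
  unfolding vol_def wedge_def omega_coords by (simp add: axis_def)

lemma div_vol_eq:
  assumes "\<And>a b c d. \<eta> p a b c d = r * vol p a b c d"
  shows "div_vol \<eta> p = r"
  unfolding div_vol_def
proof (rule the_equality)
  fix s assume "\<forall>a b c d. \<eta> p a b c d = s * vol p a b c d"
  then have "s * vol p (e 1) (e 2) (e 3) (e 4) = r * vol p (e 1) (e 2) (e 3) (e 4)"
    using assms by metis
  then show "s = r" by (simp add: vol_standard_basis)
qed (use assms in blast)

lemma quat_basis: "u = u$1 *\<^sub>R e 1 + u$2 *\<^sub>R e 2 + u$3 *\<^sub>R e 3 + u$4 *\<^sub>R e 4"
  by (simp add: quat_eq_iff axis_def)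

text \<open>Wedging with \<open>\<omega>\<close> contracts a \<open>2\<close>-form with the Poisson bivector of \<open>\<omega>\<close>, up to sign.\<close>

lemma wedge_omega:
  assumes bl: "bilinear (\<sigma> p)" and alt: "\<And>v w. \<sigma> p v w = - \<sigma> p w v"
  shows "wedge \<sigma> omega p a b c d = - (\<sigma> p (e 1) (e 3) + \<sigma> p (e 2) (e 4)) * vol p a b c d"
proof -
  have expand: "\<sigma> p v w =
      \<sigma> p (e 1) (e 2) * (v$1 * w$2 - v$2 * w$1) + \<sigma> p (e 1) (e 3) * (v$1 * w$3 - v$3 * w$1)
    + \<sigma> p (e 1) (e 4) * (v$1 * w$4 - v$4 * w$1) + \<sigma> p (e 2) (e 3) * (v$2 * w$3 - v$3 * w$2)
    + \<sigma> p (e 2) (e 4) * (v$2 * w$4 - v$4 * w$2) + \<sigma> p (e 3) (e 4) * (v$3 * w$4 - v$4 * w$3)" for v w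
  proof -
    have diag: "\<sigma> p u u = 0" for u using alt[of u u] by simp
    have "\<sigma> p v w = \<sigma> p (v$1 *\<^sub>R e 1 + v$2 *\<^sub>R e 2 + v$3 *\<^sub>R e 3 + v$4 *\<^sub>R e 4)
        (w$1 *\<^sub>R e 1 + w$2 *\<^sub>R e 2 + w$3 *\<^sub>R e 3 + w$4 *\<^sub>R e 4)"
      using quat_basis[of v] quat_basis[of w] by metis
    also have "\<dots> = (\<Sum>i\<in>{1, 2, 3, 4}. \<Sum>j\<in>{1, 2, 3, 4}. v$i * w$j * \<sigma> p (e i) (e j))"
      by (simp add: bilinear_ladd[OF bl] bilinear_radd[OF bl] bilinear_lmul[OF bl] bilinear_rmul[OF bl]
          distrib_left mult.assoc add.assoc)
    also have "\<dots> = \<sigma> p (e 1) (e 2) * (v$1 * w$2 - v$2 * w$1) + \<sigma> p (e 1) (e 3) * (v$1 * w$3 - v$3 * w$1)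
    + \<sigma> p (e 1) (e 4) * (v$1 * w$4 - v$4 * w$1) + \<sigma> p (e 2) (e 3) * (v$2 * w$3 - v$3 * w$2)
    + \<sigma> p (e 2) (e 4) * (v$2 * w$4 - v$4 * w$2) + \<sigma> p (e 3) (e 4) * (v$3 * w$4 - v$4 * w$3)"
      by (simp add: diag alt[of "e 2" "e 1"] alt[of "e 3" "e 1"] alt[of "e 4" "e 1"] alt[of "e 3" "e 2"]
          alt[of "e 4" "e 2"] alt[of "e 4" "e 3"] algebra_simps)
    finally show ?thesis .
  qed
  show ?thesis
    unfolding vol_def wedge_def omega_coords
    unfolding expand[of a b] expand[of a c] expand[of a d] expand[of b c] expand[of b d] expand[of c d]
    by algebra
qed

lemma omega_antisym: "omega p v w = - omega p w v"
  by (simp add: omega_coords)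

lemma omega_left_coords:
  "omega_left qi p v w = v$1 * w$2 - v$2 * w$1 + (v$3 * w$4 - v$4 * w$3)"
  "omega_left qj p v w = v$1 * w$3 - v$3 * w$1 - (v$2 * w$4 - v$4 * w$2)"
  "omega_left qk p v w = v$1 * w$4 - v$4 * w$1 + (v$2 * w$3 - v$3 * w$2)"
  by (simp_all add: omega_left_def quat_inner qmult_nth quat_units_nth)

lemma omega_left_antisym: "q \<in> {qi, qj, qk} \<Longrightarrow> omega_left q p v w = - omega_left q p w v"
  by (auto simp: omega_left_coords)

lemma omega_left_bounded_bilinear: "bounded_bilinear (omega_left q p)"
  using bounded_bilinear.comp1[OF bounded_bilinear_inner bounded_linear_qmult_left]
  unfolding omega_left_def .

lemma omega_bounded_bilinear: "bounded_bilinear (omega p)"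
  using bounded_bilinear.comp1[OF bounded_bilinear_inner bounded_linear_qmult_right]
  unfolding omega_def .

section \<open>Hamiltonian diffeomorphisms preserve the symplectic form\<close>

context torus_lattice
begin

lemma dfun_proj:
  assumes "smooth_fun \<Lambda> h"
  shows "dfun \<Lambda> h (\<pi> x) w = Df (\<lambda>x. h (\<pi> x)) x w"
  unfolding dfun_def
  using assms by (intro periodic_SOME periodic_frechet periodic_proj) (simp add: smooth_fun_def)

definition gradient :: "(quat \<Rightarrow> real) \<Rightarrow> quat \<Rightarrow> quat" where
  "gradient k x = (\<chi> i. Df k x (e i))"

lemma gradient_inner:
  assumes "smooth k"
  shows "gradient k x \<bullet> w = Df k x w"
proof -
  interpret linear "Df k x"
    using assms by (rule smooth_on_linear_frechet) simp
  have "Df k x w =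
      Df k x (w$1 *\<^sub>R e 1 + w$2 *\<^sub>R e 2 + w$3 *\<^sub>R e 3 + w$4 *\<^sub>R e 4)"
    using quat_basis[of w] by metis
  then show ?thesis by (simp add: add scale gradient_def quat_inner mult.commute)
qed

lemma ham_field_gradient:
  assumes "smooth_fun \<Lambda> h"
  shows "ham_field \<Lambda> h (\<pi> x) = gradient (\<lambda>x. h (\<pi> x)) x \<cdot>\<^sub>H qj"
proof -
  let ?k = "\<lambda>x. h (\<pi> x)"
  have k: "smooth ?k" using assms by (simp add: smooth_fun_def)
  have iff: "(\<forall>w. omega p v w = - dfun \<Lambda> h (\<pi> x) w) \<longleftrightarrow> v \<cdot>\<^sub>H qj = - gradient ?k x" for v p
  proof -
    have "(\<forall>w. omega p v w = - dfun \<Lambda> h (\<pi> x) w) \<longleftrightarrow> (\<forall>w. (v \<cdot>\<^sub>H qj) \<bullet> w = (- gradient ?k x) \<bullet> w)"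
      by (simp add: omega_def dfun_proj[OF assms] gradient_inner[OF k])
    then show ?thesis using vector_eq_rdot by metis
  qed
  have j: "v \<cdot>\<^sub>H qj = - gradient ?k x \<longleftrightarrow> v = gradient ?k x \<cdot>\<^sub>H qj" for v
    by (auto simp: quat_eq_iff qmult_nth quat_units_nth)
  show ?thesis
    unfolding ham_field_def iff j by simp
qed

lemma ham_field_smooth:
  assumes "smooth_fun \<Lambda> h"
  shows "smooth (\<lambda>x. ham_field \<Lambda> h (\<pi> x))"
  unfolding ham_field_gradient[OF assms] gradient_def
  using assms
  by (intro smooth_on_bounded_linear[OF open_UNIV bounded_linear_qmult_right] smooth_on_vec_lambda
      smooth_on_frechet) (simp_all add: smooth_fun_def)

lemma omega_ham_field:
  assumes "smooth_fun \<Lambda> h"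
  shows "omega p (ham_field \<Lambda> h (\<pi> x)) w = - Df (\<lambda>x. h (\<pi> x)) x w"
proof -
  have "smooth (\<lambda>x. h (\<pi> x))" using assms by (simp add: smooth_fun_def)
  from gradient_inner[OF this] show ?thesis
    by (simp add: omega_def ham_field_gradient[OF assms] quat_unit_square)
qed

text \<open>The bilinear form \<open>\<omega>(DX a, b)\<close> is minus the Hessian of the Hamiltonian, hence symmetric.\<close>

lemma ham_field_infinitesimally_symplectic:
  assumes h: "smooth_fun \<Lambda> h"
  defines "X \<equiv> \<lambda>x. ham_field \<Lambda> h (\<pi> x)"
  shows "omega p (Df X x a) b + omega p a (Df X x b) = 0"
proof -
  let ?k = "\<lambda>x. h (\<pi> x)"
  have k: "smooth ?k" using h by (simp add: smooth_fun_def)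
  have X: "smooth X" unfolding X_def by (rule ham_field_smooth[OF h])
  have D: "omega p (Df X x a) b =
      - Df (\<lambda>y. Df ?k y b) x a" for a b
  proof -
    have "omega p (Df X x a) b = Df (\<lambda>y. omega p (X y) b) x a"
      using frechet_derivative_bounded_linear[OF bounded_bilinear.bounded_linear_left[OF omega_bounded_bilinear] X UNIV_I]
      by simp
    also have "(\<lambda>y. omega p (X y) b) = (\<lambda>y. - Df ?k y b)"
      unfolding X_def omega_ham_field[OF h] ..
    also have "Df (\<lambda>y. - Df ?k y b) x a =
        - Df (\<lambda>y. Df ?k y b) x a"
      by (rule frechet_derivative_bounded_linear[OF bounded_linear_minus[OF bounded_linear_ident] smooth_on_frechet[OF k] UNIV_I])
    finally show ?thesis .
  qed
  have "Df (\<lambda>y. Df ?k y a) x b =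
      Df (\<lambda>y. Df ?k y b) x a"
    by (rule second_derivative_symmetric[OF k open_UNIV UNIV_I])
  then show ?thesis
    using D[of a b] D[of b a] omega_antisym[of p a] by simp
qed

definition isotopy_lift ::
  "(real \<Rightarrow> point \<Rightarrow> point) \<Rightarrow> (real \<times> quat) set \<Rightarrow> (real \<times> quat \<Rightarrow> quat) \<Rightarrow> bool" where
  "isotopy_lift \<psi> U F \<longleftrightarrow>
     open U \<and> smooth_on U F \<and> (\<forall>(s, y)\<in>U. \<pi> (F (s, y)) = \<psi> s (\<pi> y))"

text \<open>Any two local lifts of an isotopy differ by a locally constant lattice vector, so the velocity can be
  read off from any one of them.\<close>

lemma velocity_eq:
  assumes F: "isotopy_lift \<psi> U F" "(t, x) \<in> U"
  shows "velocity \<Lambda> \<psi> t (\<pi> x) = Df F (t, x) (1, 0)"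
  unfolding velocity_def
proof (rule the_equality)
  show "\<exists>x' U' F'. \<pi> x' = \<pi> x \<and> (t, x') \<in> U' \<and> open U' \<and> smooth_on U' F' \<and>
      (\<forall>(s, y)\<in>U'. \<pi> (F' (s, y)) = \<psi> s (\<pi> y)) \<and>
      Df F (t, x) (1, 0) = Df F' (t, x') (1, 0)"
    using F unfolding isotopy_lift_def by blast
next
  fix w assume "\<exists>x' U' F'. \<pi> x' = \<pi> x \<and> (t, x') \<in> U' \<and> open U' \<and> smooth_on U' F' \<and>
      (\<forall>(s, y)\<in>U'. \<pi> (F' (s, y)) = \<psi> s (\<pi> y)) \<and>
      w = Df F' (t, x') (1, 0)"
  then obtain x' U' F' where x': "\<pi> x' = \<pi> x" "(t, x') \<in> U'" and F': "isotopy_lift \<psi> U' F'"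
    and w: "w = Df F' (t, x') (1, 0)"
    unfolding isotopy_lift_def by blast
  have l: "x' - x \<in> \<Lambda>" using x'(1) by (metis proj_eq_iff)
  have "Df F' ((t, x) + (0, x' - x)) = Df F (t, x)"
  proof (rule lifts_frechet_unique[of U F _ U' F'])
    fix z assume z: "z \<in> U" "z + (0, x' - x) \<in> U'"
    obtain s y where sy: "z = (s, y)" by (cases z)
    have "\<pi> (F (s, y)) = \<psi> s (\<pi> y)" using F(1) z(1) sy unfolding isotopy_lift_def by blast
    moreover have "\<pi> (F' (s, y + (x' - x))) = \<psi> s (\<pi> (y + (x' - x)))"
      using F' z(2) sy unfolding isotopy_lift_def by auto
    ultimately show "\<pi> (F z) = \<pi> (F' (z + (0, x' - x)))"
      using proj_add_lattice[OF l, of y] sy by simp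
  qed (use F F' x' in \<open>auto simp: isotopy_lift_def\<close>)
  then show "w = Df F (t, x) (1, 0)" by (simp add: w)
qed

lemma isotopy_lift_slice:
  assumes F: "isotopy_lift \<psi> U F" "(s, x) \<in> U"
  shows "local_lift \<Lambda> (\<psi> s) {y. (s, y) \<in> U} (\<lambda>y. F (s, y))"
    "Df (\<lambda>y. F (s, y)) x v = Df F (s, x) (0, v)"
proof -
  have U: "open U" "smooth_on U F" "\<And>s y. (s, y) \<in> U \<Longrightarrow> \<pi> (F (s, y)) = \<psi> s (\<pi> y)"
    using F(1) unfolding isotopy_lift_def by auto
  have "open ((\<lambda>y. (s, y)) -` U)"
    using U(1) by (intro continuous_open_vimage continuous_intros)
  then have o: "open {y. (s, y) \<in> U}" by (simp add: vimage_def)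
  have d: "((\<lambda>y. (s, y)) has_derivative (\<lambda>v. (0, v))) (at y)" for y :: quat
    by (auto intro!: derivative_eq_intros)
  have bl: "bounded_linear (\<lambda>v :: quat. (0 :: real, v))"
    by (rule has_derivative_bounded_linear[OF d[of 0]])
  have "smooth (\<lambda>y :: quat. (s, 0) + (0 :: real, y))"
    by (intro smooth_on_add smooth_on_const smooth_on_linear bl open_UNIV)
  then have "smooth (\<lambda>y :: quat. (s, y))" by simp
  then have sl: "smooth_on {y. (s, y) \<in> U} (\<lambda>y :: quat. (s, y))"
    by (rule smooth_on_subset) simp
  have "smooth_on {y. (s, y) \<in> U} (\<lambda>y. F (s, y))"
    by (rule smooth_on_compose[OF o U(1) _ U(2) sl]) simp
  then show "local_lift \<Lambda> (\<psi> s) {y. (s, y) \<in> U} (\<lambda>y. F (s, y))"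
    using o U(3) by (simp add: local_lift_def)
  show "Df (\<lambda>y. F (s, y)) x v = Df F (s, x) (0, v)"
    using frechet_derivative_eq[OF has_derivative_compose[OF d smooth_on_has_derivative[OF U(2) F(2)]]] by simp
qed

lemma dmap_isotopy:
  assumes "isotopy_lift \<psi> U F" "(s, x) \<in> U"
  shows "dmap \<Lambda> (\<psi> s) (\<pi> x) v = Df F (s, x) (0, v)"
  using dmap_eq[OF isotopy_lift_slice(1)[OF assms]] isotopy_lift_slice(2)[OF assms] assms(2) by simp

text \<open>Along the flow, \<open>\<psi>\<^sub>s\<^sup>* \<omega>\<close> is constant in \<open>s\<close>: the velocity is a Hamiltonian field, and time and
  space derivatives of the lift commute.\<close>

lemma omega_constant_along_flow:
  assumes iso: "smooth_isotopy \<Lambda> \<psi>" and h: "\<And>t. smooth_fun \<Lambda> (h t)"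
    and vel: "\<And>t p. p \<in> torus \<Lambda> \<Longrightarrow> velocity \<Lambda> \<psi> t p = ham_field \<Lambda> (h t) (\<psi> t p)"
  shows "((\<lambda>s. omega p (dmap \<Lambda> (\<psi> s) (\<pi> x) v) (dmap \<Lambda> (\<psi> s) (\<pi> x) w)) has_real_derivative 0) (at s0)"
proof -
  have "\<exists>U F. (s0, x) \<in> U \<and> open U \<and> smooth_on U F \<and> (\<forall>(s, y)\<in>U. \<pi> (F (s, y)) = \<psi> s (\<pi> y))"
    using iso unfolding smooth_isotopy_def by blast
  then obtain U F where F: "isotopy_lift \<psi> U F" and sx: "(s0, x) \<in> U"
    unfolding isotopy_lift_def by blast
  have U: "open U" "smooth_on U F" "\<And>s y. (s, y) \<in> U \<Longrightarrow> \<pi> (F (s, y)) = \<psi> s (\<pi> y)"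
    using F unfolding isotopy_lift_def by auto
  define X where "X = (\<lambda>y. ham_field \<Lambda> (h s0) (\<pi> y))"
  have X: "smooth X" unfolding X_def by (rule ham_field_smooth[OF h])
  define A where "A v s = Df F (s, x) (0, v)" for v s
  have dA: "(A v has_derivative (\<lambda>r. r *\<^sub>R Df X (F (s0, x)) (A v s0))) (at s0)" for v
  proof -
    have "((\<lambda>s. (s, x)) has_derivative (\<lambda>r. (r, 0))) (at s0)" by (auto intro!: derivative_eq_intros)
    from has_derivative_compose[OF this smooth_on_has_derivative[OF smooth_on_frechet[OF U(2), of "(0, v)"] sx]]
    have "(A v has_derivative
        (\<lambda>r. Df (\<lambda>z. Df F z (0, v)) (s0, x) (r, 0))) (at s0)"
      by (simp add: A_def[abs_def])
    moreover have "Df (\<lambda>z. Df F z (0, v)) (s0, x) (r, 0) =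
        r *\<^sub>R Df X (F (s0, x)) (A v s0)" for r
    proof -
      let ?E = "\<lambda>z. Df F z (1, 0)"
      have "Df (\<lambda>z. Df F z (0, v)) (s0, x) (r, 0) =
          r *\<^sub>R Df (\<lambda>z. Df F z (0, v)) (s0, x) (1, 0)"
        using linear_scale[OF smooth_on_linear_frechet[OF smooth_on_frechet[OF U(2)] sx], of "(0, v)" r "(1, 0)"] by simp
      also have "Df (\<lambda>z. Df F z (0, v)) (s0, x) (1, 0) =
          Df ?E (s0, x) (0, v)"
        by (rule second_derivative_symmetric[OF U(2,1) sx])
      also have "\<dots> = Df (\<lambda>y. ?E (s0, y)) x v"
      proof -
        have "((\<lambda>y. (s0, y)) has_derivative (\<lambda>v. (0, v))) (at x)" by (auto intro!: derivative_eq_intros)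
        from frechet_derivative_eq[OF has_derivative_compose[OF this smooth_on_has_derivative[OF smooth_on_frechet[OF U(2)] sx]]]
        show ?thesis by simp
      qed
      also have "Df (\<lambda>y. ?E (s0, y)) x v = Df X (F (s0, x)) (A v s0)"
      proof -
        note L = isotopy_lift_slice(1)[OF F sx]
        have o: "open {y. (s0, y) \<in> U}" and s: "smooth_on {y. (s0, y) \<in> U} (\<lambda>y. F (s0, y))"
          using L by (auto simp: local_lift_def)
        have "((\<lambda>y. X (F (s0, y))) has_derivative
            (\<lambda>v. Df X (F (s0, x)) (Df (\<lambda>y. F (s0, y)) x v))) (at x)"
          by (rule has_derivative_compose[OF smooth_on_has_derivative[OF s] smooth_has_derivative[OF X]])
            (simp add: sx)
        then have "((\<lambda>y. ?E (s0, y)) has_derivative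
            (\<lambda>v. Df X (F (s0, x)) (Df (\<lambda>y. F (s0, y)) x v))) (at x)"
        proof (rule has_derivative_transform_within_open[OF _ o])
          show "x \<in> {y. (s0, y) \<in> U}" using sx by simp
          show "X (F (s0, y)) = ?E (s0, y)" if "y \<in> {y. (s0, y) \<in> U}" for y
            using velocity_eq[OF F, of s0 y] vel[OF proj_in_torus, of s0 y] U(3)[of s0 y] that by (simp add: X_def)
        qed
        from frechet_derivative_eq[OF this] show ?thesis
          by (simp add: A_def isotopy_lift_slice(2)[OF F sx])
      qed
      finally show ?thesis .
    qed
    ultimately show ?thesis by simp
  qed
  have "((\<lambda>s. omega p (A v s) (A w s)) has_derivative
      (\<lambda>r. omega p (A v s0) (r *\<^sub>R Df X (F (s0, x)) (A w s0)) +
        omega p (r *\<^sub>R Df X (F (s0, x)) (A v s0)) (A w s0))) (at s0)"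
    by (rule bounded_bilinear.FDERIV[OF omega_bounded_bilinear dA dA])
  then have d: "((\<lambda>s. omega p (A v s) (A w s)) has_real_derivative 0) (at s0)"
  proof (rule has_derivative_imp_has_field_derivative)
    fix r
    have "omega p (r *\<^sub>R a) b = r * omega p a b" "omega p a (r *\<^sub>R b) = r * omega p a b" for a b
      by (simp_all add: omega_coords algebra_simps)
    then show "r * 0 = omega p (A v s0) (r *\<^sub>R Df X (F (s0, x)) (A w s0)) +
        omega p (r *\<^sub>R Df X (F (s0, x)) (A v s0)) (A w s0)"
      using ham_field_infinitesimally_symplectic[OF h, of p s0 "F (s0, x)" "A v s0" "A w s0"]
      by (simp add: X_def distrib_left[symmetric] add.commute)
  qed
  have "open ((\<lambda>s. (s, x)) -` U)" using U(1) by (intro continuous_open_vimage continuous_intros)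
  then show ?thesis
    by (rule has_field_derivative_transform_within_open[OF d]) (use sx in \<open>simp_all add: A_def dmap_isotopy[OF F]\<close>)
qed

lemma isotopy_homotopic:
  assumes "smooth_isotopy \<Lambda> \<psi>"
  shows "homotopic_with (\<lambda>_. True) (torus_topology \<Lambda>) (torus_topology \<Lambda>) (\<psi> 0) (\<psi> 1)"
proof -
  have "torus_homotopy (\<lambda>z. \<psi> (fst z) (snd z))"
  proof (rule continuous_torus_homotopy)
    fix t x
    have "\<exists>U F. (t, x) \<in> U \<and> open U \<and> smooth_on U F \<and> (\<forall>(s, y)\<in>U. \<pi> (F (s, y)) = \<psi> s (\<pi> y))"
      using assms unfolding smooth_isotopy_def by blast
    then obtain U F where "(t, x) \<in> U" "open U" "smooth_on U F" "\<forall>(s, y)\<in>U. \<pi> (F (s, y)) = \<psi> s (\<pi> y)"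
      by blast
    then show "\<exists>W F. open W \<and> (t, x) \<in> W \<and> continuous_on W F \<and>
        (\<forall>(s, y)\<in>W. s \<in> {0..1} \<longrightarrow> \<pi> (F (s, y)) = \<psi> (fst (s, \<pi> y)) (snd (s, \<pi> y)))"
      by (intro exI[of _ U] exI[of _ F]) (auto dest: smooth_on_continuous_on)
  qed
  then show ?thesis unfolding homotopic_with_def by fastforce
qed

text \<open>The isotopy joins \<open>\<phi>\<close> to the identity, which preserves \<open>\<omega>\<close>.\<close>

lemma Ham_symplectic:
  assumes "\<phi> \<in> Ham \<Lambda>"
  shows "\<phi> \<in> Diff0 \<Lambda>" "omega p (dmap \<Lambda> \<phi> (\<pi> x) v) (dmap \<Lambda> \<phi> (\<pi> x) w) = omega p v w"
proof -
  obtain \<psi> h where h: "\<And>t. smooth_fun \<Lambda> (h t)" and iso: "smooth_isotopy \<Lambda> \<psi>"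
    and ends: "\<And>p. p \<in> torus \<Lambda> \<Longrightarrow> \<psi> 0 p = p" "\<And>p. p \<in> torus \<Lambda> \<Longrightarrow> \<psi> 1 p = \<phi> p"
    and vel: "\<And>t p. p \<in> torus \<Lambda> \<Longrightarrow> velocity \<Lambda> \<psi> t p = ham_field \<Lambda> (h t) (\<psi> t p)"
  proof -
    from assms obtain \<psi> h where *: "(\<forall>t. h t \<in> C0 \<Lambda>) \<and> smooth_isotopy \<Lambda> \<psi> \<and>
      (\<forall>p\<in>torus \<Lambda>. \<psi> 0 p = p \<and> \<psi> 1 p = \<phi> p) \<and>
      (\<forall>t. \<forall>p\<in>torus \<Lambda>. velocity \<Lambda> \<psi> t p = ham_field \<Lambda> (h t) (\<psi> t p))"
      unfolding Ham_def mem_Collect_eq by (elim exE conjE) (rule that, simp)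
    then have "smooth_fun \<Lambda> (h t)" for t by (simp add: C0_def)
    with * show thesis using that[of h \<psi>] by blast
  qed
  have "homotopic_with (\<lambda>_. True) (torus_topology \<Lambda>) (torus_topology \<Lambda>) (\<psi> 1) id"
    by (rule homotopic_with_eq[OF homotopic_with_symD[OF isotopy_homotopic[OF iso]]]) (auto simp: ends)
  then have 1: "\<psi> 1 \<in> Diff0 \<Lambda>"
    using iso by (simp add: Diff0_def smooth_isotopy_def)
  then show \<phi>: "\<phi> \<in> Diff0 \<Lambda>" using ends(2) by (rule Diff0_cong)
  obtain F G where F: "cover_diffeo F G" "lifts (\<psi> 1) F" using Diff0_imp_cover_diffeo[OF 1] .
  note Fs = cover_diffeo_smooth[OF F(1)]
  have "lifts \<phi> F" using F(2) ends(2) by (rule lifts_cong)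
  then have d1: "dmap \<Lambda> \<phi> (\<pi> x) v = dmap \<Lambda> (\<psi> 1) (\<pi> x) v" for v
    by (simp add: dmap_lift[OF _ Fs] F(2))
  have "lifts (\<psi> 0) (\<lambda>x. x)" by (simp add: lifts_def ends(1))
  then have d0: "dmap \<Lambda> (\<psi> 0) (\<pi> x) v = v" for v
    by (simp add: dmap_lift[OF _ smooth_on_id[OF open_UNIV]])
  let ?A = "\<lambda>s. omega p (dmap \<Lambda> (\<psi> s) (\<pi> x) v) (dmap \<Lambda> (\<psi> s) (\<pi> x) w)"
  have "?A 1 = ?A 0"
    by (rule DERIV_isconst_all) (intro allI omega_constant_along_flow[OF iso h vel])
  then show "omega p (dmap \<Lambda> \<phi> (\<pi> x) v) (dmap \<Lambda> \<phi> (\<pi> x) w) = omega p v w"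
    by (simp add: d1 d0)
qed

text \<open>The volume form is a multiple of \<open>\<omega> \<and> \<omega>\<close>.\<close>

lemma vol_preserving:
  assumes A: "linear A" and om: "\<And>v w. omega p (A v) (A w) = omega p v w"
  shows "det (matrix A) = 1"
proof -
  have "det (matrix A) = det (transpose (matrix A))" by simp
  also have "transpose (matrix A) = vector [A (e 1), A (e 2), A (e 3), A (e 4)]"
    by (simp add: vec_eq_iff forall_4 vector_4 transpose_def matrix_def)
  also have "det \<dots> = vol p (A (e 1)) (A (e 2)) (A (e 3)) (A (e 4))" by (simp add: vol_det)
  also have "\<dots> = vol p (e 1) (e 2) (e 3) (e 4)" by (simp add: vol_def wedge_def om)
  finally show ?thesis by (simp add: vol_standard_basis)
qed

lemma ham_invariant_L2_metric:
  "ham_invariant \<Lambda> (L2_metric \<Lambda>) (left_op qi) (left_op qj) (left_op qk)"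
  unfolding ham_invariant_def
proof (intro ballI conjI)
  fix \<phi> f assume \<phi>: "\<phi> \<in> Ham \<Lambda>" and f: "f \<in> Diff0 \<Lambda>"
  show "f \<circ> \<phi> \<in> Diff0 \<Lambda>" by (rule Diff0_compose[OF Ham_symplectic(1)[OF \<phi>] f])
  obtain F G where F: "cover_diffeo F G" "lifts \<phi> F"
    using Diff0_imp_cover_diffeo[OF Ham_symplectic(1)[OF \<phi>]] .
  note Fs = cover_diffeo_smooth[OF F(1)]
  have \<phi>F: "\<phi> (\<pi> x) = \<pi> (F x)" for x using F(2) by (simp add: lifts_def)
  have det: "\<bar>det (matrix (Df F x))\<bar> = 1" for x
    using vol_preserving[OF smooth_on_linear_frechet[OF Fs UNIV_I], of undefined x]
      Ham_symplectic(2)[OF \<phi>, of undefined x] by (simp add: dmap_lift[OF F(2) Fs])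
  fix u assume u: "u \<in> fields \<Lambda>"
  show "u \<circ> \<phi> \<in> fields \<Lambda>"
    using smooth_compose[OF fields_smooth[OF u] Fs] by (simp add: fields_def smooth_fun_def \<phi>F)
  show "L2_metric \<Lambda> (f \<circ> \<phi>) (u \<circ> \<phi>) (v \<circ> \<phi>) = L2_metric \<Lambda> f u v" if v: "v \<in> fields \<Lambda>" for v
    using integral_volume_preserving[OF F(1) det periodic_proj[of "\<lambda>p. u p \<bullet> v p"] continuous_field_inner[OF u v]]
    by (simp add: L2_metric_domain \<phi>F)
  fix A :: endo and p assume "A \<in> {left_op qi, left_op qj, left_op qk}"
  then show "A (f \<circ> \<phi>) (u \<circ> \<phi>) p = A f u (\<phi> p)" by (auto simp: left_op_def)
qed

end

section \<open>The moment maps\<close>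

context torus_lattice
begin

text \<open>For \<open>U = V\<close> the frame of partial derivatives of a map, this is the contraction of the pullback of
  \<open>\<omega>\<^sub>q\<close> with the bivector \<open>e1 \<and> e3 + e2 \<and> e4\<close>; two separate frames give its polarisation.  The forms
  are invariant under translations, so \<open>undefined\<close> serves as their base point.\<close>

definition contraction :: "quat \<Rightarrow> (4 \<Rightarrow> quat) \<Rightarrow> (4 \<Rightarrow> quat) \<Rightarrow> real" where
  "contraction q U V = omega_left q undefined (U 1) (V 3) + omega_left q undefined (U 2) (V 4)"

lemma pullback_wedge_omega:
  assumes f: "lifts f F" "smooth F" and q: "q \<in> {qi, qj, qk}"
  shows "wedge (pullback \<Lambda> f (omega_left q)) omega (\<pi> x) a b c d =
    - contraction q (\<lambda>i. Df F x (e i)) (\<lambda>i. Df F x (e i)) *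
      vol (\<pi> x) a b c d"
proof -
  interpret D: linear "Df F x"
    by (rule smooth_on_linear_frechet[OF f(2) UNIV_I])
  interpret W: bounded_bilinear "omega_left q p" for p by (rule omega_left_bounded_bilinear)
  have pb: "pullback \<Lambda> f (omega_left q) (\<pi> x) v w =
      omega_left q undefined (Df F x v) (Df F x w)" for v w
    by (simp add: pullback_def dmap_lift[OF f] omega_left_def)
  have "bilinear (pullback \<Lambda> f (omega_left q) (\<pi> x))"
    unfolding bilinear_def pb
    by (auto intro!: linearI simp: D.add D.scale W.add_left W.add_right W.scaleR_left W.scaleR_right)
  moreover have "pullback \<Lambda> f (omega_left q) (\<pi> x) v w = - pullback \<Lambda> f (omega_left q) (\<pi> x) w v" for v w
    unfolding pb by (rule omega_left_antisym[OF q])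
  ultimately show ?thesis
    unfolding contraction_def pb[symmetric] by (rule wedge_omega)
qed

lemma mu_lift:
  assumes "lifts f F" "smooth F" "q \<in> {qi, qj, qk}"
  shows "mu \<Lambda> q f (\<pi> x) =
    contraction q (\<lambda>i. Df F x (e i)) (\<lambda>i. Df F x (e i))"
  unfolding mu_def using div_vol_eq[of "wedge (pullback \<Lambda> f (omega_left q)) omega" "\<pi> x",
      OF pullback_wedge_omega[OF assms]] by simp

lemma dmap_compose:
  assumes "f \<in> Diff0 \<Lambda>" "\<phi> \<in> Diff0 \<Lambda>"
  shows "dmap \<Lambda> (f \<circ> \<phi>) (\<pi> x) v = dmap \<Lambda> f (\<phi> (\<pi> x)) (dmap \<Lambda> \<phi> (\<pi> x) v)"
proof -
  obtain F F' where F: "cover_diffeo F F'" "lifts f F" using Diff0_imp_cover_diffeo[OF assms(1)] .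
  obtain P P' where P: "cover_diffeo P P'" "lifts \<phi> P" using Diff0_imp_cover_diffeo[OF assms(2)] .
  have s: "smooth F" "smooth P" using F P by (auto simp: cover_diffeo_def)
  have "Df (\<lambda>x. F (P x)) x =
      (\<lambda>v. Df F (P x) (Df P x v))"
    by (rule frechet_derivative_eq[OF has_derivative_compose[OF smooth_has_derivative[OF s(2)]
            smooth_has_derivative[OF s(1)]]])
  moreover have "\<phi> (\<pi> x) = \<pi> (P x)" using P(2) by (simp add: lifts_def)
  ultimately show ?thesis
    using dmap_lift[OF lifts_compose[OF P(2) F(2)] smooth_compose[OF s]] dmap_lift[OF F(2) s(1)] dmap_lift[OF P(2) s(2)]
    by simp
qed

text \<open>Since \<open>\<phi>\<close> preserves \<open>\<omega>\<close> and \<open>vol\<close>, pulling back the \<open>4\<close>-form \<open>f\<^sup>* \<omega>\<^sub>q \<and> \<omega>\<close> gives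
  \<open>(f \<circ> \<phi>)\<^sup>* \<omega>\<^sub>q \<and> \<omega>\<close>.\<close>

lemma mu_equivariant:
  assumes f: "f \<in> Diff0 \<Lambda>" and \<phi>: "\<phi> \<in> Ham \<Lambda>" and p: "p \<in> torus \<Lambda>" and q: "q \<in> {qi, qj, qk}"
  shows "mu \<Lambda> q (f \<circ> \<phi>) p = mu \<Lambda> q f (\<phi> p)"
proof -
  obtain x where x: "p = \<pi> x" using p torusE by blast
  have \<phi>D: "\<phi> \<in> Diff0 \<Lambda>" by (rule Ham_symplectic(1)[OF \<phi>])
  obtain P P' where P: "cover_diffeo P P'" "lifts \<phi> P" using Diff0_imp_cover_diffeo[OF \<phi>D] .
  have \<phi>p: "\<phi> p = \<pi> (P x)" using P(2) by (simp add: lifts_def x)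
  obtain F F' where F: "cover_diffeo F F'" "lifts f F" using Diff0_imp_cover_diffeo[OF f] .
  note Fs = cover_diffeo_smooth[OF F(1)]
  let ?A = "dmap \<Lambda> \<phi> p"
  let ?r = "contraction q (\<lambda>i. Df F (P x) (e i)) (\<lambda>i. Df F (P x) (e i))"
  have om: "omega p v w = omega (\<phi> p) (?A v) (?A w)" for v w
    using Ham_symplectic(2)[OF \<phi>, of p x] by (simp add: x omega_def)
  have pb: "pullback \<Lambda> (f \<circ> \<phi>) (omega_left q) p v w = pullback \<Lambda> f (omega_left q) (\<phi> p) (?A v) (?A w)" for v w
    by (simp add: pullback_def x dmap_compose[OF f \<phi>D])
  have "wedge (pullback \<Lambda> (f \<circ> \<phi>) (omega_left q)) omega p a b c d = - ?r * vol p a b c d" for a b c d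
  proof -
    have "wedge (pullback \<Lambda> (f \<circ> \<phi>) (omega_left q)) omega p a b c d =
        wedge (pullback \<Lambda> f (omega_left q)) omega (\<phi> p) (?A a) (?A b) (?A c) (?A d)"
      unfolding wedge_def pb om ..
    also have "\<dots> = - ?r * vol (\<phi> p) (?A a) (?A b) (?A c) (?A d)"
      unfolding \<phi>p by (rule pullback_wedge_omega[OF F(2) Fs q])
    also have "vol (\<phi> p) (?A a) (?A b) (?A c) (?A d) = vol p a b c d"
      unfolding vol_def wedge_def om ..
    finally show ?thesis .
  qed
  from div_vol_eq[of "wedge (pullback \<Lambda> (f \<circ> \<phi>) (omega_left q)) omega", OF this]
  have "mu \<Lambda> q (f \<circ> \<phi>) p = ?r" by (simp add: mu_def)
  then show ?thesis by (simp add: \<phi>p mu_lift[OF F(2) Fs q])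
qed

lemma iter_deriv_affine:
  fixes g k :: "quat \<Rightarrow> real"
  assumes "smooth g" "smooth k"
  shows "iter_deriv vs (\<lambda>x. g x + t * k x) = (\<lambda>x. iter_deriv vs g x + t * iter_deriv vs k x)"
proof (induction vs)
  case (Cons v vs)
  have "((\<lambda>x. iter_deriv vs g x + t * iter_deriv vs k x) has_derivative
      (\<lambda>v. Df (iter_deriv vs g) x v + t * Df (iter_deriv vs k) x v)) (at x)" for x
    by (intro has_derivative_add has_derivative_mult_right
        smooth_has_derivative[OF smooth_on_iter_deriv[OF assms(1)]]
        smooth_has_derivative[OF smooth_on_iter_deriv[OF assms(2)]])
  from frechet_derivative_eq[OF this] show ?case by (simp add: Cons.IH)
qed simp

text \<open>All derivatives of the periodic remainder \<open>k\<close> are bounded, so \<open>t k\<close> tends to zero in the space of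
  smooth functions.\<close>

lemma Cinf_lim_affine:
  fixes g k :: "quat \<Rightarrow> real"
  assumes g: "smooth g" "periodic g" and k: "smooth k" "periodic k"
    and \<Phi>: "\<forall>\<^sub>F t in at 0. \<forall>x. \<Phi> t (\<pi> x) = g x + t * k x"
    and D: "\<And>x. D (\<pi> x) = g x"
  shows "Cinf_lim \<Lambda> \<Phi> D (at 0)"
proof -
  have lift: "\<forall>\<^sub>F t in at 0. (\<lambda>x. \<Phi> t (\<pi> x)) = (\<lambda>x. g x + t * k x)"
    using \<Phi> by eventually_elim auto
  have "uniform_limit UNIV (\<lambda>t. iter_deriv vs (\<lambda>x. \<Phi> t (\<pi> x))) (iter_deriv vs (\<lambda>x. D (\<pi> x))) (at 0)" for vs
  proof (rule uniform_limitI)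
    fix \<epsilon> :: real assume \<epsilon>: "0 < \<epsilon>"
    obtain C where C: "0 \<le> C" "\<And>x. norm (iter_deriv vs k x) \<le> C"
      using periodic_bounded[OF periodic_iter_deriv[OF k] smooth_on_continuous_on[OF smooth_on_iter_deriv[OF k(1)]]]
      by blast
    have "\<forall>\<^sub>F t in at 0. \<bar>t\<bar> < \<epsilon> / (C + 1)"
      using \<epsilon> C(1) by (auto simp: eventually_at dist_real_def intro!: exI[of _ "\<epsilon> / (C + 1)"])
    with lift show "\<forall>\<^sub>F t in at 0. \<forall>x\<in>UNIV.
        dist (iter_deriv vs (\<lambda>x. \<Phi> t (\<pi> x)) x) (iter_deriv vs (\<lambda>x. D (\<pi> x)) x) < \<epsilon>"
    proof eventually_elim
      case (elim t)
      have "\<bar>t * iter_deriv vs k x\<bar> < \<epsilon>" for x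
      proof -
        have "\<bar>t * iter_deriv vs k x\<bar> \<le> \<bar>t\<bar> * (C + 1)"
          using C(2)[of x] by (auto simp: abs_mult intro!: mult_left_mono)
        also have "\<dots> < \<epsilon>" using elim(2) C(1) by (simp add: field_simps)
        finally show ?thesis .
      qed
      then show ?case
        unfolding elim(1) D iter_deriv_affine[OF g(1) k(1)] by (simp add: dist_real_def)
    qed
  qed
  moreover have "\<forall>\<^sub>F t in at 0. smooth_fun \<Lambda> (\<Phi> t)"
    using lift
  proof eventually_elim
    case (elim t)
    show ?case unfolding smooth_fun_def elim
      by (intro smooth_on_add smooth_on_mult smooth_on_const g k open_UNIV)
  qed
  moreover have "smooth_fun \<Lambda> D" by (simp add: smooth_fun_def D g)
  ultimately show ?thesis by (simp add: Cinf_lim_def)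
qed

lemma smooth_contraction:
  assumes "\<And>i. smooth (\<lambda>x. U x i)" "\<And>i. smooth (\<lambda>x. V x i)"
  shows "smooth (\<lambda>x :: quat. contraction q (U x) (V x))"
  unfolding contraction_def
  by (intro smooth_on_add smooth_on_bilinear[OF _ omega_left_bounded_bilinear] assms open_UNIV)

lemma smooth_fun_mu:
  assumes f: "f \<in> Diff0 \<Lambda>" and q: "q \<in> {qi, qj, qk}"
  shows "smooth_fun \<Lambda> (mu \<Lambda> q f)"
proof -
  obtain F G where F: "cover_diffeo F G" "lifts f F" using Diff0_imp_cover_diffeo[OF f] .
  note Fs = cover_diffeo_smooth[OF F(1)]
  show ?thesis
    unfolding smooth_fun_def mu_lift[OF F(2) Fs q]
    by (intro smooth_contraction smooth_on_frechet Fs)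
qed

lemma equivariant_frechet_periodic:
  assumes "cover_diffeo F G"
  shows "periodic (\<lambda>x. Df F x v)"
proof -
  have F: "smooth F" "\<And>x l. l \<in> \<Lambda> \<Longrightarrow> F (x + l) = F x + l"
    using assms by (auto simp: cover_diffeo_def)
  have "Df F (x + l) = Df F x" if l: "l \<in> \<Lambda>" for x l
  proof -
    have "Df F (x + l) = Df (\<lambda>x. F (x + l)) x"
      by (rule frechet_derivative_translate[OF F(1), symmetric])
    also have "(\<lambda>x. F (x + l)) = (\<lambda>x. F x + l)" using F(2)[OF l] by auto
    also have "Df (\<lambda>x. F x + l) x = Df F x"
      using smooth_on_has_derivative[OF F(1) UNIV_I, of x]
      by (intro frechet_derivative_eq) (auto intro!: derivative_eq_intros)
    finally show ?thesis .
  qed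
  then show ?thesis by (simp add: periodic_def)
qed

lemma equivariant_frechet_inverse:
  assumes "cover_diffeo F G"
  shows "Df F (G y) (Df G y v) = v"
proof -
  have s: "smooth F" "smooth G" and FG: "\<And>x. F (G x) = x"
    using assms by (auto simp: cover_diffeo_def)
  have "((\<lambda>y. F (G y)) has_derivative (\<lambda>v. Df F (G y) (Df G y v))) (at y)"
    by (rule has_derivative_compose[OF smooth_has_derivative[OF s(2)] smooth_has_derivative[OF s(1)]])
  then have "((\<lambda>y. y) has_derivative (\<lambda>v. Df F (G y) (Df G y v))) (at y)" by (simp add: FG)
  from has_derivative_unique[OF this has_derivative_ident] show ?thesis by (rule fun_cong)
qed

lemma push_field:
  assumes "f \<in> Diff0 \<Lambda>" "Y \<in> fields \<Lambda>"
  shows "push \<Lambda> f Y \<in> fields \<Lambda>"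
proof -
  obtain F G where F: "cover_diffeo F G" "lifts f F" using Diff0_imp_cover_diffeo[OF assms(1)] .
  note Fs = cover_diffeo_smooth[OF F(1)]
  show ?thesis
    using smooth_on_frechet_field[OF open_UNIV Fs fields_smooth[OF assms(2)]]
    by (simp add: fields_def smooth_fun_def push_def dmap_lift[OF F(2) Fs])
qed

text \<open>\<open>mu\<close> is quadratic in the derivative of the map, so along the line \<open>f + t u\<close> it is a quadratic
  polynomial in \<open>t\<close>, whose linear coefficient is obtained by polarisation.\<close>

lemma mu_dir_deriv:
  assumes f: "f \<in> Diff0 \<Lambda>" and u: "u \<in> fields \<Lambda>" and q: "q \<in> {qi, qj, qk}"
    and F: "cover_diffeo F G" "lifts f F"
  defines "u' \<equiv> \<lambda>x i. Df (\<lambda>x. u (\<pi> x)) x (e i)"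
    and "F' \<equiv> \<lambda>x i. Df F x (e i)"
  obtains D where "has_dir_deriv \<Lambda> (mu \<Lambda> q) f u D"
    "\<And>x. D (\<pi> x) = contraction q (u' x) (F' x) + contraction q (F' x) (u' x)"
proof -
  note Fs = cover_diffeo_smooth[OF F(1)]
  have us: "smooth (\<lambda>x. u (\<pi> x))" by (rule fields_smooth[OF u])
  have F's: "smooth (\<lambda>x. F' x i)" and u's: "smooth (\<lambda>x. u' x i)" for i
    unfolding F'_def u'_def by (intro smooth_on_frechet Fs us)+
  have F'p: "F' (x + l) = F' x" and u'p: "u' (x + l) = u' x" if l: "l \<in> \<Lambda>" for x l
    using equivariant_frechet_periodic[OF F(1)] periodic_frechet[OF us periodic_proj] l
    unfolding F'_def u'_def periodic_def by auto
  let ?d = "\<lambda>x. contraction q (u' x) (F' x) + contraction q (F' x) (u' x)"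
  let ?Q = "\<lambda>x. contraction q (u' x) (u' x)"
  have dp: "periodic ?d" and Qp: "periodic ?Q" by (simp_all add: periodic_def F'p u'p)
  have ds: "smooth ?d" and Qs: "smooth ?Q"
    by (intro smooth_on_add smooth_contraction F's u's open_UNIV)+
  define D where "D p = ?d (SOME x. \<pi> x = p)" for p
  have D: "D (\<pi> x) = ?d x" for x
    unfolding D_def by (rule periodic_SOME[OF dp])
  have mu: "mu \<Lambda> q (shift f t u) (\<pi> x) = mu \<Lambda> q f (\<pi> x) + t * ?d x + t * t * ?Q x" for t x
  proof -
    have s: "smooth (\<lambda>x. F x + t *\<^sub>R u (\<pi> x))"
      by (intro smooth_on_add smooth_on_scaleR smooth_on_const Fs us open_UNIV)
    have "((\<lambda>x. F x + t *\<^sub>R u (\<pi> x)) has_derivative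
        (\<lambda>v. Df F x v + t *\<^sub>R Df (\<lambda>x. u (\<pi> x)) x v)) (at x)"
      by (intro has_derivative_add has_derivative_scaleR_right
          smooth_has_derivative[OF Fs] smooth_has_derivative[OF us])
    from frechet_derivative_eq[OF this]
    have "mu \<Lambda> q (shift f t u) (\<pi> x) = contraction q (\<lambda>i. F' x i + t *\<^sub>R u' x i) (\<lambda>i. F' x i + t *\<^sub>R u' x i)"
      by (simp add: mu_lift[OF lifts_shift[OF F(2)] s q] F'_def u'_def)
    also have "\<dots> = contraction q (F' x) (F' x) + t * ?d x + t * t * ?Q x"
    proof -
      interpret W: bounded_bilinear "omega_left q undefined" by (rule omega_left_bounded_bilinear)
      show ?thesis
        by (simp add: contraction_def W.add_left W.add_right W.scaleR_left W.scaleR_right algebra_simps)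
    qed
    finally show ?thesis by (simp add: mu_lift[OF F(2) Fs q] F'_def)
  qed
  have "Cinf_lim \<Lambda> (\<lambda>t p. (1 / t) *\<^sub>R (mu \<Lambda> q (shift f t u) p - mu \<Lambda> q f p)) D (at 0)"
  proof (rule Cinf_lim_affine[OF ds dp Qs Qp _ D])
    have "\<forall>\<^sub>F t in at 0. t \<noteq> (0::real)" by (simp add: eventually_at_filter)
    then show "\<forall>\<^sub>F t in at 0. \<forall>x. (1 / t) *\<^sub>R (mu \<Lambda> q (shift f t u) (\<pi> x) - mu \<Lambda> q f (\<pi> x)) = ?d x + t * ?Q x"
      by eventually_elim (simp add: mu field_simps)
  qed
  then have "has_dir_deriv \<Lambda> (mu \<Lambda> q) f u D"
    using shift_in_Diff0[OF f u] by (simp add: has_dir_deriv_def)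
  then show thesis using that D by blast
qed

text \<open>The derivative of the moment map is the contraction of \<open>d\<beta>\<close>, where \<open>\<beta> = \<omega>\<^sub>q(u, df)\<close>; integrating
  by parts against \<open>h\<close> moves the derivatives onto \<open>h\<close> and produces the components of its
  Hamiltonian field.\<close>

lemma moment_map_identity:
  assumes u: "u \<in> fields \<Lambda>" and q: "q \<in> {qi, qj, qk}" and h: "smooth_fun \<Lambda> h"
    and F: "cover_diffeo F G"
  defines "u' \<equiv> \<lambda>x i. Df (\<lambda>x. u (\<pi> x)) x (e i)"
    and "F' \<equiv> \<lambda>x i. Df F x (e i)"
  shows "(LINT x:domain|lborel. (contraction q (u' x) (F' x) + contraction q (F' x) (u' x)) * h (\<pi> x)) =
    (LINT x:domain|lborel. omega_left q undefined
       (Df F x (ham_field \<Lambda> h (\<pi> x))) (u (\<pi> x)))"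
proof -
  let ?w = "omega_left q undefined"
  interpret W: bounded_bilinear ?w by (rule omega_left_bounded_bilinear)
  have Fs: "smooth F" using F by (simp add: cover_diffeo_def)
  have us: "smooth (\<lambda>x. u (\<pi> x))" by (rule fields_smooth[OF u])
  let ?k = "\<lambda>x. h (\<pi> x)"
  have ks: "smooth ?k" using h by (simp add: smooth_fun_def)
  have kp: "periodic ?k" by (rule periodic_proj)
  define \<beta> where "\<beta> i x = ?w (u (\<pi> x)) (F' x i)" for i x
  have F's: "smooth (\<lambda>x. F' x i)" for i
    unfolding F'_def by (intro smooth_on_frechet Fs)
  have \<beta>s: "smooth (\<beta> i)" for i
    unfolding \<beta>_def[abs_def]
    by (rule smooth_on_bilinear[OF open_UNIV omega_left_bounded_bilinear us F's])
  have \<beta>p: "periodic (\<beta> i)" for i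
    using equivariant_frechet_periodic[OF F, of "e i"] by (simp add: \<beta>_def F'_def periodic_def)
  have \<beta>': "Df (\<beta> j) x (e i) =
      ?w (u (\<pi> x)) (Df (\<lambda>y. F' y j) x (e i)) + ?w (u' x i) (F' x j)" for i j x
    using frechet_derivative_eq[OF bounded_bilinear.FDERIV[OF omega_left_bounded_bilinear
          smooth_has_derivative[OF us] smooth_has_derivative[OF F's]]]
    by (simp add: \<beta>_def[abs_def] u'_def)
  have sym: "Df (\<lambda>y. F' y j) x (e i) = Df (\<lambda>y. F' y i) x (e j)" for i j x
    unfolding F'_def by (rule second_derivative_symmetric[OF Fs open_UNIV UNIV_I])
  let ?B = "\<lambda>i j x. Df (\<beta> j) x (e i)"
  let ?K = "\<lambda>i x. Df ?k x (e i)"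
  have d: "contraction q (u' x) (F' x) + contraction q (F' x) (u' x) = ?B 1 3 x - ?B 3 1 x + (?B 2 4 x - ?B 4 2 x)" for x
    using omega_left_antisym[OF q, of undefined "F' x 1" "u' x 3"] omega_left_antisym[OF q, of undefined "F' x 2" "u' x 4"]
    by (simp add: contraction_def \<beta>' sym[of 1 x 3] sym[of 2 x 4])
  have int: "set_integrable lborel domain (\<lambda>x. ?B i j x * ?k x)" for i j
    by (intro domain_integrable smooth_on_continuous_on smooth_on_mult smooth_on_frechet \<beta>s ks open_UNIV)
  have int': "set_integrable lborel domain (\<lambda>x. \<beta> j x * ?K i x)" for i j
    by (intro domain_integrable smooth_on_continuous_on smooth_on_mult smooth_on_frechet \<beta>s ks open_UNIV)
  have parts: "(LINT x:domain|lborel. ?B i j x * ?k x) = - (LINT x:domain|lborel. \<beta> j x * ?K i x)" for i j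
    by (rule integral_by_parts[OF \<beta>s \<beta>p ks kp])
  have X: "?w (Df F x (ham_field \<Lambda> h (\<pi> x))) (u (\<pi> x)) =
      \<beta> 1 x * ?K 3 x - \<beta> 3 x * ?K 1 x + (\<beta> 2 x * ?K 4 x - \<beta> 4 x * ?K 2 x)" for x
  proof -
    interpret D: linear "Df F x"
      by (rule smooth_on_linear_frechet[OF Fs UNIV_I])
    have "ham_field \<Lambda> h (\<pi> x) =
        (- ?K 3 x) *\<^sub>R e 1 + (- ?K 4 x) *\<^sub>R e 2 + ?K 1 x *\<^sub>R e 3 + ?K 2 x *\<^sub>R e 4"
      by (simp add: ham_field_gradient[OF h] gradient_def quat_eq_iff qmult_nth quat_units_nth axis_def)
    then have "Df F x (ham_field \<Lambda> h (\<pi> x)) =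
        (- ?K 3 x) *\<^sub>R F' x 1 + (- ?K 4 x) *\<^sub>R F' x 2 + ?K 1 x *\<^sub>R F' x 3 + ?K 2 x *\<^sub>R F' x 4"
      by (simp only: D.add D.scale F'_def)
    moreover have "?w (F' x i) (u (\<pi> x)) = - \<beta> i x" for i
      unfolding \<beta>_def by (rule omega_left_antisym[OF q])
    ultimately show ?thesis
      by (simp only: W.add_left W.scaleR_left) (simp add: algebra_simps)
  qed
  have "(LINT x:domain|lborel. (contraction q (u' x) (F' x) + contraction q (F' x) (u' x)) * ?k x) =
      (LINT x:domain|lborel. (?B 1 3 x * ?k x - ?B 3 1 x * ?k x) + (?B 2 4 x * ?k x - ?B 4 2 x * ?k x))"
    unfolding d by (simp add: algebra_simps)
  also have "\<dots> = (LINT x:domain|lborel. ?B 1 3 x * ?k x) - (LINT x:domain|lborel. ?B 3 1 x * ?k x) +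
      ((LINT x:domain|lborel. ?B 2 4 x * ?k x) - (LINT x:domain|lborel. ?B 4 2 x * ?k x))"
    by (simp only: set_integral_add(2)[OF set_integral_diff(1)[OF int int] set_integral_diff(1)[OF int int]]
        set_integral_diff(2)[OF int int])
  also have "\<dots> = (LINT x:domain|lborel. \<beta> 1 x * ?K 3 x) - (LINT x:domain|lborel. \<beta> 3 x * ?K 1 x) +
      ((LINT x:domain|lborel. \<beta> 2 x * ?K 4 x) - (LINT x:domain|lborel. \<beta> 4 x * ?K 2 x))"
    unfolding parts by simp
  also have "\<dots> = (LINT x:domain|lborel. \<beta> 1 x * ?K 3 x - \<beta> 3 x * ?K 1 x + (\<beta> 2 x * ?K 4 x - \<beta> 4 x * ?K 2 x))"
    by (simp only: set_integral_add(2)[OF set_integral_diff(1)[OF int' int'] set_integral_diff(1)[OF int' int']]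
        set_integral_diff(2)[OF int' int'])
  finally show ?thesis unfolding X .
qed

lemma moment_map_mu:
  assumes q: "q \<in> {qi, qj, qk}"
  shows "moment_map \<Lambda> (kaehler_form (L2_metric \<Lambda>) (left_op q)) (mu \<Lambda> q)"
  unfolding moment_map_def
proof (intro conjI ballI)
  fix f assume f: "f \<in> Diff0 \<Lambda>"
  show "smooth_fun \<Lambda> (mu \<Lambda> q f)" by (rule smooth_fun_mu[OF f q])
  fix Y assume Y: "Y \<in> fields \<Lambda>"
  let ?u = "push \<Lambda> f Y"
  have u: "?u \<in> fields \<Lambda>" by (rule push_field[OF f Y])
  obtain F G where F: "cover_diffeo F G" "lifts f F" using Diff0_imp_cover_diffeo[OF f] .
  note Fs = cover_diffeo_smooth[OF F(1)]
  obtain D where D: "has_dir_deriv \<Lambda> (mu \<Lambda> q) f ?u D"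
    "\<And>x. D (\<pi> x) =
      contraction q (\<lambda>i. Df (\<lambda>x. ?u (\<pi> x)) x (e i)) (\<lambda>i. Df F x (e i)) +
      contraction q (\<lambda>i. Df F x (e i)) (\<lambda>i. Df (\<lambda>x. ?u (\<pi> x)) x (e i))"
    using mu_dir_deriv[OF f u q F] by blast
  show "\<exists>D. has_dir_deriv \<Lambda> (mu \<Lambda> q) f ?u D \<and>
      (\<forall>h\<in>C0 \<Lambda>. kaehler_form (L2_metric \<Lambda>) (left_op q) f (push \<Lambda> f (ham_field \<Lambda> h)) ?u =
        torus_integral \<Lambda> (\<lambda>p. D p * h p))"
  proof (intro exI[of _ D] conjI ballI D(1))
    fix h assume "h \<in> C0 \<Lambda>"
    then have h: "smooth_fun \<Lambda> h" by (simp add: C0_def)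
    have "push \<Lambda> f (ham_field \<Lambda> h) (\<pi> x) = Df F x (ham_field \<Lambda> h (\<pi> x))" for x
      by (simp add: push_def dmap_lift[OF F(2) Fs])
    then show "kaehler_form (L2_metric \<Lambda>) (left_op q) f (push \<Lambda> f (ham_field \<Lambda> h)) ?u =
        torus_integral \<Lambda> (\<lambda>p. D p * h p)"
      using moment_map_identity[OF u q h F(1)]
      by (simp add: kaehler_form_def L2_metric_domain torus_integral_domain left_op_def omega_left_def D(2))
  qed
qed (rule mu_equivariant[OF _ _ _ q])

end

section \<open>The zeros of the moment maps\<close>

context torus_lattice
begin

text \<open>Integrals of \<open>2 \<times> 2\<close> minors of derivatives vanish, since the minors are divergences.\<close>

lemma integral_minor:
  fixes g k :: "quat \<Rightarrow> real"
  assumes g: "smooth g" "periodic g" and k: "smooth k" "periodic k"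
  shows "(LINT x:domain|lborel. Df g x a * Df k x b -
    Df g x b * Df k x a) = 0"
proof -
  have int: "set_integrable lborel domain (\<lambda>x. Df g x a * Df k x b)" for a b
    by (intro domain_integrable smooth_on_continuous_on smooth_on_mult smooth_on_frechet g k open_UNIV)
  have parts: "(LINT x:domain|lborel. Df g x a * Df k x b) =
      - (LINT x:domain|lborel. g x * Df (\<lambda>y. Df k y b) x a)" for a b
    by (rule integral_by_parts[OF g smooth_on_frechet[OF k(1)] periodic_frechet[OF k]])
  have sym: "Df (\<lambda>y. Df k y b) x a =
      Df (\<lambda>y. Df k y a) x b" for x
    by (rule second_derivative_symmetric[OF k(1) open_UNIV UNIV_I])
  show ?thesis
    unfolding set_integral_diff(2)[OF int int] parts sym by simp
qed

text \<open>The integral over the torus of \<open>d\<beta> \<and> d\<beta>\<close>, for a periodic \<open>1\<close>-form \<open>\<beta>\<close>, vanishes: its density is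
  a sum of minors.\<close>

lemma integral_exact_square:
  fixes \<beta> :: "4 \<Rightarrow> quat \<Rightarrow> real"
  assumes \<beta>: "\<And>i. smooth (\<beta> i)" "\<And>i. periodic (\<beta> i)"
  defines "\<gamma> \<equiv> \<lambda>i j x. Df (\<beta> j) x (e i) - Df (\<beta> i) x (e j)"
  shows "(LINT x:domain|lborel. \<gamma> 1 2 x * \<gamma> 3 4 x - \<gamma> 1 3 x * \<gamma> 2 4 x + \<gamma> 1 4 x * \<gamma> 2 3 x) = 0"
proof -
  define N where "N i j k l x = Df (\<beta> i) x (e k) * Df (\<beta> j) x (e l) -
      Df (\<beta> i) x (e l) * Df (\<beta> j) x (e k)" for i j k l x
  have int: "set_integrable lborel domain (N i j k l)" for i j k l
    unfolding N_def[abs_def]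
    by (intro domain_integrable smooth_on_continuous_on smooth_on_diff smooth_on_mult smooth_on_frechet \<beta> open_UNIV)
  have 0: "(LINT x:domain|lborel. N i j k l x) = 0" for i j k l
    unfolding N_def by (rule integral_minor[OF \<beta> \<beta>])
  have "\<gamma> 1 2 x * \<gamma> 3 4 x - \<gamma> 1 3 x * \<gamma> 2 4 x + \<gamma> 1 4 x * \<gamma> 2 3 x =
      (N 2 4 1 3 x - N 2 3 1 4 x) + ((N 1 3 2 4 x - N 1 4 2 3 x) - (N 1 2 3 4 x + N 3 4 1 2 x))" for x
    unfolding \<gamma>_def N_def by algebra
  moreover note i1 = set_integral_diff(1)[OF int int] and i2 = set_integral_add(1)[OF int int]
  ultimately show ?thesis
    by (simp only: set_integral_add(2)[OF i1 set_integral_diff(1)[OF i1 i2]] set_integral_diff(2)[OF i1 i2]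
        set_integral_diff(2)[OF int int] set_integral_add(2)[OF int int] 0)
qed

text \<open>A diffeomorphism isotopic to the identity pulls \<open>\<omega>\<close> back to a form that differs from \<open>\<omega>\<close> by the
  exact form \<open>d\<beta>\<close>, where \<open>\<beta>\<close> is built from the periodic displacement \<open>w\<close>.\<close>

lemma pullback_omega_exact:
  assumes G: "cover_diffeo G F"
  obtains \<beta> :: "4 \<Rightarrow> quat \<Rightarrow> real" where "\<And>i. smooth (\<beta> i)" "\<And>i. periodic (\<beta> i)"
    "\<And>i j x. omega undefined (Df G x (e i)) (Df G x (e j)) -
        omega undefined (e i) (e j) =
      Df (\<beta> j) x (e i) - Df (\<beta> i) x (e j)"
proof -
  interpret W: bounded_bilinear "omega undefined" by (rule omega_bounded_bilinear)
  have Gs: "smooth G" and Ge: "\<And>x l. l \<in> \<Lambda> \<Longrightarrow> G (x + l) = G x + l"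
    using G by (auto simp: cover_diffeo_def)
  define w where "w x = G x - x" for x
  have ws: "smooth w"
    unfolding w_def[abs_def] by (intro smooth_on_diff smooth_on_id Gs open_UNIV)
  have wp: "periodic w" by (simp add: periodic_def w_def Ge)
  let ?w' = "\<lambda>i x. Df w x (e i)"
  have G': "Df G x v = v + Df w x v" for x v
  proof -
    have "((\<lambda>x. x + w x) has_derivative (\<lambda>v. v + Df w x v)) (at x)"
      by (intro has_derivative_add has_derivative_ident smooth_has_derivative[OF ws])
    from frechet_derivative_eq[OF this] show ?thesis by (simp add: w_def)
  qed
  (* both occurrences of w in the second summand get differentiated, which the factor 1/2 compensates *)
  define \<beta> where "\<beta> i x = omega undefined (w x) (e i + (1/2) *\<^sub>R ?w' i x)" for i x
  have w's: "smooth (?w' i)" for i by (rule smooth_on_frechet[OF ws])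
  have cs: "smooth (\<lambda>x. e i + (1/2) *\<^sub>R ?w' i x)" for i
    by (intro smooth_on_add smooth_on_scaleR smooth_on_const w's open_UNIV)
  have \<beta>s: "smooth (\<beta> i)" for i
    unfolding \<beta>_def[abs_def] by (rule smooth_on_bilinear[OF open_UNIV omega_bounded_bilinear ws cs])
  have \<beta>p: "periodic (\<beta> i)" for i
    using wp periodic_frechet[OF ws wp] by (simp add: periodic_def \<beta>_def)
  have \<beta>': "Df (\<beta> j) x (e i) =
      omega undefined (w x) ((1/2) *\<^sub>R Df (?w' j) x (e i)) +
      omega undefined (?w' i x) (e j + (1/2) *\<^sub>R ?w' j x)" for i j x
  proof -
    have "((\<lambda>x. e j + (1/2) *\<^sub>R ?w' j x) has_derivative (\<lambda>v. (1/2) *\<^sub>R Df (?w' j) x v)) (at x)"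
      using has_derivative_add[OF has_derivative_const has_derivative_scaleR_right[OF smooth_has_derivative[OF w's]]]
      by simp
    from frechet_derivative_eq[OF bounded_bilinear.FDERIV[OF omega_bounded_bilinear smooth_has_derivative[OF ws] this]]
    show ?thesis by (simp add: \<beta>_def[abs_def])
  qed
  have sym: "Df (?w' j) x (e i) = Df (?w' i) x (e j)" for i j x
    by (rule second_derivative_symmetric[OF ws open_UNIV UNIV_I])
  have "omega undefined (Df G x (e i)) (Df G x (e j)) - omega undefined (e i) (e j) =
      Df (\<beta> j) x (e i) - Df (\<beta> i) x (e j)" for i j x
    unfolding \<beta>' G' sym[of j x i]
    using omega_antisym[of undefined "e i" "?w' j x"] omega_antisym[of undefined "?w' i x" "?w' j x"]
    by (simp add: W.add_left W.add_right W.scaleR_right)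
  then show thesis using that \<beta>s \<beta>p by blast
qed

lemma omega_left_wedge_omega:
  assumes "q \<in> {qi, qj, qk}"
  shows "wedge (omega_left q) omega p a b c d = 0"
  using assms by (auto simp: wedge_def omega_left_coords omega_coords algebra_simps)

text \<open>For symplectic \<open>f\<close> the form \<open>f\<^sup>* \<omega>\<^sub>q \<and> \<omega>\<close> is the pullback of \<open>\<omega>\<^sub>q \<and> \<omega>\<close>, which vanishes.\<close>

lemma Symp_imp_mu_zero:
  assumes f: "f \<in> Diff0 \<Lambda>" "f \<in> Symp \<Lambda>" and q: "q \<in> {qi, qj, qk}" and p: "p \<in> torus \<Lambda>"
  shows "mu \<Lambda> q f p = 0"
proof -
  have om: "omega p v w = omega (f p) (dmap \<Lambda> f p v) (dmap \<Lambda> f p w)" for v w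
    using f(2) p by (simp add: Symp_def pullback_def)
  have "wedge (pullback \<Lambda> f (omega_left q)) omega p a b c d = 0 * vol p a b c d" for a b c d
  proof -
    have "wedge (pullback \<Lambda> f (omega_left q)) omega p a b c d =
        wedge (omega_left q) omega (f p) (dmap \<Lambda> f p a) (dmap \<Lambda> f p b) (dmap \<Lambda> f p c) (dmap \<Lambda> f p d)"
      unfolding wedge_def om pullback_def ..
    then show ?thesis by (simp add: omega_left_wedge_omega[OF q])
  qed
  from div_vol_eq[of "wedge (pullback \<Lambda> f (omega_left q)) omega", OF this]
  show ?thesis by (simp add: mu_def)
qed

text \<open>If \<open>mu\<close> vanishes, then \<open>\<omega>\<^sub>q \<and> g\<^sup>* \<omega> = 0\<close> for the inverse \<open>g\<close> of \<open>f\<close>, so the exact form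
  \<open>g\<^sup>* \<omega> - \<omega>\<close> is anti-self-dual.  The density of its square is then minus a sum of squares with
  integral zero, so the form vanishes.\<close>

lemma mu_zero_imp_Symp:
  assumes f: "f \<in> Diff0 \<Lambda>" and 0: "\<And>q p. q \<in> {qi, qj, qk} \<Longrightarrow> p \<in> torus \<Lambda> \<Longrightarrow> mu \<Lambda> q f p = 0"
  shows "f \<in> Symp \<Lambda>"
proof -
  obtain F G where F: "cover_diffeo F G" "lifts f F" using Diff0_imp_cover_diffeo[OF f] .
  have G: "cover_diffeo G F" by (rule cover_diffeo_sym[OF F(1)])
  have s: "smooth F" "smooth G" and FG: "\<And>x. F (G x) = x" "\<And>x. G (F x) = x"
    using F(1) by (auto simp: cover_diffeo_def)
  let ?DF = "\<lambda>x. Df F x"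
  let ?DG = "\<lambda>y. Df G y"
  have DFG: "?DF (G y) (?DG y v) = v" and DGF: "?DG (F x) (?DF x v) = v" for x y v
    using equivariant_frechet_inverse[OF F(1)] equivariant_frechet_inverse[OF G] .
  define \<alpha> where "\<alpha> i j y = omega undefined (?DG y (e i)) (?DG y (e j))" for i j y
  (* the coefficient of the 4-form omega_left q \<and> g* omega, obtained by evaluating the vanishing form
     f* omega_left q \<and> omega on the images of the standard basis under the derivative of g *)
  have wz: "omega_left q undefined (e 1) (e 2) * \<alpha> 3 4 y - omega_left q undefined (e 1) (e 3) * \<alpha> 2 4 y
      + omega_left q undefined (e 1) (e 4) * \<alpha> 2 3 y + omega_left q undefined (e 2) (e 3) * \<alpha> 1 4 y
      - omega_left q undefined (e 2) (e 4) * \<alpha> 1 3 y + omega_left q undefined (e 3) (e 4) * \<alpha> 1 2 y = 0"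
    if q: "q \<in> {qi, qj, qk}" for q y
  proof -
    let ?p = "\<pi> (G y)"
    have "wedge (pullback \<Lambda> f (omega_left q)) omega ?p (?DG y (e 1)) (?DG y (e 2)) (?DG y (e 3)) (?DG y (e 4)) = 0"
      using 0[OF q, of ?p] by (simp add: pullback_wedge_omega[OF F(2) s(1) q] mu_lift[OF F(2) s(1) q])
    moreover have "pullback \<Lambda> f (omega_left q) ?p (?DG y v) (?DG y w) = omega_left q undefined v w" for v w
      by (simp add: pullback_def dmap_lift[OF F(2) s(1)] DFG omega_left_def)
    moreover have "omega ?p (?DG y (e i)) (?DG y (e j)) = \<alpha> i j y" for i j by (simp add: \<alpha>_def omega_def)
    ultimately show ?thesis by (simp add: wedge_def)
  qed
  have asd: "\<alpha> 3 4 y = - \<alpha> 1 2 y" "\<alpha> 2 4 y = \<alpha> 1 3 y" "\<alpha> 2 3 y = - \<alpha> 1 4 y" for y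
    using wz[of qi y] wz[of qj y] wz[of qk y] by (simp_all add: omega_left_coords axis_def)
  obtain \<beta> :: "4 \<Rightarrow> quat \<Rightarrow> real" where \<beta>: "\<And>i. smooth (\<beta> i)" "\<And>i. periodic (\<beta> i)"
    "\<And>i j x. omega undefined (?DG x (e i)) (?DG x (e j)) - omega undefined (e i) (e j) =
      Df (\<beta> j) x (e i) - Df (\<beta> i) x (e j)"
    using pullback_omega_exact[OF G] by blast
  define \<gamma> where "\<gamma> i j x = Df (\<beta> j) x (e i) - Df (\<beta> i) x (e j)" for i j x
  have \<gamma>: "\<gamma> i j x = \<alpha> i j x - omega undefined (e i) (e j)" for i j x
    by (simp add: \<gamma>_def \<alpha>_def \<beta>(3))
  have \<gamma>_asd: "\<gamma> 3 4 y = - \<gamma> 1 2 y" "\<gamma> 2 4 y = \<gamma> 1 3 y" "\<gamma> 2 3 y = - \<gamma> 1 4 y" for y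
    by (simp_all add: \<gamma> asd omega_coords axis_def)
  let ?S = "\<lambda>x. \<gamma> 1 2 x * \<gamma> 1 2 x + \<gamma> 1 3 x * \<gamma> 1 3 x + \<gamma> 1 4 x * \<gamma> 1 4 x"
  have \<gamma>s: "smooth (\<gamma> i j)" for i j
    unfolding \<gamma>_def[abs_def] by (intro smooth_on_diff smooth_on_frechet \<beta> open_UNIV)
  have \<gamma>p: "periodic (\<gamma> i j)" for i j
    using periodic_frechet[OF \<beta>(1,2)] by (simp add: periodic_def \<gamma>_def)
  have "(LINT x:domain|lborel. \<gamma> 1 2 x * \<gamma> 3 4 x - \<gamma> 1 3 x * \<gamma> 2 4 x + \<gamma> 1 4 x * \<gamma> 2 3 x) = 0"
    unfolding \<gamma>_def by (rule integral_exact_square[OF \<beta>(1,2)])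
  moreover have "\<gamma> 1 2 x * \<gamma> 3 4 x - \<gamma> 1 3 x * \<gamma> 2 4 x + \<gamma> 1 4 x * \<gamma> 2 3 x = - 1 * ?S x" for x
    by (simp add: \<gamma>_asd)
  ultimately have "(LINT x:domain|lborel. - 1 * ?S x) = 0" by simp
  then have S0: "(LINT x:domain|lborel. ?S x) = 0"
    by (simp only: set_integral_mult_right)
  have "?S x = 0" for x
  proof (rule integral_nonneg_eq_0[OF _ _ _ S0])
    show "periodic ?S" using \<gamma>p by (simp add: periodic_def)
    show "continuous_on UNIV ?S"
      by (intro smooth_on_continuous_on smooth_on_add smooth_on_mult \<gamma>s open_UNIV)
  qed simp
  then have z: "\<gamma> 1 2 x = 0" "\<gamma> 1 3 x = 0" "\<gamma> 1 4 x = 0" for x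
    by (metis (no_types, lifting) add_nonneg_eq_0_iff add_nonneg_nonneg mult_eq_0_iff zero_le_square)+
  have basis: "omega undefined (?DG y (e i)) (?DG y (e j)) = omega undefined (e i) (e j)" for i j y
  proof -
    have \<gamma>_anti: "\<gamma> i j y = - \<gamma> j i y" for i j by (simp add: \<gamma>_def)
    have up: "\<gamma> 2 3 y = 0" "\<gamma> 2 4 y = 0" "\<gamma> 3 4 y = 0" using \<gamma>_asd z by simp_all
    have "\<gamma> i j y = 0"
      using exhaust_4[of i] exhaust_4[of j] z up \<gamma>_anti[of i j] \<gamma>_anti[of i i] by auto
    then show ?thesis by (simp add: \<gamma> \<alpha>_def)
  qed
  have G_symp: "omega undefined (?DG y v) (?DG y w) = omega undefined v w" for y v w
  proof -
    interpret D: linear "?DG y" by (rule smooth_on_linear_frechet[OF s(2) UNIV_I])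
    interpret W: bounded_bilinear "omega undefined" by (rule omega_bounded_bilinear)
    have "omega undefined (?DG y v) (?DG y w) =
        omega undefined (?DG y (v$1 *\<^sub>R e 1 + v$2 *\<^sub>R e 2 + v$3 *\<^sub>R e 3 + v$4 *\<^sub>R e 4))
          (?DG y (w$1 *\<^sub>R e 1 + w$2 *\<^sub>R e 2 + w$3 *\<^sub>R e 3 + w$4 *\<^sub>R e 4))"
      using quat_basis[of v] quat_basis[of w] by metis
    also have "\<dots> = omega undefined (v$1 *\<^sub>R e 1 + v$2 *\<^sub>R e 2 + v$3 *\<^sub>R e 3 + v$4 *\<^sub>R e 4)
          (w$1 *\<^sub>R e 1 + w$2 *\<^sub>R e 2 + w$3 *\<^sub>R e 3 + w$4 *\<^sub>R e 4)"
      by (simp only: D.add D.scale W.add_left W.add_right W.scaleR_left W.scaleR_right basis)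
    also have "\<dots> = omega undefined v w" using quat_basis[of v] quat_basis[of w] by metis
    finally show ?thesis .
  qed
  have "pullback \<Lambda> f omega p v w = omega p v w" if p: "p \<in> torus \<Lambda>" for p v w
  proof -
    obtain x where x: "p = \<pi> x" using p torusE by blast
    show ?thesis
      using G_symp[of "F x" "?DF x v" "?DF x w"]
      by (simp add: x pullback_def dmap_lift[OF F(2) s(1)] DGF omega_def)
  qed
  then show ?thesis using f by (simp add: Symp_def Diff0_def)
qed

end

theorem theorem1p5:
  fixes \<Lambda> :: "quat set"
  assumes "full_lattice \<Lambda>"
  shows "hyperkaehler \<Lambda> (L2_metric \<Lambda>) (left_op qi) (left_op qj) (left_op qk) \<and>
    (\<forall>q\<in>{qi, qj, qk}. complex_structure \<Lambda> (right_op q) \<and>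
        compatible \<Lambda> (L2_metric \<Lambda>) (right_op q)) \<and>
    ham_invariant \<Lambda> (L2_metric \<Lambda>) (left_op qi) (left_op qj) (left_op qk) \<and>
    (\<forall>p\<in>torus \<Lambda>. \<forall>a b c d. vol p a b c d = det (vector [a, b, c, d] :: real^4^4)) \<and>
    (\<forall>q\<in>{qi, qj, qk}.
        moment_map \<Lambda> (kaehler_form (L2_metric \<Lambda>) (left_op q)) (mu \<Lambda> q)) \<and>
    {f \<in> Diff0 \<Lambda>. \<forall>q\<in>{qi, qj, qk}. \<forall>p\<in>torus \<Lambda>. mu \<Lambda> q f p = 0} = Diff0 \<Lambda> \<inter> Symp \<Lambda>"
proof -
  interpret torus_lattice \<Lambda> by unfold_locales (rule assms)
  have "{f \<in> Diff0 \<Lambda>. \<forall>q\<in>{qi, qj, qk}. \<forall>p\<in>torus \<Lambda>. mu \<Lambda> q f p = 0} = Diff0 \<Lambda> \<inter> Symp \<Lambda>"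
  proof (intro set_eqI iffI)
    fix f assume "f \<in> {f \<in> Diff0 \<Lambda>. \<forall>q\<in>{qi, qj, qk}. \<forall>p\<in>torus \<Lambda>. mu \<Lambda> q f p = 0}"
    then show "f \<in> Diff0 \<Lambda> \<inter> Symp \<Lambda>" using mu_zero_imp_Symp[of f] by blast
  next
    fix f assume "f \<in> Diff0 \<Lambda> \<inter> Symp \<Lambda>"
    then show "f \<in> {f \<in> Diff0 \<Lambda>. \<forall>q\<in>{qi, qj, qk}. \<forall>p\<in>torus \<Lambda>. mu \<Lambda> q f p = 0}"
      using Symp_imp_mu_zero[of f] by blast
  qed
  then show ?thesis
    by (intro conjI ballI allI hyperkaehler_L2_metric right_op_complex_structure L2_metric_compatible(2)
        ham_invariant_L2_metric vol_det moment_map_mu)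
qed

end
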